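(* Let $r\ge1$, let $N$ be a non-negative integer, and let $a,b_1,\dots,b_{r+2},x_1,\dots,x_r$ be nonzero complex parameters, generic subject to $a^2q=b_1\cdots b_{r+2}x_1\cdots x_r$. Then $$\sum_{\substack{k_1,\dots,k_r\ge0\\ |\mathbf k|\le N}}\frac{\Delta(\mathbf xq^{2\mathbf k};p)}{\Delta(\mathbf x;p)}\frac{(q^{-N},q^{N+1};q,p)_{|\mathbf k|}}{\prod_{i=1}^{r+2}(aq/b_i;q,p)_{|\mathbf k|}}q^{|\mathbf k|}$$ $$\times\prod_{i=1}^r\left(\frac{\theta(ax_iq^{|\mathbf k|+2k_i};p)}{\theta(ax_i;p)}\frac{(ax_i;q,p)_{|\mathbf k|}\prod_{j=1}^{r+2}(x_ib_j;q^2,p)_{k_i}}{(ax_iq^{N+2},ax_iq^{1-N};q^2,p)_{k_i}\prod_{j=1}^r(q^2x_i/x_j;q^2,p)_{k_i}}\right)$$ equals $$\prod_{i=1}^r\frac{(ax_iq^2;q^2,p)_m}{(q/ax_i;q^2,p)_m}\prod_{i=1}^{r+2}\frac{(b_iq/a;q^2,p)_m}{(aq^2/b_i;q^2,p)_m}\quad\text{if }N=2m,$$ and $$\prod_{i=1}^r\frac{(ax_iq;q^2,p)_m}{(1/ax_i;q^2,p)_m}\prod_{i=1}^{r+2}\frac{(b_i/a;q^2,p)_m}{(aq/b_i;q^2,p)_m}\quad\text{if }N=2m-1.$$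
   Context: $p,q$ are complex numbers with $|p|<1$, $q\ne0$, and $q^k\notin p^{\mathbb Z}$ for all integers $k>0$ (if $p=0$: $q^k\ne1$). For $x\ne0$, $\theta(x;p)=\prod_{j=0}^\infty(1-p^jx)(1-p^{j+1}/x)$. Elliptic shifted factorials: $(a;q,p)_k=\prod_{j=0}^{k-1}\theta(aq^j;p)$ for $k\in\mathbb Z_{\ge0}$ (similarly with base $q^2$), and $(a_1,\dots,a_m;q,p)_k=(a_1;q,p)_k\cdots(a_m;q,p)_k$. For $\mathbf k=(k_1,\dots,k_r)$, $|\mathbf k|=k_1+\cdots+k_r$. For $\mathbf x=(x_1,\dots,x_r)$, $\Delta(\mathbf x;p)=\prod_{1\le i<j\le r}x_j\theta(x_i/x_j;p)$, and $\mathbf xq^{2\mathbf k}=(x_1q^{2k_1},\dots,x_rq^{2k_r})$. In expressions such as $q/ax_i$, everything after the slash is in the denominator. All parameters are assumed generic so that no denominator vanishes. *)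

theory Defs
  imports "HOL-Analysis.Analysis"
begin

(* Meant for norm p < 1 and x \<noteq> 0; see theta_has_prod. The infinite product may vanish. For p = 0
   the convention 0 ^ 0 = 1 yields theta x 0 = 1 - x. *)
definition theta :: "complex \<Rightarrow> complex \<Rightarrow> complex" where
  "theta x p = (\<Prod>j. (1 - p ^ j * x) * (1 - p ^ (j + 1) / x))"

definition ellfact :: "complex \<Rightarrow> complex \<Rightarrow> complex \<Rightarrow> nat \<Rightarrow> complex" where
  "ellfact a q p k = (\<Prod>j<k. theta (a * q ^ j) p)"

definition Delta :: "nat \<Rightarrow> (nat \<Rightarrow> complex) \<Rightarrow> complex \<Rightarrow> complex" where
  "Delta r x p = (\<Prod>j=1..r. \<Prod>i=1..<j. x j * theta (x i / x j) p)"

(* Multi-indices are extensional functions on {1..r}, so that each (k_1, ..., k_r) occurs once. *)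
definition multi_indices :: "nat \<Rightarrow> nat \<Rightarrow> (nat \<Rightarrow> nat) set" where
  "multi_indices r N = {k \<in> {1..r} \<rightarrow>\<^sub>E UNIV. (\<Sum>i=1..r. k i) \<le> N}"

lemma finite_multi_indices: "finite (multi_indices r N)"
proof (rule finite_subset)
  show "multi_indices r N \<subseteq> {1..r} \<rightarrow>\<^sub>E {..N}"
  proof
    fix k assume k: "k \<in> multi_indices r N"
    have "k i \<le> N" if "i \<in> {1..r}" for i
      using member_le_sum[of i "{1..r}" k] that k unfolding multi_indices_def by force
    with k show "k \<in> {1..r} \<rightarrow>\<^sub>E {..N}"
      by (auto simp: multi_indices_def PiE_iff)
  qed
  show "finite ({1..r} \<rightarrow>\<^sub>E {..N})" by (simp add: finite_PiE)
qed

lemma theta_has_prod: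
  assumes "norm p < 1"
  shows "(\<lambda>j. (1 - p ^ j * x) * (1 - p ^ (j + 1) / x)) has_prod theta x p"
proof -
  have *: "summable (\<lambda>j. norm ((1 - p ^ j * c) - 1))" for c
    using assms by (simp add: norm_mult norm_power summable_mult2)
  have c: "convergent_prod (\<lambda>j. 1 - p ^ j * c)" for c
    by (rule abs_convergent_prod_imp_convergent_prod)
       (use *[of c] in \<open>simp add: summable_imp_abs_convergent_prod\<close>)
  have "convergent_prod (\<lambda>j. (1 - p ^ j * x) * (1 - p ^ j * (p / x)))"
    by (intro convergent_prod_mult c)
  then show ?thesis
    unfolding theta_def by (simp add: convergent_prod_has_prod mult.commute)
qed

end

theory Submission
  imports Defs "HOL-Complex_Analysis.Complex_Analysis"
begin

text \<open>
  Write $Q = q^2$ and replace $q^{-N}$ by a free parameter $c$. If $b_i = 1/(Q x_i)$ for $i \le r$,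
  only indices with $k_i \in \{0,1\}$ survive, and after clearing denominators both sides are
  sums of products of $r$ factors $\theta(\alpha c)\theta(\alpha q/c)$. These factors span a
  two-dimensional space, so Lagrange interpolation applies. At $c = 1$ only $k = 0$ contributes,
  and at $c = 1/(a x_i q)$ the condition $k_i = 1$ is forced, which is the same identity with
  $r - 1$ variables; this proves the case of $k_i \in \{0,1\}$ by induction on $r$. Specialising
  the variables to geometric strings $x_i, x_i Q, \ldots, x_i Q^{n_i - 1}$ gives the sum with
  $b_i = Q^{-n_i}/x_i$ for $i \le r$. For $c = q^{-N}$ both sides, as functions of $b_i$ with
  $b_i b_{r+2}$ fixed, are again determined by $N + 1$ values, and the points
  $b_i = Q^{-n}/x_i$, $0 \le n \le N$, remove the restrictions on $b_1, \ldots, b_r$ one at a time.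
  The genericity needed on the way is removed by perturbing $a$, $b_{r+1}$ and $b_{r+2}$.
\<close>

section \<open>The theta function\<close>

text \<open>The choice of variable is dictated by termination. While the b_i with i \<le> r cut the
  sum off, c is free and can serve for interpolation; for general b_i the sum stops only because c =
  q^{-N}, so c is frozen and the freedom left is to move b_i against b_{r+2} at constant product.
  The induction on r closes because the substitution c = 1/(a x_i q) sends (a, c) to (aq, a x_i q)
  and keeps the relation b_{r+1} b_{r+2} = a^2 q^{2r+1}, with r replaced by r - 1. The main obstacle
  is genericity. The hypotheses exclude zeros of the denominators for the given N, whereas
  interpolation needs nodes that stay apart modulo powers of p, and a itself moves along powers of
  q; hence whole double orbits q^Z p^Z are avoided first and a limit is taken at the end. The x_i
  need no perturbation: \<open>Delta\<close> and the factors (q^2 x_i/x_j; q^2, p)_k being nonzero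
  already separates the points x_i Q^s with s \<le> N. The complex analysis works with a compact
  annulus and needs p \<noteq> 0; for p = 0 the two-dimensional space consists of polynomials of
  degree at most one in c + t/c.\<close>

definition qpoch :: "complex \<Rightarrow> complex \<Rightarrow> complex" where
  "qpoch x p = (\<Prod>j. 1 - p ^ j * x)"

lemma qpoch_convergent:
  assumes "norm p < 1"
  shows "convergent_prod (\<lambda>j. 1 - p ^ j * x :: complex)"
proof -
  have "summable (\<lambda>j. norm ((1 - p ^ j * x) - 1))"
    using assms by (simp add: norm_mult norm_power summable_mult2)
  then show ?thesis
    by (intro abs_convergent_prod_imp_convergent_prod summable_imp_abs_convergent_prod)
qed

lemma qpoch_has_prod:
  assumes "norm p < 1"
  shows "(\<lambda>j. 1 - p ^ j * x) has_prod qpoch x p"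
  unfolding qpoch_def by (intro convergent_prod_has_prod qpoch_convergent assms)

lemma qpoch_eq_0_iff:
  assumes "norm p < 1"
  shows "qpoch x p = 0 \<longleftrightarrow> (\<exists>j. p ^ j * x = 1)"
  using has_prod_eq_0_iff[OF qpoch_has_prod[OF assms, of x]] by (simp add: image_iff eq_commute[of 1] eq_commute[of 0])

lemma qpoch_rec:
  assumes "norm p < 1"
  shows "qpoch x p = (1 - x) * qpoch (p * x) p"
proof -
  have "(\<lambda>j. 1 - p ^ Suc j * x) has_prod qpoch (p * x) p"
    using qpoch_has_prod[OF assms, of "p * x"] by (simp add: mult_ac)
  then have "(\<lambda>j. 1 - p ^ j * x) has_prod (qpoch (p * x) p * (1 - p ^ 0 * x))"
    by (rule has_prod_Suc_imp)
  then show ?thesis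
    using has_prod_unique2[OF qpoch_has_prod[OF assms, of x]] by (simp add: mult_ac)
qed

text \<open>On the closed unit ball around \<open>x\<close> the n-th factor differs from 1 by at
  most |p|^n (|x| + 1), so the partial products converge uniformly there. Holomorphy, not just
  continuity, is what the Liouville argument below consumes.\<close>

lemma qpoch_holomorphic:
  assumes p: "norm p < 1"
  shows "(\<lambda>x. qpoch x p) holomorphic_on UNIV"
proof (rule holomorphic_uniform_sequence)
  show "(\<lambda>x. \<Prod>j<n. 1 - p ^ j * x) holomorphic_on UNIV" for n
    by (intro holomorphic_intros)
  fix x :: complex
  have "uniformly_convergent_on (cball x 1) (\<lambda>N y. \<Sum>n<N. norm ((1 - p ^ n * y) - 1))"
  proof (rule Weierstrass_m_test'[of _ _ "\<lambda>n. norm p ^ n * (norm x + 1)"])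
    fix n y assume "y \<in> cball x 1"
    then have "norm y \<le> norm x + 1"
      using norm_triangle_ineq2[of y x] by (simp add: dist_norm norm_minus_commute)
    then show "norm (norm ((1 - p ^ n * y) - 1)) \<le> norm p ^ n * (norm x + 1)"
      by (simp add: norm_mult norm_power mult_left_mono)
  qed (use p in \<open>auto intro: summable_mult2\<close>)
  then have "uniformly_convergent_on (cball x 1) (\<lambda>N y. \<Prod>n<N. 1 - p ^ n * y)"
    by (intro uniformly_convergent_on_prod') (auto intro!: continuous_intros)
  then obtain g where g: "uniform_limit (cball x 1) (\<lambda>N y. \<Prod>n<N. 1 - p ^ n * y) g sequentially"
    by (auto simp: uniformly_convergent_on_def)
  have geq: "g y = qpoch y p" if "y \<in> cball x 1" for y
    using tendsto_uniform_limitI[OF g that] has_prod_imp_tendsto'[OF qpoch_has_prod[OF p, of y]]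
    by (rule LIMSEQ_unique)
  have "uniform_limit (cball x 1) (\<lambda>N y. \<Prod>n<N. 1 - p ^ n * y) (\<lambda>y. qpoch y p) sequentially
      \<longleftrightarrow> uniform_limit (cball x 1) (\<lambda>N y. \<Prod>n<N. 1 - p ^ n * y) g sequentially"
    by (rule uniform_limit_cong') (simp_all add: geq)
  with g show "\<exists>d>0. cball x d \<subseteq> UNIV \<and>
     uniform_limit (cball x d) (\<lambda>N y. \<Prod>n<N. 1 - p ^ n * y) (\<lambda>y. qpoch y p) sequentially"
    by (intro exI[of _ 1]) simp
qed auto

locale theta_base =
  fixes p :: complex
  assumes norm_p: "norm p < 1"
begin

abbreviation \<theta> :: "complex \<Rightarrow> complex" where
  "\<theta> x \<equiv> theta x p"

lemma theta_qpoch: "\<theta> x = qpoch x p * qpoch (p / x) p"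
proof -
  have "(\<lambda>j. (1 - p ^ j * x) * (1 - p ^ j * (p / x))) has_prod (qpoch x p * qpoch (p / x) p)"
    by (intro has_prod_mult qpoch_has_prod norm_p)
  then show ?thesis
    using has_prod_unique2[OF theta_has_prod[OF norm_p, of x]] by (simp add: mult_ac)
qed

text \<open>Splitting off the first factor of one product leaves (px; p)(p/x; p), which is invariant
  under x -> 1/x; only 1 - 1/x = -(1 - x)/x remains.\<close>

lemma theta_inverse:
  assumes "x \<noteq> 0"
  shows "\<theta> (1 / x) = - \<theta> x / x"
proof -
  have "\<theta> (1 / x) = (1 - 1 / x) * qpoch (p / x) p * qpoch (p * x) p"
    using qpoch_rec[OF norm_p, of "1 / x"] by (simp add: theta_qpoch)
  moreover have "\<theta> x = (1 - x) * qpoch (p * x) p * qpoch (p / x) p"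
    using qpoch_rec[OF norm_p, of x] by (simp add: theta_qpoch)
  ultimately show ?thesis
    using assms by (simp add: right_diff_distrib left_diff_distrib diff_divide_distrib)
qed

lemma theta_minus_swap:
  assumes "x \<noteq> 0" "y \<noteq> 0"
  shows "\<theta> (x / y) = - (x / y) * \<theta> (y / x)"
  using theta_inverse[of "y / x"] assms by simp

lemma theta_1 [simp]: "\<theta> 1 = 0"
  using theta_inverse[of 1] by simp

lemma theta_p_mult:
  assumes "p \<noteq> 0" "x \<noteq> 0"
  shows "\<theta> (p * x) = - \<theta> x / x"
proof -
  have "\<theta> (p * x) = qpoch (p * x) p * qpoch (1 / x) p"
    using assms by (simp add: theta_qpoch)
  also have "\<dots> = \<theta> (1 / x)"
    by (simp add: theta_qpoch)
  finally show ?thesis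
    using theta_inverse[OF assms(2)] by simp
qed

text \<open>The form with \<open>powi\<close> also covers p = 0: then \<open>p powi n\<close> is 1
  for n = 0 and 0 for every other n, so for x \<noteq> 0 the condition reads x = 1.\<close>

lemma theta_eq_0_iff:
  assumes "x \<noteq> 0"
  shows "\<theta> x = 0 \<longleftrightarrow> (\<exists>n. x = p powi n)"
proof
  assume "\<theta> x = 0"
  then consider j where "p ^ j * x = 1" | j where "p ^ j * (p / x) = 1"
    by (auto simp: theta_qpoch qpoch_eq_0_iff[OF norm_p])
  then show "\<exists>n. x = p powi n"
  proof cases
    case (1 j)
    then have "x = p powi (- int j)"
      using assms by (simp add: power_int_minus nonzero_eq_divide_eq divide_inverse[symmetric] inverse_eq_divide)
        (metis mult.commute nonzero_eq_divide_eq mult_zero_left zero_neq_one)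
    then show ?thesis ..
  next
    case (2 j)
    then have "x = p powi (int (Suc j))"
      using assms unfolding power_int_of_nat by (auto simp: field_simps)
    then show ?thesis ..
  qed
next
  assume "\<exists>n. x = p powi n"
  then obtain n where n: "x = p powi n" ..
  show "\<theta> x = 0"
  proof (cases "n \<le> 0")
    case True
    then have "p ^ nat (- n) * x = 1"
      using n assms by (cases "n = 0"; cases "p = 0") (auto simp: power_int_def power_0_left simp flip: power_mult_distrib split: if_splits)
    then show ?thesis
      by (auto simp: theta_qpoch qpoch_eq_0_iff[OF norm_p])
  next
    case False
    then have "x = p ^ (nat (n - 1)) * p"
      using n by (auto simp: power_int_def nat_diff_distrib simp flip: power_Suc2)
    then have "p ^ (nat (n - 1)) * (p / x) = 1"
      using assms by simp
    then show ?thesis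
      by (auto simp: theta_qpoch qpoch_eq_0_iff[OF norm_p])
  qed
qed

lemma theta_holomorphic [holomorphic_intros]:
  assumes "f holomorphic_on A" "\<And>x. x \<in> A \<Longrightarrow> f x \<noteq> 0"
  shows "(\<lambda>x. \<theta> (f x)) holomorphic_on A"
proof -
  have *: "(\<lambda>x. qpoch (g x) p) holomorphic_on A" if "g holomorphic_on A" for g
    using holomorphic_on_compose_gen[OF that qpoch_holomorphic[OF norm_p]] by (simp add: o_def)
  show ?thesis
    unfolding theta_qpoch by (intro holomorphic_intros * assms)
qed

lemma tendsto_theta [tendsto_intros]:
  assumes "(f \<longlongrightarrow> c) F" "c \<noteq> 0"
  shows "((\<lambda>x. \<theta> (f x)) \<longlongrightarrow> \<theta> c) F"
proof -
  have "(\<lambda>x. \<theta> x) holomorphic_on - {0}"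
    by (intro holomorphic_intros) auto
  then have "isCont (\<lambda>x. \<theta> x) c"
    using assms(2) by (intro continuous_on_interior[OF holomorphic_on_imp_continuous_on])
      (auto simp: interior_open open_Compl)
  then show ?thesis
    using assms(1) isCont_tendsto_compose by blast
qed

text \<open>All zeros are simple. At 1 this is visible from the factor 1 - x, and quasi-periodicity
  carries it to every power of p.\<close>

lemma deriv_theta_nonzero:
  assumes "x \<noteq> 0" "\<theta> x = 0" "p \<noteq> 0"
  obtains D where "((\<lambda>x. \<theta> x) has_field_derivative D) (at x)" "D \<noteq> 0"
proof -
  have hol: "(\<lambda>x. \<theta> x) holomorphic_on - {0}"
    by (intro holomorphic_intros) auto
  define T where "T = deriv (\<lambda>x. \<theta> x)"
  have T: "((\<lambda>x. \<theta> x) has_field_derivative T x) (at x)" if "x \<noteq> 0" for x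
    using hol that unfolding T_def by (auto intro!: holomorphic_derivI[of _ "- {0}"])
  have 1: "T 1 \<noteq> 0"
  proof -
    have eq: "\<theta> x = (1 - x) * (qpoch (p * x) p * qpoch (p / x) p)" for x
      using qpoch_rec[OF norm_p, of x] by (simp add: theta_qpoch)
    define E where "E = (\<lambda>x. qpoch (p * x) p * qpoch (p / x) p)"
    have *: "(\<lambda>x. qpoch (g x) p) holomorphic_on A" if "g holomorphic_on A" for g A
      using holomorphic_on_compose_gen[OF that qpoch_holomorphic[OF norm_p]] by (simp add: o_def)
    have "E holomorphic_on - {0}"
      unfolding E_def by (intro holomorphic_intros *) auto
    then have "(E has_field_derivative deriv E 1) (at 1)"
      by (auto intro!: holomorphic_derivI[of _ "- {0}"])
    then have "((\<lambda>x. (1 - x) * E x) has_field_derivative (- E 1)) (at 1)"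
      by (auto intro!: derivative_eq_intros)
    then have "((\<lambda>x. \<theta> x) has_field_derivative (- E 1)) (at 1)"
      unfolding eq E_def .
    then have "T 1 = - E 1"
      using DERIV_unique[OF T[of 1]] by simp
    moreover have "E 1 \<noteq> 0"
    proof -
      have "p ^ j * p \<noteq> 1" for j
      proof
        assume "p ^ j * p = 1"
        then have "norm p ^ Suc j = 1"
          by (metis norm_one norm_power power_Suc2)
        moreover have "norm p ^ Suc j < 1"
          using norm_p power_Suc_less_one[of "norm p" j] \<open>p \<noteq> 0\<close> by auto
        ultimately show False by simp
      qed
      then show ?thesis
        unfolding E_def by (simp add: qpoch_eq_0_iff[OF norm_p])
    qed
    ultimately show ?thesis by simp
  qed
  \<comment> \<open>Differentiating \<theta>(px) = -\<theta>(x)/x at a zero, the term with \<theta>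
    itself drops out and the two derivatives become proportional.\<close>
  have step: "T (p * y) = - T y / (p * y)" if y: "y \<noteq> 0" "\<theta> y = 0" for y
  proof -
    have "((\<lambda>x. \<theta> (p * x)) has_field_derivative (T (p * y) * p)) (at y)"
      using T[of "p * y"] y \<open>p \<noteq> 0\<close> by (intro DERIV_chain2[where f = "\<lambda>x. \<theta> x"]) (auto intro!: derivative_eq_intros)
    moreover have "((\<lambda>x. - \<theta> x / x) has_field_derivative (- T y / y)) (at y)"
      using T[of y] y by (auto intro!: derivative_eq_intros simp: field_simps)
    then have "((\<lambda>x. \<theta> (p * x)) has_field_derivative (- T y / y)) (at y)"
      by (rule has_field_derivative_transform_within_open[where S = "- {0}"])
        (use y \<open>p \<noteq> 0\<close> in \<open>auto simp: theta_p_mult\<close>)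
    ultimately have "T (p * y) * p = - T y / y"
      by (rule DERIV_unique)
    then show ?thesis
      using \<open>p \<noteq> 0\<close> y by (simp add: divide_simps mult_ac)
  qed
  obtain n where n: "x = p powi n"
    using assms(2) theta_eq_0_iff[OF assms(1)] by auto
  have z: "\<theta> (p powi m) = 0" for m
    using theta_eq_0_iff[of "p powi m"] \<open>p \<noteq> 0\<close> by auto
  have "T (p powi n) \<noteq> 0"
  proof (induction n rule: int_induct[where k = 0])
    case base
    then show ?case using 1 by simp
  next
    case (step1 i)
    then show ?case
      using step[of "p powi i"] z[of i] \<open>p \<noteq> 0\<close> by (simp add: power_int_add mult.commute)
  next
    case (step2 i)
    then show ?case
      using step[of "p powi (i - 1)"] z[of "i - 1"] \<open>p \<noteq> 0\<close>
      by (simp add: power_int_diff)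
  qed
  then show ?thesis
    using that[OF T[OF assms(1)]] n by simp
qed

section \<open>Interpolation by theta functions\<close>

text \<open>A theta function of degree two in c, symmetric under c -> t/c. For fixed t these
  functions span a two-dimensional space; for p = 0 it is spanned by 1 and c + t/c.\<close>

definition tpair :: "complex \<Rightarrow> complex \<Rightarrow> complex \<Rightarrow> complex" where
  "tpair t \<alpha> c = \<theta> (\<alpha> * c) * \<theta> (\<alpha> * t / c)"

text \<open>The multiplier does not depend on \<alpha>. Linear combinations therefore obey the same
  law, and quotients of two such functions are p-invariant.\<close>

lemma tpair_p_mult:
  assumes "p \<noteq> 0" "c \<noteq> 0" "t \<noteq> 0" "\<alpha> \<noteq> 0"
  shows "tpair t \<alpha> (p * c) = t / (p * c\<^sup>2) * tpair t \<alpha> c"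
proof -
  define y where "y = \<alpha> * t / (p * c)"
  have y: "y \<noteq> 0" "p * y = \<alpha> * t / c"
    using assms by (auto simp: y_def)
  have "\<theta> (p * y) = - \<theta> y / y"
    by (rule theta_p_mult) (use assms y in auto)
  then have "\<theta> y = - y * \<theta> (\<alpha> * t / c)"
    using y by (simp add: field_simps)
  moreover have "\<theta> (\<alpha> * (p * c)) = - \<theta> (\<alpha> * c) / (\<alpha> * c)"
    using theta_p_mult[of "\<alpha> * c"] assms by (simp add: mult_ac)
  ultimately show ?thesis
    using assms by (simp add: tpair_def y_def[symmetric]) (simp add: y_def power2_eq_square divide_simps)
qed

lemma tpair_reflect: "c \<noteq> 0 \<Longrightarrow> t \<noteq> 0 \<Longrightarrow> tpair t \<alpha> (t / c) = tpair t \<alpha> c"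
  by (simp add: tpair_def)

text \<open>The annulus |p| \<le> |z| \<le> 1 is a fundamental domain for multiplication by p, up to
  its boundary; in logarithms, finding n is rounding to an integer.\<close>

lemma p_power_annulus:
  assumes "p \<noteq> 0" "c \<noteq> 0"
  obtains n :: int where "norm p \<le> norm (p powi n * c)" "norm (p powi n * c) \<le> 1"
proof -
  define L where "L = ln (norm p)"
  have L: "L < 0"
    using norm_p assms by (simp add: L_def)
  define n where "n = \<lceil>- ln (norm c) / L\<rceil>"
  have ln: "ln (norm (p powi n * c)) = of_int n * L + ln (norm c)"
    using assms by (simp add: norm_mult norm_power_int ln_mult ln_powr L_def flip: powr_real_of_int')
  have "- ln (norm c) / L \<le> of_int n" "of_int n \<le> - ln (norm c) / L + 1"
    unfolding n_def by linarith+
  then have "of_int n * L \<le> - ln (norm c)" "- ln (norm c) + L \<le> of_int n * L"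
    using L by (simp_all add: field_simps)
  then have "ln (norm (p powi n * c)) \<le> ln 1" "L \<le> ln (norm (p powi n * c))"
    using ln by simp_all
  moreover have "norm (p powi n * c) > 0" "norm p > 0"
    using assms by auto
  ultimately have "norm p \<le> norm (p powi n * c)" "norm (p powi n * c) \<le> 1"
    unfolding L_def by (simp_all add: ln_le_cancel_iff)
  then show ?thesis by (rule that)
qed

text \<open>Invariance makes the maximum over a compact annulus a bound on the whole punctured
  plane. The singularity at 0 is then removable and Liouville applies.\<close>

lemma p_invariant_constant:
  assumes p: "p \<noteq> 0" and hol: "f holomorphic_on - {0}"
    and inv: "\<And>c. c \<noteq> 0 \<Longrightarrow> f (p * c) = f c"
  obtains K where "\<And>c. c \<noteq> 0 \<Longrightarrow> f c = K"
proof -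
  have invi: "f (p powi n * c) = f c" if "c \<noteq> 0" for n c
  proof (induction n rule: int_induct[where k = 0])
    case base
    then show ?case by simp
  next
    case (step1 i)
    then show ?case
      using inv[of "p powi i * c"] that p by (simp add: power_int_add mult_ac)
  next
    case (step2 i)
    then show ?case
      using inv[of "p powi (i - 1) * c"] that p by (simp add: power_int_diff)
  qed
  define A where "A = cball 0 1 - ball (0::complex) (norm p)"
  have "compact A"
    unfolding A_def by (intro compact_diff) auto
  moreover have "A \<subseteq> - {0}"
    using p by (auto simp: A_def)
  ultimately have "compact (f ` A)"
    using holomorphic_on_imp_continuous_on[OF hol] continuous_on_subset compact_continuous_image by blast
  then obtain B where B: "\<And>z. z \<in> A \<Longrightarrow> norm (f z) \<le> B"
    using compact_imp_bounded[of "f ` A"] unfolding bounded_iff by blast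
  have B': "norm (f c) \<le> B" if c: "c \<noteq> 0" for c
  proof -
    obtain n where "norm p \<le> norm (p powi n * c)" "norm (p powi n * c) \<le> 1"
      using p_power_annulus[OF p c] .
    then have "norm (f (p powi n * c)) \<le> B"
      by (intro B) (auto simp: A_def)
    then show ?thesis
      using invi[OF c] by simp
  qed
  have "\<exists>B. eventually (\<lambda>z. norm (f z) \<le> B) (at 0)"
    using B' by (intro exI[of _ B]) (auto simp: eventually_at_filter)
  moreover have "f holomorphic_on (UNIV - {0})"
    using hol by (simp add: Compl_eq_Diff_UNIV)
  ultimately obtain g where g: "g holomorphic_on UNIV" "\<And>z. z \<noteq> 0 \<Longrightarrow> g z = f z"
    using holomorphic_on_extend_bounded[of f UNIV 0] by auto
  have "norm (g z) \<le> max B (norm (g 0))" for z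
    using B'[of z] g(2)[of z] by (cases "z = 0") auto
  then have "bounded (range g)"
    unfolding bounded_iff by blast
  then obtain K where "\<And>z. g z = K"
    using Liouville_theorem[OF g(1)] by (auto simp: constant_on_def)
  then show ?thesis
    using g(2) that by metis
qed

text \<open>The zeros of \<^term>\<open>tpair t (1 / c1)\<close> are simple and shared by $f$, so the quotient extends to a
  $p$-invariant holomorphic function, which is bounded.\<close>

lemma theta_quotient_constant:
  assumes p: "p \<noteq> 0" and t: "t \<noteq> 0" and c1: "c1 \<noteq> 0"
    and hol: "f holomorphic_on - {0}"
    and qp: "\<And>c. c \<noteq> 0 \<Longrightarrow> f (p * c) = t / (p * c\<^sup>2) * f c"
    and f0: "f c1 = 0" "f (t / c1) = 0"
    and simple: "\<theta> (c1\<^sup>2 / t) \<noteq> 0"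
  obtains K where "\<And>c. c \<noteq> 0 \<Longrightarrow> f c = K * tpair t (1 / c1) c"
proof -
  define g where "g = tpair t (1 / c1)"
  have g_alt: "g c = \<theta> (c / c1) * \<theta> (t / (c1 * c))" for c
    by (simp add: g_def tpair_def)
  have holg: "g holomorphic_on - {0}"
    unfolding g_alt using c1 t by (auto intro!: holomorphic_intros)
  have fz: "f (p powi n * c) = 0" if "c \<noteq> 0" "f c = 0" for n c
  proof (induction n rule: int_induct[where k = 0])
    case base
    then show ?case using that by simp
  next
    case (step1 i)
    then show ?case
      using qp[of "p powi i * c"] that p by (simp add: power_int_add mult_ac)
  next
    case (step2 i)
    then show ?case
      using qp[of "p powi (i - 1) * c"] that p t by (simp add: power_int_diff)
  qed
  \<comment> \<open>The zeros of the two factors of \<open>g\<close> form the orbits of c1 and of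
    t/c1 under powers of p. A common zero would make c1^2/t a power of p, against
    \<open>simple\<close>; so every zero of \<open>g\<close> is simple.\<close>
  have nz2: False if c: "c \<noteq> 0" and z: "\<theta> (c / c1) = 0" "\<theta> (t / (c1 * c)) = 0" for c
  proof -
    obtain n where "c / c1 = p powi n"
      using c z c1 theta_eq_0_iff[of "c / c1"] by auto
    moreover obtain m where "t / (c1 * c) = p powi m"
      using c z c1 t theta_eq_0_iff[of "t / (c1 * c)"] by auto
    moreover have "c1\<^sup>2 / t = inverse (c / c1 * (t / (c1 * c)))"
      using c c1 t by (simp add: field_simps power2_eq_square)
    ultimately have "c1\<^sup>2 / t = p powi (- (n + m))"
      using p by (simp add: power_int_diff power_int_minus field_simps)
    then have "\<theta> (c1\<^sup>2 / t) = 0"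
      using c1 t p by (subst theta_eq_0_iff) auto
    then show False
      using simple by simp
  qed
  have zero: "\<exists>D. (g has_field_derivative D) (at c) \<and> D \<noteq> 0 \<and> f c = 0" if c: "c \<noteq> 0" and gz: "g c = 0" for c
  proof -
    have dth: "\<exists>E. ((\<lambda>x. \<theta> x) has_field_derivative E) (at x)" if "x \<noteq> 0" for x
    proof -
      have "(\<lambda>x. \<theta> x) holomorphic_on - {0}"
        by (intro holomorphic_intros) auto
      then show ?thesis
        using holomorphic_derivI[of "\<lambda>x. \<theta> x" "- {0}" x UNIV] that by auto
    qed
    consider "\<theta> (c / c1) = 0" | "\<theta> (t / (c1 * c)) = 0"
      using gz g_alt by auto
    then show ?thesis
    proof cases
      case 1
      obtain D where D: "((\<lambda>x. \<theta> x) has_field_derivative D) (at (c / c1))" "D \<noteq> 0"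
        using deriv_theta_nonzero[of "c / c1"] 1 c c1 p by auto
      obtain E where E: "((\<lambda>x. \<theta> x) has_field_derivative E) (at (t / (c1 * c)))"
        using dth[of "t / (c1 * c)"] c c1 t by auto
      have "((\<lambda>c. \<theta> (c / c1)) has_field_derivative (D * (1 / c1))) (at c)"
        by (rule DERIV_chain2[where f = "\<lambda>x. \<theta> x"], rule D(1)) (use c1 in \<open>auto intro!: derivative_eq_intros\<close>)
      moreover have "((\<lambda>c. \<theta> (t / (c1 * c))) has_field_derivative (E * (- (t * c1) / (c1 * c)\<^sup>2))) (at c)"
        by (rule DERIV_chain2[where f = "\<lambda>x. \<theta> x"], rule E) (use c1 c in \<open>auto intro!: derivative_eq_intros simp: power2_eq_square\<close>)
      ultimately have "(g has_field_derivative (D * (1 / c1) * \<theta> (t / (c1 * c)) + E * (- (t * c1) / (c1 * c)\<^sup>2) * \<theta> (c / c1))) (at c)"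
        unfolding g_alt by (rule DERIV_mult)
      moreover obtain n where "c / c1 = p powi n"
        using 1 c c1 theta_eq_0_iff[of "c / c1"] by auto
      then have "c = p powi n * c1"
        using c1 by (simp add: field_simps)
      then have "f c = 0"
        using fz[OF c1 f0(1)] by simp
      ultimately show ?thesis
        using 1 D(2) c1 nz2[OF c 1] by (auto intro!: exI)
    next
      case 2
      obtain D where D: "((\<lambda>x. \<theta> x) has_field_derivative D) (at (t / (c1 * c)))" "D \<noteq> 0"
        using deriv_theta_nonzero[of "t / (c1 * c)"] 2 c c1 p t by auto
      obtain E where E: "((\<lambda>x. \<theta> x) has_field_derivative E) (at (c / c1))"
        using dth[of "c / c1"] c c1 t by auto
      have "((\<lambda>c. \<theta> (c / c1)) has_field_derivative (E * (1 / c1))) (at c)"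
        by (rule DERIV_chain2[where f = "\<lambda>x. \<theta> x"], rule E) (use c1 in \<open>auto intro!: derivative_eq_intros\<close>)
      moreover have "((\<lambda>c. \<theta> (t / (c1 * c))) has_field_derivative (D * (- (t * c1) / (c1 * c)\<^sup>2))) (at c)"
        by (rule DERIV_chain2[where f = "\<lambda>x. \<theta> x"], rule D(1)) (use c1 c in \<open>auto intro!: derivative_eq_intros simp: power2_eq_square\<close>)
      ultimately have "(g has_field_derivative (E * (1 / c1) * \<theta> (t / (c1 * c)) + D * (- (t * c1) / (c1 * c)\<^sup>2) * \<theta> (c / c1))) (at c)"
        unfolding g_alt by (rule DERIV_mult)
      moreover obtain n where "t / (c1 * c) = p powi n"
        using 2 c c1 t theta_eq_0_iff[of "t / (c1 * c)"] by auto
      then have "c = p powi (- n) * (t / c1)"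
        using c1 c t p by (simp add: field_simps power_int_minus)
      then have "f c = 0"
        using fz[OF _ f0(2), of "- n"] c1 t by simp
      ultimately show ?thesis
        using 2 D(2) c1 t c nz2[OF c _ 2] by (auto intro!: exI)
    qed
  qed
  define G where "G = (\<lambda>c. f c / g c)"
  \<comment> \<open>At a zero of \<open>g\<close> the numerator vanishes as well and the derivative
    of \<open>g\<close> does not, so l'Hopital's rule gives a finite limit.\<close>
  have lim: "\<exists>L. (G \<longlongrightarrow> L) (at c)" if c: "c \<noteq> 0" for c
  proof (cases "g c = 0")
    case True
    then obtain D where D: "(g has_field_derivative D) (at c)" "D \<noteq> 0" "f c = 0"
      using zero[OF c] by blast
    have "(f has_field_derivative deriv f c) (at c)"
      using hol c by (auto intro!: holomorphic_derivI[of _ "- {0}"])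
    from lhopital_complex_simple[OF this D(1) D(3) True D(2) refl] show ?thesis
      unfolding G_def by blast
  next
    case False
    have "isCont f c" "isCont g c"
      using holomorphic_on_imp_continuous_on[OF hol] holomorphic_on_imp_continuous_on[OF holg] c
      by (auto simp: continuous_on_eq_continuous_at open_Compl)
    then have "(G \<longlongrightarrow> f c / g c) (at c)"
      unfolding G_def using False by (intro tendsto_divide) (auto simp: isCont_def)
    then show ?thesis by blast
  qed
  have sing: "isolated_singularity_at G c" if c: "c \<noteq> 0" for c
    unfolding G_def
    by (intro isolated_singularity_at_divide isolated_singularity_at_holomorphic[of _ "- {0}"]
        not_essential_holomorphic[of _ "- {0}"] holomorphic_on_subset[OF hol] holomorphic_on_subset[OF holg])
      (use c in auto)
  define \<Phi> where "\<Phi> = remove_sings G"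
  have G_lim: "(G \<longlongrightarrow> \<Phi> c) (at c)" if c: "c \<noteq> 0" for c
    using lim[OF c] remove_sings_eqI unfolding \<Phi>_def by metis
  have "\<Phi> analytic_on {c}" if "c \<noteq> 0" for c
    unfolding \<Phi>_def using remove_sings_analytic_at[OF sing[OF that] G_lim[OF that]] .
  then have hol\<Phi>: "\<Phi> holomorphic_on - {0}"
    by (intro analytic_imp_holomorphic, subst analytic_on_analytic_at) auto
  have inv: "\<Phi> (p * c) = \<Phi> c" if c: "c \<noteq> 0" for c
  proof -
    have "filterlim (\<lambda>w. p * w) (at (p * c)) (at c)"
      unfolding filterlim_at using p
      by (auto intro!: tendsto_eq_intros simp: eventually_at_filter)
    then have "((\<lambda>w. G (p * w)) \<longlongrightarrow> \<Phi> (p * c)) (at c)"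
      using G_lim[of "p * c"] c p filterlim_compose by fastforce
    moreover have "eventually (\<lambda>w. G (p * w) = G w) (at c)"
    proof -
      have "eventually (\<lambda>w. w \<in> - {0}) (at c)"
        using c by (intro eventually_at_in_open') auto
      then show ?thesis
      proof eventually_elim
        case (elim w)
        then show ?case
          using qp[of w] tpair_p_mult[of w t "1 / c1"] p t c1 by (simp add: G_def g_def)
      qed
    qed
    ultimately have "(G \<longlongrightarrow> \<Phi> (p * c)) (at c)"
      using Lim_transform_eventually by fast
    then show ?thesis
      using G_lim[OF c] LIM_unique by blast
  qed
  obtain K where K: "\<And>c. c \<noteq> 0 \<Longrightarrow> \<Phi> c = K"
    using p_invariant_constant[OF p hol\<Phi> inv] by metis
  have "f c = K * g c" if c: "c \<noteq> 0" for c
  proof (cases "g c = 0")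
    case True
    then show ?thesis using zero[OF c] by auto
  next
    case False
    have "isCont f c" "isCont g c"
      using holomorphic_on_imp_continuous_on[OF hol] holomorphic_on_imp_continuous_on[OF holg] c
      by (auto simp: continuous_on_eq_continuous_at open_Compl)
    then have "(G \<longlongrightarrow> f c / g c) (at c)"
      unfolding G_def using False by (intro tendsto_divide) (auto simp: isCont_def)
    then have "f c / g c = \<Phi> c"
      using G_lim[OF c] LIM_unique by blast
    then show ?thesis
      using K[OF c] False by (simp add: field_simps)
  qed
  then show ?thesis
    using that unfolding g_def by blast
qed

text \<open>A form of Weierstrass's three-term relation, written as Lagrange interpolation at c0 and
  c1. For p \<noteq> 0 the difference of the two sides vanishes at c1 and t/c1, hence is a multiple
  of \<open>tpair t (1 / c1)\<close>; its vanishing at c0 forces the factor to be 0. For p = 0 it is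
  linear interpolation in c + t/c.\<close>

lemma tpair_span:
  assumes t: "t \<noteq> 0" and nz: "\<alpha> \<noteq> 0" "c0 \<noteq> 0" "c1 \<noteq> 0" "c \<noteq> 0"
    and simple: "\<theta> (c1\<^sup>2 / t) \<noteq> 0" and dist: "\<theta> (c0 / c1) \<noteq> 0" "\<theta> (c0 * c1 / t) \<noteq> 0"
  shows "tpair t \<alpha> c = tpair t \<alpha> c0 * (tpair t (1 / c1) c / tpair t (1 / c1) c0)
    + tpair t \<alpha> c1 * (tpair t (1 / c0) c / tpair t (1 / c0) c1)"
proof (cases "p = 0")
  case True
  have th: "\<theta> x = 1 - x" for x
    using theta_qpoch[of x] qpoch_rec[OF norm_p, of x] True by (simp add: qpoch_def)
  define X where "X = (\<lambda>c. c + t / c)"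
  have T: "tpair t \<beta> u = 1 - \<beta> * X u + \<beta>\<^sup>2 * t" if "u \<noteq> 0" for \<beta> u
    using that by (simp add: tpair_def th X_def field_simps power2_eq_square)
  have T1: "tpair t (1 / v) u = (X v - X u) / v" if "u \<noteq> 0" "v \<noteq> 0" for u v
    using that T[of u "1 / v"] by (simp add: X_def field_simps power2_eq_square)
  have "tpair t (1 / c1) c0 \<noteq> 0"
    using dist nz t by (auto simp: tpair_def th mult.commute)
  then have X01: "X c0 - X c1 \<noteq> 0"
    using T1[of c0 c1] nz by auto
  have ratios: "(X c1 - X c) / c1 / ((X c1 - X c0) / c1) = (X c - X c1) / (X c0 - X c1)"
    "(X c0 - X c) / c0 / ((X c0 - X c1) / c0) = (X c0 - X c) / (X c0 - X c1)"
    using nz by (simp_all add: minus_divide_divide[symmetric, of "X c - X c1"])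
  have interp: "1 - \<alpha> * z + \<alpha>\<^sup>2 * t = (1 - \<alpha> * z0 + \<alpha>\<^sup>2 * t) * ((z - z1) / (z0 - z1))
      + (1 - \<alpha> * z1 + \<alpha>\<^sup>2 * t) * ((z0 - z) / (z0 - z1))" if "z0 - z1 \<noteq> 0" for z z0 z1
    using that unfolding times_divide_eq_right add_divide_distrib[symmetric]
    by (subst nonzero_eq_divide_eq) (auto simp: algebra_simps)
  show ?thesis
    unfolding T1[OF nz(4,2)] T1[OF nz(4,3)] T1[OF nz(2,3)] T1[OF nz(3,2)] ratios
    unfolding T[OF nz(2)] T[OF nz(3)] T[OF nz(4)]
    by (rule interp[OF X01])
next
  case False
  have d: "tpair t (1 / c1) c0 \<noteq> 0" "tpair t (1 / c0) c1 \<noteq> 0"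
    using dist theta_minus_swap[of c0 c1] theta_minus_swap[of t "c0 * c1"] nz t
    by (auto simp: tpair_def mult_ac)
  define f where "f = (\<lambda>c. tpair t \<alpha> c - tpair t \<alpha> c0 * (tpair t (1 / c1) c / tpair t (1 / c1) c0)
    - tpair t \<alpha> c1 * (tpair t (1 / c0) c / tpair t (1 / c0) c1))"
  have hol: "tpair t \<beta> holomorphic_on - {0}" if "\<beta> \<noteq> 0" for \<beta>
    unfolding tpair_def using that t by (auto intro!: holomorphic_intros)
  have z: "tpair t (1 / u) u = 0" if "u \<noteq> 0" for u
    using that by (simp add: tpair_def)
  obtain K where K: "\<And>c. c \<noteq> 0 \<Longrightarrow> f c = K * tpair t (1 / c1) c"
  proof (rule theta_quotient_constant[OF False t nz(3) _ _ _ _ simple, of f])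
    show "f holomorphic_on - {0}"
      unfolding f_def using nz d by (intro holomorphic_intros hol) auto
    show "f (p * c) = t / (p * c\<^sup>2) * f c" if "c \<noteq> 0" for c
    proof -
      have "tpair t \<beta> (p * c) = t / (p * c\<^sup>2) * tpair t \<beta> c" if "\<beta> \<noteq> 0" for \<beta>
        using tpair_p_mult[OF False \<open>c \<noteq> 0\<close> t that] .
      from this[OF nz(1)] this[of "1 / c1"] this[of "1 / c0"] show ?thesis
        using nz unfolding f_def by (simp add: right_diff_distrib mult.left_commute)
    qed
    show "f c1 = 0"
      unfolding f_def using d nz by (simp add: z)
    then show "f (t / c1) = 0"
      unfolding f_def using nz t by (simp add: tpair_reflect)
  qed blast
  moreover have "f c0 = 0"
    unfolding f_def using d nz by (simp add: z)
  ultimately have "K = 0"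
    using d nz by fastforce
  then have "f c = 0"
    using K[OF nz(4)] by simp
  then show ?thesis
    by (simp add: f_def algebra_simps)
qed

text \<open>The functions of $c$ obtained from products of $n$ factors \<^const>\<open>tpair\<close>; only their values at $c \neq 0$ matter.\<close>

inductive tspace :: "complex \<Rightarrow> nat \<Rightarrow> (complex \<Rightarrow> complex) \<Rightarrow> bool" for t where
  tspace_const: "tspace t 0 (\<lambda>_. k)"
| tspace_times_tpair: "tspace t n f \<Longrightarrow> \<alpha> \<noteq> 0 \<Longrightarrow> tspace t (Suc n) (\<lambda>c. f c * tpair t \<alpha> c)"
| tspace_add: "tspace t n f \<Longrightarrow> tspace t n g \<Longrightarrow> tspace t n (\<lambda>c. f c + g c)"
| tspace_cong: "tspace t n f \<Longrightarrow> (\<And>c. c \<noteq> 0 \<Longrightarrow> g c = f c) \<Longrightarrow> tspace t n g"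

lemma tspace_mult:
  assumes "tspace t m f" "tspace t n g"
  shows "tspace t (m + n) (\<lambda>c. f c * g c)"
  using assms(1)
proof induction
  case (tspace_const k)
  \<comment> \<open>Constants are generators in degree 0 only, so scaling an element of higher
    degree takes an induction over the second factor.\<close>
  show ?case
    using assms(2)
  proof induction
    case (tspace_const l)
    show ?case
      using tspace.tspace_const[of t "k * l"] by simp
  next
    case (tspace_times_tpair n f \<alpha>)
    then show ?case
      using tspace.tspace_times_tpair[of t "0 + n" "\<lambda>c. k * f c" \<alpha>] by (simp add: mult.assoc)
  next
    case (tspace_add n f g)
    then show ?case
      using tspace.tspace_add[of t "0 + n" "\<lambda>c. k * f c" "\<lambda>c. k * g c"] by (simp add: distrib_left)
  next
    case (tspace_cong n f g)
    then show ?case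
      using tspace.tspace_cong[of t "0 + n" "\<lambda>c. k * f c" "\<lambda>c. k * g c"] by simp
  qed
next
  case (tspace_times_tpair n' f \<alpha>)
  then show ?case
    using tspace.tspace_times_tpair[of t "n' + n" "\<lambda>c. f c * g c" \<alpha>] by (simp add: mult_ac)
next
  case (tspace_add n' f h)
  then show ?case
    using tspace.tspace_add[of t "n' + n" "\<lambda>c. f c * g c" "\<lambda>c. h c * g c"] by (simp add: distrib_right)
next
  case (tspace_cong n' f h)
  then show ?case
    using tspace.tspace_cong[of t "n' + n" "\<lambda>c. f c * g c" "\<lambda>c. h c * g c"] by simp
qed

lemma tspace_tpair: "\<alpha> \<noteq> 0 \<Longrightarrow> tspace t 1 (tpair t \<alpha>)"
  using tspace_times_tpair[OF tspace_const[of t 1], of \<alpha>] by simp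

lemma tspace_scale: "tspace t n f \<Longrightarrow> tspace t n (\<lambda>c. k * f c)"
  using tspace_mult[OF tspace_const[of t k]] by simp

lemma tspace_prod:
  assumes "\<And>i. i \<in> A \<Longrightarrow> tspace t (d i) (f i)"
  shows "tspace t (\<Sum>i\<in>A. d i) (\<lambda>c. \<Prod>i\<in>A. f i c)"
proof (cases "finite A")
  case True
  then show ?thesis
    using assms
    by (induction A rule: finite_induct)
      (auto intro!: tspace_const tspace_mult)
next
  case False
  then show ?thesis by (simp add: tspace_const)
qed

text \<open>In degree n the zero function is obtained as 0 times a product of n pairs; it is needed
  for empty sums.\<close>

lemma tspace_zero: "tspace t n (\<lambda>_. 0)"
proof -
  have "tspace t (\<Sum>i<n. 1) (\<lambda>c. \<Prod>i<n. tpair t 1 c)"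
    by (intro tspace_prod tspace_tpair) simp
  then show ?thesis
    using tspace_scale[of t n _ 0] by simp
qed

lemma tspace_sum:
  assumes "\<And>i. i \<in> A \<Longrightarrow> tspace t n (f i)"
  shows "tspace t n (\<lambda>c. \<Sum>i\<in>A. f i c)"
proof (cases "finite A")
  case True
  then show ?thesis
    using assms
    by (induction A rule: finite_induct)
      (auto intro!: tspace_zero tspace_add)
next
  case False
  then show ?thesis by (simp add: tspace_zero)
qed

text \<open>The points and their reflections t/u are to be distinct modulo powers of p. The case u =
  v of the first condition says that no point is its own reflection, which is the simplicity
  hypothesis of \<open>tpair_span\<close>.\<close>

definition nodes :: "complex \<Rightarrow> complex set \<Rightarrow> bool" where
  "nodes t U \<longleftrightarrow> finite U \<and> 0 \<notin> U \<and> (\<forall>u\<in>U. \<forall>v\<in>U. \<theta> (u * v / t) \<noteq> 0 \<and> (u \<noteq> v \<longrightarrow> \<theta> (u / v) \<noteq> 0))"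

lemma nodes_subset: "nodes t U \<Longrightarrow> V \<subseteq> U \<Longrightarrow> nodes t V"
  unfolding nodes_def by (meson finite_subset subsetD)

lemma tpair_nodes_nonzero:
  assumes "nodes t U" "u \<in> U" "v \<in> U" "u \<noteq> v" "t \<noteq> 0"
  shows "tpair t (1 / v) u \<noteq> 0"
proof -
  have "u \<noteq> 0" "v \<noteq> 0" "\<theta> (u / v) \<noteq> 0" "\<theta> (u * v / t) \<noteq> 0"
    using assms unfolding nodes_def by auto
  then show ?thesis
    using theta_minus_swap[of t "u * v"] assms(5) by (auto simp: tpair_def mult_ac)
qed

lemma tspace_lagrange:
  assumes "tspace t n f" and t: "t \<noteq> 0" and "nodes t U" "card U = Suc n" and "c \<noteq> 0"
  shows "f c = (\<Sum>u\<in>U. f u * (\<Prod>v\<in>U - {u}. tpair t (1 / v) c / tpair t (1 / v) u))"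
  using assms(1,3-5)
proof (induction arbitrary: U c)
  case (tspace_const k)
  then obtain u where "U = {u}"
    using card_1_singletonE by auto
  then show ?case by simp
next
  case (tspace_times_tpair n f \<alpha>)
  let ?w = "\<lambda>v c. tpair t (1 / v) c"
  let ?h = "tpair t \<alpha>"
  have fin: "finite U" and nz: "\<And>u. u \<in> U \<Longrightarrow> u \<noteq> 0"
    using tspace_times_tpair.prems unfolding nodes_def by auto
  obtain m where m: "m \<in> U"
    using tspace_times_tpair.prems by fastforce
  define V where "V = U - {m}"
  have V: "nodes t V" "card V = Suc n" "finite V" "m \<notin> V" "U = insert m V"
    using tspace_times_tpair.prems m fin nodes_subset[of t U V] by (auto simp: V_def)
  have w: "?w v u \<noteq> 0" if "u \<in> U" "v \<in> U" "u \<noteq> v" for u v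
    using tpair_nodes_nonzero tspace_times_tpair.prems that t by blast
  define L where "L = (\<lambda>u c. \<Prod>v\<in>V - {u}. ?w v c / ?w v u)"
  have IH: "f c = (\<Sum>u\<in>V. f u * L u c)" if "c \<noteq> 0" for c
    using tspace_times_tpair.IH[OF V(1,2) that] by (simp add: L_def)
  \<comment> \<open>Both sides are the product over all of V of the factors vanishing at the nodes,
    normalised at m except that the value at u is kept; this lets every m-contribution share the
    factor \<open>L m c\<close>.\<close>
  have Lm: "L u c * ?w u c / ?w u m = L m c * L u m" if u: "u \<in> V" for u
  proof -
    have "V - {m} = V" using V by auto
    then have "L m c = ?w u c / ?w u m * (\<Prod>v\<in>V - {u}. ?w v c / ?w v m)"
      unfolding L_def using V(3) u by (simp add: prod.remove)
    moreover have "(\<Prod>v\<in>V - {u}. ?w v c / ?w v m) * L u m = L u c"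
      unfolding L_def prod.distrib[symmetric]
      by (intro prod.cong refl) (use w V u in auto)
    ultimately show ?thesis by (simp add: mult_ac)
  qed
  have span: "?h c = ?h u * (?w m c / ?w m u) + ?h m * (?w u c / ?w u m)" if u: "u \<in> V" for u
    using tspace_times_tpair.prems that V nz t \<open>\<alpha> \<noteq> 0\<close>
    by (intro tpair_span) (auto simp: nodes_def power2_eq_square)
  have "f c * ?h c = (\<Sum>u\<in>V. f u * L u c * ?h c)"
    using IH[OF tspace_times_tpair.prems(3)] by (simp add: sum_distrib_right)
  also have "\<dots> = (\<Sum>u\<in>V. f u * ?h u * (L u c * (?w m c / ?w m u)) + ?h m * L m c * (f u * L u m))"
  proof (rule sum.cong)
    fix u assume u: "u \<in> V"
    show "f u * L u c * ?h c = f u * ?h u * (L u c * (?w m c / ?w m u)) + ?h m * L m c * (f u * L u m)"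
    proof -
      have "?h m * L m c * (f u * L u m) = f u * ?h m * (L u c * ?w u c / ?w u m)"
        by (simp add: Lm[OF u])
      then show ?thesis
        by (subst span[OF u]) (simp add: algebra_simps)
    qed
  qed simp
  \<comment> \<open>The induction hypothesis at the point m collapses the sum of
    \<open>f u * L u m\<close> to \<open>f m\<close>.\<close>
  also have "\<dots> = (\<Sum>u\<in>V. f u * ?h u * (L u c * (?w m c / ?w m u))) + f m * ?h m * L m c"
    using IH[of m] nz m by (simp add: sum.distrib sum_distrib_left mult_ac)
  also have "\<dots> = (\<Sum>u\<in>U. f u * ?h u * (\<Prod>v\<in>U - {u}. ?w v c / ?w v u))"
  proof -
    have "(\<Prod>v\<in>U - {m}. ?w v c / ?w v m) = L m c"
      unfolding L_def V_def by simp
    moreover have "(\<Prod>v\<in>U - {u}. ?w v c / ?w v u) = L u c * (?w m c / ?w m u)" if "u \<in> V" for u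
    proof -
      have "U - {u} = insert m (V - {u})"
        using V that by auto
      then show ?thesis
        using V by (simp add: L_def mult_ac)
    qed
    ultimately show ?thesis
      using V(3,4) by (simp add: V(5))
  qed
  finally show ?case .
next
  case (tspace_add n f g)
  then show ?case
    by (simp add: sum.distrib distrib_right)
next
  case (tspace_cong n f g)
  have fg: "f u = g u" if "u \<in> U" for u
    using tspace_cong that unfolding nodes_def by metis
  have "f c = (\<Sum>u\<in>U. f u * (\<Prod>v\<in>U - {u}. tpair t (1 / v) c / tpair t (1 / v) u))"
    using tspace_cong.IH[OF tspace_cong.prems] .
  also have "\<dots> = (\<Sum>u\<in>U. g u * (\<Prod>v\<in>U - {u}. tpair t (1 / v) c / tpair t (1 / v) u))"
    by (intro sum.cong refl) (simp add: fg)
  finally show ?case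
    using tspace_cong by simp
qed

lemma tspace_eqI:
  assumes "tspace t n f" "tspace t n g" "t \<noteq> 0" "nodes t U" "card U = Suc n" "c \<noteq> 0"
    and "\<And>u. u \<in> U \<Longrightarrow> f u = g u"
  shows "f c = g c"
  using tspace_lagrange[OF assms(1,3-6)] tspace_lagrange[OF assms(2,3-6)] assms(7) by simp

end

section \<open>The sum over subsets\<close>

lemma ellfact_0 [simp]: "ellfact a q p 0 = 1"
  by (simp add: ellfact_def)

lemma ellfact_Suc: "ellfact a q p (Suc k) = ellfact a q p k * theta (a * q ^ k) p"
  by (simp add: ellfact_def)

lemma ellfact_add: "ellfact a q p (m + n) = ellfact a q p m * ellfact (a * q ^ m) q p n"
  by (induction n) (simp_all add: ellfact_Suc power_add mult_ac)

lemma ellfact_Suc': "ellfact a q p (Suc k) = theta a p * ellfact (a * q) q p k"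
  using ellfact_add[of a q p 1 k] by (simp add: ellfact_Suc)

lemma ellfact_swap:
  "ellfact a q p m * ellfact (a * q ^ m) q p n = ellfact a q p n * ellfact (a * q ^ n) q p m"
  by (metis add.commute ellfact_add)

lemma ellfact_double: "ellfact a q p (2 * k) = ellfact a (q\<^sup>2) p k * ellfact (a * q) (q\<^sup>2) p k"
proof (induction k)
  case (Suc k)
  have "ellfact a q p (2 * Suc k)
      = ellfact a q p (2 * k) * theta (a * q ^ (2 * k)) p * theta (a * q ^ Suc (2 * k)) p"
    by (simp add: ellfact_Suc)
  then show ?case
    unfolding Suc.IH ellfact_Suc[of _ _ _ k] by (simp add: mult_ac flip: power_mult)
qed simp

lemma ellfact_eq_0_iff: "ellfact a q p k = 0 \<longleftrightarrow> (\<exists>j<k. theta (a * q ^ j) p = 0)"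
  by (auto simp: ellfact_def)

locale elliptic = theta_base +
  fixes q :: complex
  assumes q_nonzero: "q \<noteq> 0" and theta_q: "\<theta> q \<noteq> 0"
begin

text \<open>$z \notin q^{\mathbb Z} p^{\mathbb Z}$, except that $p^{\mathbb Z}$ is $\{1\}$ if $p = 0$.\<close>

definition gen :: "complex \<Rightarrow> bool" where
  "gen z \<longleftrightarrow> z \<noteq> 0 \<and> (\<forall>e::int. \<theta> (z * q powi e) \<noteq> 0)"

lemma gen_nonzero: "gen z \<Longrightarrow> z \<noteq> 0"
  by (simp add: gen_def)

lemma gen_theta: "gen z \<Longrightarrow> \<theta> z \<noteq> 0"
  using gen_def[of z] by (metis mult.right_neutral power_int_0_right)

lemma gen_powi: "gen z \<Longrightarrow> gen (z * q powi e)"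
  unfolding gen_def using q_nonzero by (simp add: mult.assoc flip: power_int_add)

lemma gen_power: "gen z \<Longrightarrow> gen (z * q ^ n)"
  using gen_powi[of z "int n"] by simp

lemma gen_mult_q: "gen z \<Longrightarrow> gen (z * q)"
  using gen_power[of z 1] by simp

lemma gen_divide_power: "gen z \<Longrightarrow> gen (z / q ^ n)"
  using gen_powi[of z "- int n"] by (simp add: power_int_minus divide_inverse)

lemma gen_inverse: "gen z \<Longrightarrow> gen (1 / z)"
proof -
  assume z: "gen z"
  have "\<theta> (1 / z * q powi e) \<noteq> 0" for e
  proof -
    have "\<theta> (1 / (z * q powi (- e))) = - \<theta> (z * q powi (- e)) / (z * q powi (- e))"
      using z q_nonzero by (intro theta_inverse) (auto simp: gen_def)
    moreover have "\<theta> (z * q powi (- e)) \<noteq> 0" "z \<noteq> 0"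
      using z by (auto simp: gen_def)
    ultimately show ?thesis
      using q_nonzero by (simp add: power_int_minus divide_inverse)
  qed
  then show "gen (1 / z)"
    using z by (simp add: gen_def)
qed

lemma gen_ellfact: "gen z \<Longrightarrow> ellfact z q p k \<noteq> 0"
  using gen_theta gen_power by (auto simp: ellfact_eq_0_iff)

lemma gen_ellfact_square: "gen z \<Longrightarrow> ellfact z (q\<^sup>2) p k \<noteq> 0"
  using gen_theta gen_power by (auto simp: ellfact_eq_0_iff simp flip: power_mult)

lemma tspace_ellfact_pair:
  assumes "\<alpha> \<noteq> 0" "Q \<noteq> 0"
  shows "tspace t k (\<lambda>c. ellfact (\<alpha> * c) Q p k * ellfact (\<alpha> * t / c) Q p k)"
proof -
  have "tspace t (\<Sum>s<k. 1) (\<lambda>c. \<Prod>s<k. tpair t (\<alpha> * Q ^ s) c)"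
    using assms by (intro tspace_prod tspace_tpair) auto
  moreover have "(\<Prod>s<k. tpair t (\<alpha> * Q ^ s) c) = ellfact (\<alpha> * c) Q p k * ellfact (\<alpha> * t / c) Q p k" for c
    by (simp add: ellfact_def tpair_def prod.distrib[symmetric] mult_ac)
  ultimately show ?thesis by simp
qed

text \<open>The summand for $b_i = 1/(q^2 x_i)$ with $k$ the indicator function of $I$, up to a factor not
  depending on $I$; $b$ and $b'$ stand for $b_{r+1}$ and $b_{r+2}$.\<close>

definition core_term ::
  "complex \<Rightarrow> complex \<Rightarrow> complex \<Rightarrow> complex \<Rightarrow> ('i \<Rightarrow> complex) \<Rightarrow> 'i set \<Rightarrow> 'i set \<Rightarrow> complex" where
  "core_term a b b' c x A I = (let K = card I in
     (-1) ^ K / q ^ K\<^sup>2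
     * (ellfact c q p K * ellfact (q / c) q p K / (ellfact (a * q / b) q p K * ellfact (a * q / b') q p K))
     * (\<Prod>i\<in>I. \<Prod>j\<in>A - I. \<theta> (x i / (q\<^sup>2 * x j)) / \<theta> (x i / x j))
     * (\<Prod>i\<in>I. \<theta> (x i * b) * \<theta> (x i * b') / (\<theta> (a * x i * q ^ K) * \<theta> (a * x i * q ^ (K + 1))))
     * (\<Prod>j\<in>A - I. \<theta> (a * x j * q\<^sup>2 / c) * \<theta> (a * x j * q * c)
         / (\<theta> (a * x j * q ^ (K + 1)) * \<theta> (a * x j * q ^ (K + 2)))))"

text \<open>Degree count with t = q: (c, q/c; q, p)_K supplies K pairs and each j outside I supplies
  one, with \<alpha> = a x_j q. The total does not depend on I, so all terms lie in one
  space.\<close>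

lemma tspace_core_term:
  assumes "finite A" "I \<subseteq> A" "a \<noteq> 0" "\<And>i. i \<in> A \<Longrightarrow> x i \<noteq> 0"
  shows "tspace q (card A) (\<lambda>c. core_term a b b' c x A I)"
proof -
  define K where "K = card I"
  define C where "C = (-1) ^ K / q ^ K\<^sup>2
     * (1 / (ellfact (a * q / b) q p K * ellfact (a * q / b') q p K))
     * (\<Prod>i\<in>I. \<Prod>j\<in>A - I. \<theta> (x i / (q\<^sup>2 * x j)) / \<theta> (x i / x j))
     * (\<Prod>i\<in>I. \<theta> (x i * b) * \<theta> (x i * b') / (\<theta> (a * x i * q ^ K) * \<theta> (a * x i * q ^ (K + 1))))
     * (\<Prod>j\<in>A - I. 1 / (\<theta> (a * x j * q ^ (K + 1)) * \<theta> (a * x j * q ^ (K + 2))))"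
  have "tspace q (K + (\<Sum>j\<in>A - I. 1)) (\<lambda>c. (ellfact (1 * c) q p K * ellfact (1 * q / c) q p K)
      * (\<Prod>j\<in>A - I. tpair q (a * x j * q) c))"
    using assms q_nonzero by (intro tspace_mult tspace_ellfact_pair tspace_prod tspace_tpair) auto
  moreover have "K + (\<Sum>j\<in>A - I. 1) = card A"
    using assms card_mono[of A I] finite_subset[of I A] by (simp add: K_def card_Diff_subset)
  ultimately have "tspace q (card A) (\<lambda>c. C * ((ellfact (1 * c) q p K * ellfact (1 * q / c) q p K)
      * (\<Prod>j\<in>A - I. tpair q (a * x j * q) c)))"
    by (simp add: tspace_scale)
  moreover have "core_term a b b' c x A I = C * ((ellfact (1 * c) q p K * ellfact (1 * q / c) q p K)
      * (\<Prod>j\<in>A - I. tpair q (a * x j * q) c))" for c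
    by (simp add: core_term_def Let_def C_def K_def tpair_def prod.distrib prod_dividef power2_eq_square mult_ac)
  ultimately show ?thesis by simp
qed

text \<open>At c = 1/y with y = a x_i q, the product (c, q/c; q, p)_{k+1} turns into (y, q/y; q,
  p)_k up to boundary factors. So the reduced term has y, the inverse of the old c, in the role of
  c.\<close>

lemma core_term_insert:
  assumes A: "finite A" "i \<in> A" "J \<subseteq> A - {i}" and nz: "a \<noteq> 0" "b \<noteq> 0" "b' \<noteq> 0"
    and x: "\<And>j. j \<in> A \<Longrightarrow> x j \<noteq> 0"
    and gen: "gen (a * x i)" "gen (a / b)" "gen (a / b')"
    and dist: "\<And>j. j \<in> A \<Longrightarrow> j \<noteq> i \<Longrightarrow> \<theta> (x i / x j) \<noteq> 0"
  shows "core_term a b b' (1 / (a * x i * q)) x A (insert i J)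
    = \<theta> (x i * b) * \<theta> (x i * b') / (q ^ (2 * card A) * a * x i * \<theta> (a * q / b) * \<theta> (a * q / b'))
      * core_term (a * q) b b' (a * q * x i) x (A - {i}) J"
proof -
  define k where "k = card J"
  define y where "y = a * x i * q"
  have xi: "x i \<noteq> 0" using A x by auto
  have y0: "y \<noteq> 0" using xi nz q_nonzero by (simp add: y_def)
  have fin: "finite J" "i \<notin> J"
    using A finite_subset[of J "A - {i}"] by auto
  have K: "card (insert i J) = Suc k"
    using fin by (simp add: k_def)
  have AI: "A - insert i J = (A - {i}) - J" by auto
  let ?B = "A - {i} - J"
  have cardB: "card ?B + k + 1 = card A"
    using card_Diff_subset[OF fin(1) A(3)] card_mono[OF _ A(3)] card_Suc_Diff1[OF A(1,2)] A(1)
    by (simp add: k_def)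
  define F where "F = (\<lambda>i j. \<theta> (x i / (q\<^sup>2 * x j)) / \<theta> (x i / x j))"
  define G where "G = (\<lambda>i. \<theta> (x i * b) * \<theta> (x i * b') / (\<theta> (a * x i * q ^ Suc k) * \<theta> (a * x i * q ^ (Suc k + 1))))"
  define H where "H = (\<lambda>j. \<theta> (a * x j * q\<^sup>2 / (1 / y)) * \<theta> (a * x j * q * (1 / y))
     / (\<theta> (a * x j * q ^ (Suc k + 1)) * \<theta> (a * x j * q ^ (Suc k + 2))))"
  define H' where "H' = (\<lambda>j. \<theta> ((a * q) * x j * q\<^sup>2 / y) * \<theta> ((a * q) * x j * q * y)
     / (\<theta> (a * x j * q ^ (Suc k + 1)) * \<theta> (a * x j * q ^ (Suc k + 2))))"
  \<comment> \<open>Here \<theta>(a x_j q c) becomes \<theta>(x_j/x_i) and cancels the denominator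
    \<theta>(x_i/x_j), while \<theta>(x_i/(Q x_j)) inverts to the factor \<theta>(a' x_j Q/c') of
    the reduced term, where a' = aq and c' = y.\<close>
  have FH: "F i j * H j = 1 / q\<^sup>2 * H' j" if j: "j \<in> ?B" for j
  proof -
    have xj: "x j \<noteq> 0" and d: "\<theta> (x i / x j) \<noteq> 0"
      using j x dist by auto
    have 1: "\<theta> (x i / (q\<^sup>2 * x j)) = - (x i / (q\<^sup>2 * x j)) * \<theta> ((q\<^sup>2 * x j) / x i)"
      by (rule theta_minus_swap) (use xi xj q_nonzero in auto)
    have 2: "\<theta> (x j / x i) = - (x j / x i) * \<theta> (x i / x j)"
      by (rule theta_minus_swap) (use xi xj in auto)
    have 3: "a * x j * q * (1 / y) = x j / x i" "(a * q) * x j * q\<^sup>2 / y = (q\<^sup>2 * x j) / x i"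
      "a * x j * q\<^sup>2 / (1 / y) = (a * q) * x j * q * y"
      using xi nz q_nonzero by (simp_all add: y_def power2_eq_square)
    have "F i j * H j = (- (x i / (q\<^sup>2 * x j)) * (- (x j / x i))) * (\<theta> (x i / x j) / \<theta> (x i / x j)) * H' j"
      unfolding F_def H_def H'_def 3 1 2 by simp
    also have "\<dots> = 1 / q\<^sup>2 * H' j"
      using xi xj d by simp
    finally show ?thesis .
  qed
  have FHB: "(\<Prod>j\<in>?B. F i j) * (\<Prod>j\<in>?B. H j) = 1 / q ^ (2 * card ?B) * (\<Prod>j\<in>?B. H' j)"
  proof -
    have "(\<Prod>j\<in>?B. F i j) * (\<Prod>j\<in>?B. H j) = (\<Prod>j\<in>?B. 1 / q\<^sup>2 * H' j)"
      unfolding prod.distrib[symmetric] by (intro prod.cong FH refl)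
    then show ?thesis
      by (simp add: prod_dividef power_mult)
  qed
  have e1: "ellfact (1 / y) q p (Suc k) = - \<theta> y / y * ellfact (q / y) q p k"
    using theta_inverse[OF y0] by (simp add: ellfact_Suc')
  \<comment> \<open>Completing the run of factors at its lower end exposes the two top factors,
    which are the denominator of \<open>G i\<close>.\<close>
  have e2: "\<theta> y * ellfact (q / (1 / y)) q p (Suc k) = ellfact y q p k * \<theta> (y * q ^ k) * \<theta> (y * q ^ Suc k)"
  proof -
    have "\<theta> y * ellfact (y * q) q p (Suc k) = ellfact y q p (Suc (Suc k))"
      by (simp only: ellfact_Suc')
    also have "\<dots> = ellfact y q p k * \<theta> (y * q ^ k) * \<theta> (y * q ^ Suc k)"
      by (simp only: ellfact_Suc)
    finally show ?thesis
      by (simp add: mult.commute)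
  qed
  have e3: "ellfact (a * q / b) q p (Suc k) = \<theta> (a * q / b) * ellfact ((a * q) * q / b) q p k"
    "ellfact (a * q / b') q p (Suc k) = \<theta> (a * q / b') * ellfact ((a * q) * q / b') q p k"
    by (simp_all add: ellfact_Suc')
  have G: "G i = \<theta> (x i * b) * \<theta> (x i * b') / (\<theta> (y * q ^ k) * \<theta> (y * q ^ Suc k))"
    by (simp add: G_def y_def mult_ac)
  have gy: "gen y" unfolding y_def using gen(1) by (rule gen_mult_q)
  have n1: "\<theta> y \<noteq> 0" "\<theta> (y * q ^ k) \<noteq> 0" "\<theta> (y * q ^ Suc k) \<noteq> 0"
    using gen_theta gen_power gy by blast+
  \<comment> \<open>With |B| = |A| - k - 1 the exponents satisfy (k+1)^2 + 2|B| + 1 = k^2 +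
    2|A|.\<close>
  have pow: "q ^ (Suc k)\<^sup>2 * q ^ (2 * card ?B) * q = q ^ k\<^sup>2 * q ^ (2 * card A)"
    unfolding cardB[symmetric] by (simp add: power2_eq_square power_add[symmetric] power_Suc[symmetric] algebra_simps del: power_Suc)
  have scal: "(-1) ^ Suc k / q ^ (Suc k)\<^sup>2 * (ellfact (1 / y) q p (Suc k) * ellfact (q / (1 / y)) q p (Suc k))
      * G i / q ^ (2 * card ?B)
    = \<theta> (x i * b) * \<theta> (x i * b') / (q ^ (2 * card A) * a * x i)
      * ((-1) ^ k / q ^ k\<^sup>2) * (ellfact y q p k * ellfact (q / y) q p k)"
  proof -
    have "ellfact (1 / y) q p (Suc k) * ellfact (q / (1 / y)) q p (Suc k) * G i
      = - (ellfact (q / y) q p k / y) * (\<theta> y * ellfact (q / (1 / y)) q p (Suc k)) * G i"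
      unfolding e1 by simp
    also have "\<dots> = - (ellfact (q / y) q p k / y) * ellfact y q p k * (\<theta> (x i * b) * \<theta> (x i * b'))"
      unfolding e2 G using n1 by simp
    finally have *: "ellfact (1 / y) q p (Suc k) * ellfact (q / (1 / y)) q p (Suc k) * G i
      = - (ellfact (q / y) q p k * ellfact y q p k * (\<theta> (x i * b) * \<theta> (x i * b'))) / y"
      by simp
    have "q ^ (Suc k)\<^sup>2 * q ^ (2 * card ?B) * y = q ^ k\<^sup>2 * q ^ (2 * card A) * a * x i"
      using pow unfolding y_def by (simp add: mult_ac)
    then have **: "1 / (q ^ (Suc k)\<^sup>2 * q ^ (2 * card ?B) * y) = 1 / (q ^ k\<^sup>2 * q ^ (2 * card A) * a * x i)"
      by simp
    have "(-1) ^ Suc k / q ^ (Suc k)\<^sup>2 * (ellfact (1 / y) q p (Suc k) * ellfact (q / (1 / y)) q p (Suc k))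
      * G i / q ^ (2 * card ?B) = (-1) ^ Suc k / (q ^ (Suc k)\<^sup>2 * q ^ (2 * card ?B)) *
        (ellfact (1 / y) q p (Suc k) * ellfact (q / (1 / y)) q p (Suc k) * G i)"
      by simp
    also have "\<dots> = (-1) ^ k * (ellfact (q / y) q p k * ellfact y q p k * (\<theta> (x i * b) * \<theta> (x i * b')))
      * (1 / (q ^ (Suc k)\<^sup>2 * q ^ (2 * card ?B) * y))"
      unfolding * by simp
    also have "\<dots> = \<theta> (x i * b) * \<theta> (x i * b') / (q ^ (2 * card A) * a * x i)
      * ((-1) ^ k / q ^ k\<^sup>2) * (ellfact y q p k * ellfact (q / y) q p k)"
      unfolding ** by (simp add: mult_ac)
    finally show ?thesis .
  qed
  define E where "E = ellfact ((a * q) * q / b) q p k * ellfact ((a * q) * q / b') q p k"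
  define R where "R = (\<Prod>i\<in>J. \<Prod>j\<in>?B. F i j) * (\<Prod>i\<in>J. G i)"
  have "core_term a b b' (1 / (a * x i * q)) x A (insert i J)
    = (-1) ^ Suc k / q ^ (Suc k)\<^sup>2 * (ellfact (1 / y) q p (Suc k) * ellfact (q / (1 / y)) q p (Suc k)
        / (\<theta> (a * q / b) * \<theta> (a * q / b') * E)) * ((\<Prod>j\<in>?B. F i j) * (\<Prod>i\<in>J. \<Prod>j\<in>?B. F i j))
        * (G i * (\<Prod>i\<in>J. G i)) * (\<Prod>j\<in>?B. H j)"
    unfolding core_term_def K Let_def AI y_def[symmetric] e3 E_def F_def G_def H_def
    using fin by (simp add: mult_ac)
  also have "\<dots> = ((-1) ^ Suc k / q ^ (Suc k)\<^sup>2 * (ellfact (1 / y) q p (Suc k) * ellfact (q / (1 / y)) q p (Suc k))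
      * G i) * ((\<Prod>j\<in>?B. F i j) * (\<Prod>j\<in>?B. H j)) * R / (\<theta> (a * q / b) * \<theta> (a * q / b') * E)"
    by (simp add: R_def)
  also have "\<dots> = ((-1) ^ Suc k / q ^ (Suc k)\<^sup>2 * (ellfact (1 / y) q p (Suc k) * ellfact (q / (1 / y)) q p (Suc k))
      * G i / q ^ (2 * card ?B)) * (\<Prod>j\<in>?B. H' j) * R / (\<theta> (a * q / b) * \<theta> (a * q / b') * E)"
    unfolding FHB by simp
  also have "\<dots> = \<theta> (x i * b) * \<theta> (x i * b') / (q ^ (2 * card A) * a * x i * \<theta> (a * q / b) * \<theta> (a * q / b'))
      * ((-1) ^ k / q ^ k\<^sup>2 * (ellfact y q p k * ellfact (q / y) q p k / E) * R * (\<Prod>j\<in>?B. H' j))"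
    unfolding scal by (simp add: mult_ac)
  also have "(-1) ^ k / q ^ k\<^sup>2 * (ellfact y q p k * ellfact (q / y) q p k / E) * R * (\<Prod>j\<in>?B. H' j)
     = core_term (a * q) b b' (a * q * x i) x (A - {i}) J"
    unfolding core_term_def k_def[symmetric] Let_def E_def R_def F_def G_def H'_def
    by (simp add: y_def mult_ac)
  finally show ?thesis .
qed

text \<open>The relation between b b' and a^2 q^{2|A|+1} is unchanged when a is replaced by aq and A
  loses one element; b and b' stay the same. Hence the induction generalises over a and c only,
  besides the set.\<close>

theorem subset_sum:
  assumes "finite A" "a \<noteq> 0" "b \<noteq> 0" "c \<noteq> 0" "b * b' = a\<^sup>2 * q ^ (2 * card A + 1)"
    and "\<And>i. i \<in> A \<Longrightarrow> x i \<noteq> 0" "\<And>i. i \<in> A \<Longrightarrow> gen (a * x i)" "gen (a / b)"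
    and "\<And>i j. i \<in> A \<Longrightarrow> j \<in> A \<Longrightarrow> gen (a\<^sup>2 * x i * x j)"
    and "\<And>i j. i \<in> A \<Longrightarrow> j \<in> A \<Longrightarrow> i \<noteq> j \<Longrightarrow> \<theta> (x i / x j) \<noteq> 0"
  shows "(\<Sum>I\<in>Pow A. core_term a b b' c x A I)
    = ellfact (a * q\<^sup>2 / (b * c)) (q\<^sup>2) p (card A) * ellfact (a * q * c / b) (q\<^sup>2) p (card A)
      / ellfact (a * q / b) q p (2 * card A)"
  using assms
proof (induction "card A" arbitrary: A a c)
  case 0
  then have "A = {}" by simp
  then show ?case by (simp add: core_term_def)
next
  case (Suc n)
  note fin = \<open>finite A\<close> and x0 = Suc.prems(6) and gx = Suc.prems(7) and gxx = Suc.prems(9) and dist = Suc.prems(10)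
  have a0: "a \<noteq> 0" and b0: "b \<noteq> 0" using Suc.prems by auto
  have b': "b' = a\<^sup>2 * q ^ (2 * card A + 1) / b"
    using Suc.prems by (simp add: field_simps)
  have b'0: "b' \<noteq> 0" using b' a0 b0 q_nonzero by simp
  have "a / b' = 1 / (a / b * q ^ (2 * card A + 1))"
    using a0 b0 q_nonzero by (simp add: b' power2_eq_square field_simps)
  then have gb': "gen (a / b')"
    using gen_inverse gen_power \<open>gen (a / b)\<close> by metis
  \<comment> \<open>These are the zeros of \<theta>(a x_i q c), a factor of every term with i
    outside I. Together with the point 1 they give |A| + 1 nodes, enough for degree |A|.\<close>
  define nd where "nd = (\<lambda>i. 1 / (a * x i * q))"
  define U where "U = insert 1 (nd ` A)"
  define g where "g = (\<lambda>c. 1 / ellfact (a * q / b) q p (2 * card A)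
    * (ellfact (a * q / b * c) (q\<^sup>2) p (card A) * ellfact (a * q / b * q / c) (q\<^sup>2) p (card A)))"
  have g_alt: "g c = ellfact (a * q\<^sup>2 / (b * c)) (q\<^sup>2) p (card A) * ellfact (a * q * c / b) (q\<^sup>2) p (card A)
      / ellfact (a * q / b) q p (2 * card A)" for c
    unfolding g_def by (simp add: power2_eq_square mult_ac)
  have y: "a * x i * q \<noteq> 0" "\<theta> (a * x i * q) \<noteq> 0" "gen (a * x i * q)" if "i \<in> A" for i
    using gx[OF that] gen_mult_q gen_theta gen_nonzero by blast+
  have inj: "nd i \<noteq> nd j" if "i \<in> A" "j \<in> A" "i \<noteq> j" for i j
  proof
    assume "nd i = nd j"
    then have "x i = x j" using a0 q_nonzero x0 that by (simp add: nd_def)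
    then show False using dist[OF that] x0 that by simp
  qed
  have nd1: "nd i \<noteq> 1" if "i \<in> A" for i
    using y[OF that] by (auto simp: nd_def)
  have card_U: "card U = Suc (card A)"
  proof -
    have "inj_on nd A" using inj by (auto intro: inj_onI)
    moreover have "1 \<notin> nd ` A" using nd1 by force
    ultimately show ?thesis
      unfolding U_def using fin by (simp add: card_image)
  qed
  have th_inv: "\<theta> (1 / z) \<noteq> 0" if "gen z" for z
    using gen_theta gen_inverse that by blast
  have nodes: "nodes q U"
    unfolding nodes_def
  proof (intro conjI ballI)
    show "finite U" using fin by (simp add: U_def)
    show "0 \<notin> U" using y by (auto simp: U_def nd_def)
    have n1: "\<theta> (1 * 1 / q) \<noteq> 0"
      using theta_inverse[OF q_nonzero] theta_q q_nonzero by simp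
    have n2: "\<theta> (nd i * 1 / q) \<noteq> 0" if "i \<in> A" for i
      using th_inv[OF gen_mult_q[OF y(3)[OF that]]] by (simp add: nd_def mult_ac)
    \<comment> \<open>The argument is 1/(a^2 x_i x_j q^3); the genericity of a^2 x_i x_j is there to
      separate these nodes from their reflections.\<close>
    have n3: "\<theta> (nd i * nd j / q) \<noteq> 0" if "i \<in> A" "j \<in> A" for i j
      using th_inv[OF gen_power[OF gxx[OF that], of 3]]
      by (simp add: nd_def mult_ac power2_eq_square power3_eq_cube)
    fix u v assume uv: "u \<in> U" "v \<in> U"
    then show "\<theta> (u * v / q) \<noteq> 0"
      unfolding U_def using n1 n2 n3 by (auto simp: mult.commute[of 1])
    have d1: "\<theta> (nd i / 1) \<noteq> 0" "\<theta> (1 / nd i) \<noteq> 0" if "i \<in> A" for i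
      using th_inv[OF y(3)[OF that]] y(2)[OF that] by (simp_all add: nd_def)
    have d2: "\<theta> (nd i / nd j) \<noteq> 0" if "i \<in> A" "j \<in> A" "nd i \<noteq> nd j" for i j
    proof -
      have "nd i / nd j = x j / x i"
        using a0 q_nonzero x0 that by (simp add: nd_def)
      then show ?thesis
        using dist[of j i] that by auto
    qed
    show "u \<noteq> v \<longrightarrow> \<theta> (u / v) \<noteq> 0"
      using uv d1 d2 unfolding U_def by (auto simp del: div_by_1)
  qed
  have f_space: "tspace q (card A) (\<lambda>c. \<Sum>I\<in>Pow A. core_term a b b' c x A I)"
    using fin x0 a0 by (intro tspace_sum tspace_core_term) auto
  have g_space: "tspace q (card A) g"
    unfolding g_def using a0 b0 q_nonzero by (intro tspace_scale tspace_ellfact_pair) auto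
  have "(\<Sum>I\<in>Pow A. core_term a b b' u x A I) = g u" if "u \<in> U" for u
  proof -
    from that consider "u = 1" | i where "i \<in> A" "u = nd i"
      unfolding U_def by auto
    then show ?thesis
    proof cases
      case 1
      have "core_term a b b' 1 x A I = 0" if "I \<in> Pow A - {{}}" for I
      proof -
        have "finite I" using that fin by (auto intro: finite_subset)
        then have "card I \<noteq> 0" using that by auto
        then have "ellfact 1 q p (card I) = 0"
          by (cases "card I") (auto simp: ellfact_Suc')
        then show ?thesis by (simp add: core_term_def)
      qed
      then have "(\<Sum>I\<in>Pow A. core_term a b b' 1 x A I) = core_term a b b' 1 x A {}"
        using fin by (subst sum.mono_neutral_right[of "Pow A" "{{}}"]) auto
      also have "\<dots> = (\<Prod>j\<in>A. \<theta> (a * x j * q\<^sup>2) * \<theta> (a * x j * q) / (\<theta> (a * x j * q) * \<theta> (a * x j * q\<^sup>2)))"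
        by (simp add: core_term_def power2_eq_square)
      also have "\<dots> = (\<Prod>j\<in>A. 1)"
      proof (intro prod.cong refl)
        fix j assume "j \<in> A"
        then show "\<theta> (a * x j * q\<^sup>2) * \<theta> (a * x j * q) / (\<theta> (a * x j * q) * \<theta> (a * x j * q\<^sup>2)) = 1"
          using y[of j] gen_theta[OF gen_power[OF gx, of j 2]] by simp
      qed
      also have "\<dots> = g 1"
      proof -
        have "ellfact (a * q / b) q p (2 * card A) \<noteq> 0"
          using gen_ellfact[OF gen_mult_q[OF \<open>gen (a / b)\<close>]] by (simp add: mult_ac)
        then show ?thesis
          unfolding g_def by (simp add: ellfact_double)
      qed
      finally show ?thesis using 1 by simp
    next
      case (2 i)
      note i = \<open>i \<in> A\<close>
      have cA: "card (A - {i}) = n" "card A = Suc n"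
        using Suc.hyps(2) fin i by auto
      define C where "C = \<theta> (x i * b) * \<theta> (x i * b') / (q ^ (2 * card A) * a * x i * \<theta> (a * q / b) * \<theta> (a * q / b'))"
      have "core_term a b b' (nd i) x A I = 0" if "I \<in> Pow A" "i \<notin> I" for I
      proof -
        have "\<theta> (a * x i * q * nd i) = 0"
          using y[OF i] by (simp add: nd_def)
        then have "(\<Prod>j\<in>A - I. \<theta> (a * x j * q\<^sup>2 / nd i) * \<theta> (a * x j * q * nd i)
         / (\<theta> (a * x j * q ^ (card I + 1)) * \<theta> (a * x j * q ^ (card I + 2)))) = 0"
          using fin i that by (intro prod_zero) (auto intro!: bexI[of _ i])
        then show ?thesis
          by (simp only: core_term_def Let_def mult_zero_right)
      qed
      then have "(\<Sum>I\<in>Pow A. core_term a b b' (nd i) x A I) = (\<Sum>I\<in>{I\<in>Pow A. i \<in> I}. core_term a b b' (nd i) x A I)"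
        using fin by (intro sum.mono_neutral_right) auto
      also have "\<dots> = (\<Sum>J\<in>Pow (A - {i}). core_term a b b' (nd i) x A (insert i J))"
        by (rule sum.reindex_bij_witness[of _ "insert i" "\<lambda>I. I - {i}"]) (use i in \<open>auto simp: insert_absorb\<close>)
      also have "\<dots> = (\<Sum>J\<in>Pow (A - {i}). C * core_term (a * q) b b' (a * q * x i) x (A - {i}) J)"
        unfolding nd_def C_def
        by (intro sum.cong refl core_term_insert) (use fin i a0 b0 b'0 x0 gx gb' \<open>gen (a / b)\<close> dist in auto)
      also have "\<dots> = C * (\<Sum>J\<in>Pow (A - {i}). core_term (a * q) b b' (a * q * x i) x (A - {i}) J)"
        by (simp add: sum_distrib_left)
      also have "(\<Sum>J\<in>Pow (A - {i}). core_term (a * q) b b' (a * q * x i) x (A - {i}) J)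
        = ellfact ((a * q) * q\<^sup>2 / (b * (a * q * x i))) (q\<^sup>2) p (card (A - {i}))
          * ellfact ((a * q) * q * (a * q * x i) / b) (q\<^sup>2) p (card (A - {i}))
          / ellfact ((a * q) * q / b) q p (2 * card (A - {i}))"
      proof (rule Suc.hyps(1))
        show "n = card (A - {i})" using cA by simp
        show "b * b' = (a * q)\<^sup>2 * q ^ (2 * card (A - {i}) + 1)"
          using Suc.prems(5) cA by (simp add: power2_eq_square mult_ac)
        show "gen (a * q * x j)" if "j \<in> A - {i}" for j
          using y(3)[of j] that by (simp add: mult_ac)
        show "gen (a * q / b)"
          using gen_mult_q[OF \<open>gen (a / b)\<close>] by simp
        show "gen ((a * q)\<^sup>2 * x j * x k)" if "j \<in> A - {i}" "k \<in> A - {i}" for j k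
          using gen_power[OF gxx[of j k], of 2] that by (simp add: power_mult_distrib mult_ac)
      qed (use fin a0 b0 q_nonzero x0 i dist in auto)
      also have "C * \<dots> = g (nd i)"
      proof -
        define y where "y = a * x i * q"
        have xi: "x i \<noteq> 0" using x0 i by simp
        have e1: "ellfact (1 / (b * x i)) (q\<^sup>2) p (Suc n)
          = \<theta> (1 / (b * x i)) * ellfact ((a * q) * q\<^sup>2 / (b * (a * q * x i))) (q\<^sup>2) p n"
          using a0 q_nonzero by (simp add: ellfact_Suc' mult_ac)
        \<comment> \<open>The balancing relation identifies the last factor of this run as
          \<theta>(x_i b').\<close>
        have e2: "ellfact (a * q\<^sup>2 * y / b) (q\<^sup>2) p (Suc n)
          = ellfact ((a * q) * q * (a * q * x i) / b) (q\<^sup>2) p n * \<theta> (x i * b')"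
        proof -
          have "a * q\<^sup>2 * y / b * (q\<^sup>2) ^ n = x i * b'"
            unfolding b' cA y_def power_mult[symmetric] by (simp add: power2_eq_square mult_ac)
          then show ?thesis
            by (simp add: ellfact_Suc y_def power2_eq_square mult_ac)
        qed
        have e3: "ellfact (a * q / b) q p (2 * Suc n)
           = \<theta> (a * q / b) * ellfact ((a * q) * q / b) q p (2 * n) * \<theta> (a * q ^ (2 * Suc n) / b)"
        proof -
          have "ellfact (a * q / b) q p (2 * Suc n) = ellfact (a * q / b) q p (Suc (2 * n)) * \<theta> (a * q / b * q ^ Suc (2 * n))"
            by (simp only: ellfact_Suc mult_Suc_right add_2_eq_Suc)
          then show ?thesis
            by (simp add: ellfact_Suc' mult_ac)
        qed
        have e4: "\<theta> (a * q / b') = - (b / (a * q ^ (2 * Suc n))) * \<theta> (a * q ^ (2 * Suc n) / b)"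
        proof -
          have "a * q / b' = b / (a * q ^ (2 * Suc n))"
            unfolding b' cA using a0 b0 q_nonzero by (simp add: power2_eq_square field_simps)
          then show ?thesis
            using theta_minus_swap[of b "a * q ^ (2 * Suc n)"] a0 b0 q_nonzero by simp
        qed
        have e5: "\<theta> (1 / (b * x i)) = - \<theta> (x i * b) / (x i * b)"
          using theta_inverse[of "x i * b"] b0 xi by (simp add: mult_ac)
        have "g (nd i) = ellfact (1 / (b * x i)) (q\<^sup>2) p (Suc n) * ellfact (a * q\<^sup>2 * y / b) (q\<^sup>2) p (Suc n)
           / ellfact (a * q / b) q p (2 * Suc n)"
          unfolding g_alt cA nd_def y_def using a0 b0 q_nonzero xi by (simp add: mult_ac)
        moreover have den: "V * a * x i * Z * (- (b / (a * V)) * W) = - (x i * b * Z * W)" if "V \<noteq> 0" for V Z W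
          using that a0 by simp
        have "C = - (\<theta> (x i * b) * \<theta> (x i * b') / (x i * b * \<theta> (a * q / b) * \<theta> (a * q ^ (2 * Suc n) / b)))"
          unfolding C_def cA e4 using q_nonzero by (subst den) simp_all
        ultimately show ?thesis
          unfolding e1 e2 e3 e5 cA by (simp add: mult_ac)
      qed
      finally show ?thesis using 2 by simp
    qed
  qed
  then have "(\<Sum>I\<in>Pow A. core_term a b b' c x A I) = g c"
    by (rule tspace_eqI[OF f_space g_space q_nonzero nodes card_U \<open>c \<noteq> 0\<close>])
  then show ?case
    by (simp add: g_alt)
qed

end

section \<open>The quotient of shifted and unshifted \<open>Delta\<close> in terms of shifted
  factorials\<close>

lemma prod_square_pairs:
  fixes G :: "nat \<Rightarrow> nat \<Rightarrow> 'a::comm_monoid_mult"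
  shows "(\<Prod>i=1..r. \<Prod>j=1..r. G i j) = (\<Prod>i=1..r. G i i) * (\<Prod>j=1..r. \<Prod>i=1..<j. G i j * G j i)"
proof (induction r)
  case (Suc r)
  define T where "T = (\<lambda>j. \<Prod>i=1..<j. G i j * G j i)"
  have "(\<Prod>i=1..Suc r. \<Prod>j=1..Suc r. G i j)
      = (\<Prod>i=1..r. \<Prod>j=1..r. G i j) * G (Suc r) (Suc r) * ((\<Prod>i=1..r. G i (Suc r)) * (\<Prod>j=1..r. G (Suc r) j))"
    by (simp add: prod.distrib mult_ac)
  also have "(\<Prod>i=1..r. G i (Suc r)) * (\<Prod>j=1..r. G (Suc r) j) = T (Suc r)"
    unfolding T_def atLeastLessThanSuc_atLeastAtMost prod.distrib ..
  finally show ?case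
    unfolding Suc.IH T_def[symmetric] by (simp add: mult_ac)
qed simp

lemma prod_telescope:
  fixes h :: "nat \<Rightarrow> 'a::field"
  assumes "k \<le> n" "\<And>t. k \<le> t \<Longrightarrow> t < n \<Longrightarrow> h t \<noteq> 0"
  shows "(\<Prod>t\<in>{k..<n}. h (Suc t) / h t) * h k = h n"
  using assms
proof (induction n rule: dec_induct)
  case (step m)
  have "(\<Prod>t\<in>{k..<Suc m}. h (Suc t) / h t) * h k = ((\<Prod>t\<in>{k..<m}. h (Suc t) / h t) * h k) * (h (Suc m) / h m)"
    using step.hyps by simp
  also have "(\<Prod>t\<in>{k..<m}. h (Suc t) / h t) * h k = h m"
    using step.IH step.prems by simp
  finally show ?case
    using step.hyps step.prems[of m] by simp
qed simp

context elliptic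
begin

abbreviation Q :: complex where "Q \<equiv> q\<^sup>2"

text \<open>The contribution of one pair i < j, with z = x_i/x_j, k = k_i and l = k_j. Raising l by
  one moves z/Q^l down one step, and two theta inversions bring the new boundary factors into place;
  the powers of Q absorb the monomials these produce.\<close>

lemma Delta_pair:
  assumes z: "z \<noteq> 0"
  shows "Q ^ l * \<theta> (z * Q ^ k / Q ^ l) * Q ^ (k * l) * (ellfact (z / Q ^ l) Q p k * ellfact (1 / (z * Q ^ k)) Q p l)
    = \<theta> z * (ellfact (z * Q) Q p k * ellfact (1 / z * Q) Q p l)"
proof (induction l)
  case 0
  have "\<theta> (z * Q ^ k) * ellfact z Q p k = \<theta> z * ellfact (z * Q) Q p k"
    using ellfact_Suc[of z Q p k] ellfact_Suc'[of z Q p k] by (simp add: mult.commute)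
  then show ?case by simp
next
  case (Suc l)
  define A where "A = z / Q ^ Suc l"
  have A: "A \<noteq> 0" "A * Q = z / Q ^ l" "A * Q ^ k = z * Q ^ k / Q ^ Suc l"
    using z q_nonzero by (simp_all add: A_def)
  have 1: "ellfact A Q p k * \<theta> (z * Q ^ k / Q ^ Suc l) = \<theta> A * ellfact (z / Q ^ l) Q p k"
    using ellfact_Suc[of A Q p k] ellfact_Suc'[of A Q p k] unfolding A by simp
  have 2: "\<theta> A = - A * \<theta> (1 / z * Q * Q ^ l)"
    using theta_minus_swap[of z "Q ^ Suc l"] z q_nonzero by (simp add: A_def)
  have 3: "\<theta> (1 / (z * Q ^ k) * Q ^ l) = - (Q ^ l / (z * Q ^ k)) * \<theta> (z * Q ^ k / Q ^ l)"
    using theta_minus_swap[of "Q ^ l" "z * Q ^ k"] z q_nonzero by simp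
  have "Q ^ Suc l * \<theta> (z * Q ^ k / Q ^ Suc l) * Q ^ (k * Suc l)
      * (ellfact (z / Q ^ Suc l) Q p k * ellfact (1 / (z * Q ^ k)) Q p (Suc l))
    = Q ^ Suc l * Q ^ (k * Suc l) * (ellfact A Q p k * \<theta> (z * Q ^ k / Q ^ Suc l))
      * (ellfact (1 / (z * Q ^ k)) Q p l * \<theta> (1 / (z * Q ^ k) * Q ^ l))"
    by (simp only: ellfact_Suc A_def mult_ac)
  also have "\<dots> = (Q ^ Suc l * Q ^ (k * Suc l) * A * (Q ^ l / (z * Q ^ k)))
      * \<theta> (1 / z * Q * Q ^ l) * ellfact (z / Q ^ l) Q p k * ellfact (1 / (z * Q ^ k)) Q p l * \<theta> (z * Q ^ k / Q ^ l)"
    unfolding 1 2 3 by simp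
  also have "Q ^ Suc l * Q ^ (k * Suc l) * A * (Q ^ l / (z * Q ^ k)) = Q ^ l * Q ^ (k * l)"
    using z q_nonzero by (simp add: A_def power_add)
  also have "Q ^ l * Q ^ (k * l) * \<theta> (1 / z * Q * Q ^ l) * ellfact (z / Q ^ l) Q p k
      * ellfact (1 / (z * Q ^ k)) Q p l * \<theta> (z * Q ^ k / Q ^ l)
    = (Q ^ l * \<theta> (z * Q ^ k / Q ^ l) * Q ^ (k * l) * (ellfact (z / Q ^ l) Q p k * ellfact (1 / (z * Q ^ k)) Q p l))
      * \<theta> (1 / z * Q * Q ^ l)"
    by (simp add: mult_ac)
  also have "\<dots> = \<theta> z * (ellfact (z * Q) Q p k * ellfact (1 / z * Q) Q p (Suc l))"
    unfolding Suc.IH ellfact_Suc[of _ _ _ l] by (simp add: mult_ac)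
  finally show ?case .
qed

text \<open>The contribution of i = j, that is, (Q^{-k}; Q, p)_k read backwards. It is the source of
  the sign, and q^{k + k^2} is Q^{k(k+1)/2}.\<close>

lemma Delta_diagonal: "q ^ k * q ^ (k * k) * ellfact (1 / Q ^ k) Q p k = (-1) ^ k * ellfact Q Q p k"
proof (induction k)
  case (Suc k)
  have 1: "\<theta> (1 / Q ^ Suc k) = - \<theta> (Q * Q ^ k) / Q ^ Suc k"
    using theta_inverse[of "Q ^ Suc k"] q_nonzero by simp
  have 2: "ellfact (1 / Q ^ Suc k) Q p (Suc k) = \<theta> (1 / Q ^ Suc k) * ellfact (1 / Q ^ k) Q p k"
    using q_nonzero by (simp add: ellfact_Suc')
  have 3: "q ^ Suc k * q ^ (Suc k * Suc k) / Q ^ Suc k = q ^ k * q ^ (k * k)"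
  proof -
    have "q ^ Suc k * q ^ (Suc k * Suc k) = q ^ k * q ^ (k * k) * Q ^ Suc k"
    proof -
      have "Suc k + Suc k * Suc k = k + k * k + 2 * Suc k" by simp
      then show ?thesis
        by (simp only: power_mult[symmetric] power_add[symmetric])
    qed
    moreover have "Q ^ Suc k \<noteq> 0" using q_nonzero by simp
    ultimately show ?thesis by (metis nonzero_mult_div_cancel_right)
  qed
  have "q ^ Suc k * q ^ (Suc k * Suc k) * ellfact (1 / Q ^ Suc k) Q p (Suc k)
    = - (q ^ Suc k * q ^ (Suc k * Suc k) / Q ^ Suc k) * ellfact (1 / Q ^ k) Q p k * \<theta> (Q * Q ^ k)"
    unfolding 2 1 by simp
  also have "\<dots> = - (q ^ k * q ^ (k * k) * ellfact (1 / Q ^ k) Q p k) * \<theta> (Q * Q ^ k)"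
    unfolding 3 by simp
  finally show ?case
    unfolding Suc.IH ellfact_Suc[of _ _ _ k] by simp
qed simp

text \<open>The quotient of the two \<open>Delta\<close> is traded for the double product that
  telescoping along strings produces. Since q^{K^2} is the product of all q^{k_i k_j}, the identity
  splits into diagonal and pair contributions. Stated without division, it needs no genericity of
  \<open>x\<close>.\<close>

lemma Delta_shift:
  fixes k :: "nat \<Rightarrow> nat"
  assumes x: "\<And>i. i \<in> {1..r} \<Longrightarrow> x i \<noteq> 0"
  defines "K \<equiv> (\<Sum>i=1..r. k i)"
  shows "Delta r (\<lambda>i. x i * q ^ (2 * k i)) p * q ^ K * q ^ K\<^sup>2
      * (\<Prod>i=1..r. \<Prod>j=1..r. ellfact (x i / (x j * Q ^ k j)) Q p (k i))
    = Delta r x p * (-1) ^ K * (\<Prod>i=1..r. \<Prod>j=1..r. ellfact (Q * x i / x j) Q p (k i))"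
proof -
  define G where "G = (\<lambda>i j. q ^ (k i * k j) * ellfact (x i / (x j * Q ^ k j)) Q p (k i))"
  define H where "H = (\<lambda>i j. ellfact (Q * x i / x j) Q p (k i))"
  have "q ^ K\<^sup>2 = (\<Prod>i=1..r. \<Prod>j=1..r. q ^ (k i * k j))"
    unfolding K_def power2_eq_square sum_product by (simp add: power_sum)
  then have "q ^ K\<^sup>2 * (\<Prod>i=1..r. \<Prod>j=1..r. ellfact (x i / (x j * Q ^ k j)) Q p (k i)) = (\<Prod>i=1..r. \<Prod>j=1..r. G i j)"
    unfolding G_def by (simp add: prod.distrib)
  then have "Delta r (\<lambda>i. x i * q ^ (2 * k i)) p * q ^ K * q ^ K\<^sup>2
      * (\<Prod>i=1..r. \<Prod>j=1..r. ellfact (x i / (x j * Q ^ k j)) Q p (k i))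
    = (\<Prod>i=1..r. q ^ k i * G i i) * (\<Prod>j=1..r. \<Prod>i=1..<j. (x j * q ^ (2 * k j) * \<theta> (x i * q ^ (2 * k i) / (x j * q ^ (2 * k j)))) * (G i j * G j i))"
    unfolding prod_square_pairs Delta_def K_def power_sum prod.distrib by (simp add: mult_ac)
  also have "\<dots> = (\<Prod>i=1..r. (-1) ^ k i * H i i) * (\<Prod>j=1..r. \<Prod>i=1..<j. (x j * \<theta> (x i / x j)) * (H i j * H j i))"
  proof (rule arg_cong2[where f = "(*)"]; intro prod.cong refl)
    fix i assume "i \<in> {1..r}"
    then have "x i \<noteq> 0" using x by simp
    then show "q ^ k i * G i i = (-1) ^ k i * H i i"
      using Delta_diagonal[of "k i"] by (simp add: G_def H_def mult_ac)
  next
    fix j i assume "j \<in> {1..r}" "i \<in> {1..<j}"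
    then have nz: "x i \<noteq> 0" "x j \<noteq> 0" using x by auto
    have pw: "q ^ (k i * k j) * q ^ (k j * k i) = Q ^ (k i * k j)"
      by (simp add: power_mult power2_eq_square power_mult_distrib mult.commute flip: power_mult)
    have e: "x i / x j / Q ^ k j = x i / (x j * Q ^ k j)" "1 / (x i / x j * Q ^ k i) = x j / (x i * Q ^ k i)"
      "x i / x j * Q ^ k i / Q ^ k j = x i * Q ^ k i / (x j * Q ^ k j)"
      by simp_all
    have "(x j * q ^ (2 * k j) * \<theta> (x i * q ^ (2 * k i) / (x j * q ^ (2 * k j)))) * (G i j * G j i)
       = x j * (Q ^ k j * \<theta> (x i / x j * Q ^ k i / Q ^ k j) * Q ^ (k i * k j) *
         (ellfact (x i / x j / Q ^ k j) Q p (k i) * ellfact (1 / (x i / x j * Q ^ k i)) Q p (k j)))"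
      unfolding G_def power_mult[of q 2] e pw[symmetric] by (simp only: mult_ac)
    also have "\<dots> = (x j * \<theta> (x i / x j)) * (H i j * H j i)"
      using nz by (subst Delta_pair) (simp_all add: H_def mult_ac)
    finally show "(x j * q ^ (2 * k j) * \<theta> (x i * q ^ (2 * k i) / (x j * q ^ (2 * k j)))) * (G i j * G j i)
      = (x j * \<theta> (x i / x j)) * (H i j * H j i)" .
  qed
  also have "\<dots> = Delta r x p * (-1) ^ K * (\<Prod>i=1..r. \<Prod>j=1..r. H i j)"
    unfolding prod_square_pairs Delta_def K_def power_sum prod.distrib by (simp add: mult_ac)
  finally show ?thesis
    unfolding H_def .
qed

text \<open>The summand of the sum with a free c. For c = q^{-N} one has q/c = q^{N+1}, a x_i q^2/c
  = a x_i q^{N+2} and a x_i q c = a x_i q^{1-N}.\<close>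

definition summand :: "nat \<Rightarrow> complex \<Rightarrow> (nat \<Rightarrow> complex) \<Rightarrow> (nat \<Rightarrow> complex) \<Rightarrow> complex \<Rightarrow> (nat \<Rightarrow> nat) \<Rightarrow> complex" where
  "summand r a b x c k = (let K = (\<Sum>i=1..r. k i) in
      Delta r (\<lambda>i. x i * q ^ (2 * k i)) p / Delta r x p
      * (ellfact c q p K * ellfact (q / c) q p K / (\<Prod>i=1..r+2. ellfact (a * q / b i) q p K))
      * q ^ K
      * (\<Prod>i=1..r.
          \<theta> (a * x i * q ^ (K + 2 * k i)) / \<theta> (a * x i)
          * (ellfact (a * x i) q p K * (\<Prod>j=1..r+2. ellfact (x i * b j) Q p (k i))
             / (ellfact (a * x i * q\<^sup>2 / c) Q p (k i)
                * ellfact (a * x i * q * c) Q p (k i)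
                * (\<Prod>j=1..r. ellfact (Q * x i / x j) Q p (k i))))))"

lemma tendsto_ellfact [tendsto_intros]:
  assumes "(f \<longlongrightarrow> z) F" "z \<noteq> 0" "s \<noteq> 0"
  shows "((\<lambda>u. ellfact (f u) s p k) \<longlongrightarrow> ellfact z s p k) F"
  unfolding ellfact_def using assms by (intro tendsto_prod tendsto_theta tendsto_mult tendsto_const) auto

section \<open>Specialisation to geometric strings\<close>

text \<open>The cell (i, s) labels the variable x_i Q^s. A multi-index k becomes the set of the
  first k_i cells of each string, which is how subsets of cells encode multi-indices.\<close>

definition lower :: "nat \<Rightarrow> (nat \<Rightarrow> nat) \<Rightarrow> (nat \<times> nat) set" where
  "lower r k = Sigma {1..r} (\<lambda>i. {..<k i})"

definition string :: "(nat \<Rightarrow> complex) \<Rightarrow> nat \<times> nat \<Rightarrow> complex" where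
  "string x = (\<lambda>(i, s). x i * Q ^ s)"

lemma finite_lower [simp]: "finite (lower r k)"
  by (simp add: lower_def)

lemma card_lower: "card (lower r k) = (\<Sum>i=1..r. k i)"
  by (simp add: lower_def)

lemma lower_diff: "lower r n - lower r k = Sigma {1..r} (\<lambda>i. {k i..<n i})"
  by (auto simp: lower_def)

text \<open>A factor $\theta(1)$ appears as soon as $I$ contains the successor of a missing element of some string.\<close>

lemma core_term_not_lower:
  assumes I: "I \<subseteq> lower r n" "I \<notin> lower r ` ({1..r} \<rightarrow>\<^sub>E UNIV)" and x: "\<And>i. i \<in> {1..r} \<Longrightarrow> x i \<noteq> 0"
  shows "core_term a b b' c (string x) (lower r n) I = 0"
proof -
  have "\<exists>i s. (i, Suc s) \<in> I \<and> (i, s) \<notin> I"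
  proof (rule ccontr)
    assume "\<not> ?thesis"
    then have down: "(i, s) \<in> I" if "(i, Suc s) \<in> I" for i s
      using that by blast
    \<comment> \<open>A downward closed part of a string is the segment before its first missing
      cell; cell \<open>n i\<close> is missing, so the least one exists.\<close>
    define k where "k = restrict (\<lambda>i. LEAST s. (i, s) \<notin> I) {1..r}"
    have "(i, s) \<in> I \<longleftrightarrow> s < k i" if i: "i \<in> {1..r}" for i s
    proof -
      have ex: "(i, n i) \<notin> I" using I by (auto simp: lower_def)
      have ki: "k i = (LEAST s. (i, s) \<notin> I)" using i by (simp add: k_def)
      have "(i, k i) \<notin> I" unfolding ki using ex by (rule LeastI)
      then have "(i, k i + d) \<notin> I" for d
        using down by (induction d) auto
      then have "s < k i" if "(i, s) \<in> I"
        using that by (metis le_Suc_ex linorder_not_le)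
      moreover have "(i, s) \<in> I" if "s < k i"
        using not_less_Least[of s "\<lambda>s. (i, s) \<notin> I"] that unfolding ki by blast
      ultimately show ?thesis by blast
    qed
    then have "I = lower r k"
      using I(1) by (auto simp: lower_def)
    moreover have "k \<in> {1..r} \<rightarrow>\<^sub>E UNIV"
      by (auto simp: k_def)
    ultimately show False using I(2) by blast
  qed
  then obtain i s where isI: "(i, Suc s) \<in> I" "(i, s) \<notin> I" by blast
  then have isA: "(i, s) \<in> lower r n - I" "x i \<noteq> 0"
    using I(1) x by (auto simp: lower_def)
  have "\<theta> (string x (i, Suc s) / (Q * string x (i, s))) = 0"
    using isA q_nonzero by (simp add: string_def)
  then have "(\<Prod>u\<in>I. \<Prod>v\<in>lower r n - I. \<theta> (string x u / (q\<^sup>2 * string x v)) / \<theta> (string x u / string x v)) = 0"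
    using isI isA finite_subset[OF I(1)] by (intro prod_zero bexI[OF _ isI(1)] bexI[OF _ isA(1)]) auto
  then show ?thesis
    by (simp only: core_term_def Let_def mult_zero_right mult_zero_left)
qed

lemma prod_Sigma_pair:
  "finite A \<Longrightarrow> (\<And>i. finite (B i)) \<Longrightarrow> (\<Prod>u\<in>Sigma A B. f u) = (\<Prod>i\<in>A. \<Prod>s\<in>B i. f (i, s))"
  by (subst prod.Sigma) auto

lemma ellfact_shift_prod: "k \<le> n \<Longrightarrow> ellfact z w p k * (\<Prod>s=k..<n. \<theta> (z * w ^ s)) = ellfact z w p n"
  unfolding ellfact_def
  by (metis atLeast0LessThan le0 prod.atLeastLessThan_concat)

text \<open>Consecutive cells differ by Q, exactly the shift between numerator and denominator of
  the pair factors. So the product over the missing cells of string j telescopes, and the remaining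
  products are runs of theta functions.\<close>

lemma core_term_lower:
  fixes k n :: "nat \<Rightarrow> nat"
  assumes x: "\<And>i. i \<in> {1..r} \<Longrightarrow> x i \<noteq> 0" and nz: "a \<noteq> 0" "c \<noteq> 0"
    and kn: "\<And>i. i \<in> {1..r} \<Longrightarrow> k i \<le> n i"
    and dist: "\<And>i j s t. i \<in> {1..r} \<Longrightarrow> j \<in> {1..r} \<Longrightarrow> s < n i \<Longrightarrow> t \<le> n j \<Longrightarrow> (i, s) \<noteq> (j, t) \<Longrightarrow>
        \<theta> (x i * Q ^ s / (x j * Q ^ t)) \<noteq> 0"
    and gx: "\<And>i. i \<in> {1..r} \<Longrightarrow> gen (a * x i)" "\<And>i. i \<in> {1..r} \<Longrightarrow> gen (a * x i / c)"
       "\<And>i. i \<in> {1..r} \<Longrightarrow> gen (a * x i * c)"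
  defines "K \<equiv> (\<Sum>i=1..r. k i)"
  shows "core_term a b b' c (string x) (lower r n) (lower r k)
    = (-1) ^ K / q ^ K\<^sup>2
     * (ellfact c q p K * ellfact (q / c) q p K / (ellfact (a * q / b) q p K * ellfact (a * q / b') q p K))
     * (\<Prod>i=1..r. \<Prod>j=1..r. ellfact (x i / (x j * Q ^ n j)) Q p (k i) / ellfact (x i / (x j * Q ^ k j)) Q p (k i))
     * (\<Prod>i=1..r. ellfact (x i * b) Q p (k i) * ellfact (x i * b') Q p (k i) / ellfact (a * x i * q ^ K) q p (2 * k i)
        * (ellfact (a * x i * q\<^sup>2 / c) Q p (n i) * ellfact (a * x i * q * c) Q p (n i)
          / (ellfact (a * x i * q\<^sup>2 / c) Q p (k i) * ellfact (a * x i * q * c) Q p (k i)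
             * ellfact (a * x i * q ^ (K + 2 * k i + 1)) q p (2 * (n i - k i)))))"
proof -
  have 1: "(\<Prod>u\<in>lower r k. \<Prod>v\<in>lower r n - lower r k. \<theta> (string x u / (q\<^sup>2 * string x v)) / \<theta> (string x u / string x v))
    = (\<Prod>i=1..r. \<Prod>j=1..r. ellfact (x i / (x j * Q ^ n j)) Q p (k i) / ellfact (x i / (x j * Q ^ k j)) Q p (k i))"
  proof -
    have "(\<Prod>t=k j..<n j. \<theta> (string x (i, s) / (q\<^sup>2 * string x (j, t))) / \<theta> (string x (i, s) / string x (j, t)))
      = \<theta> (x i / (x j * Q ^ n j) * Q ^ s) / \<theta> (x i / (x j * Q ^ k j) * Q ^ s)"
      if i: "i \<in> {1..r}" and j: "j \<in> {1..r}" and s: "s < k i" for i j s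
    proof -
      define h where "h = (\<lambda>t. \<theta> (x i * Q ^ s / (x j * Q ^ t)))"
      have h: "h t \<noteq> 0" if "k j \<le> t" "t \<le> n j" for t
        unfolding h_def using that i j s kn[OF i] by (intro dist) auto
      have "(\<Prod>t=k j..<n j. \<theta> (string x (i, s) / (q\<^sup>2 * string x (j, t))) / \<theta> (string x (i, s) / string x (j, t)))
        = (\<Prod>t=k j..<n j. h (Suc t) / h t)"
        by (simp add: h_def string_def mult_ac)
      moreover have "(\<Prod>t=k j..<n j. h (Suc t) / h t) * h (k j) = h (n j)"
        using h kn[OF j] by (intro prod_telescope) auto
      ultimately have "(\<Prod>t=k j..<n j. \<theta> (string x (i, s) / (q\<^sup>2 * string x (j, t))) / \<theta> (string x (i, s) / string x (j, t)))
        = h (n j) / h (k j)"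
        using h[of "k j"] kn[OF j] by (simp add: nonzero_eq_divide_eq)
      then show ?thesis
        by (simp add: h_def mult_ac)
    qed
    then have "(\<Prod>u\<in>lower r k. \<Prod>v\<in>lower r n - lower r k. \<theta> (string x u / (q\<^sup>2 * string x v)) / \<theta> (string x u / string x v))
      = (\<Prod>i=1..r. \<Prod>s<k i. \<Prod>j=1..r. \<theta> (x i / (x j * Q ^ n j) * Q ^ s) / \<theta> (x i / (x j * Q ^ k j) * Q ^ s))"
      unfolding lower_diff unfolding lower_def
      by (subst prod_Sigma_pair, simp, simp, subst prod_Sigma_pair, simp, simp, intro prod.cong refl) simp_all
    also have "\<dots> = (\<Prod>i=1..r. \<Prod>j=1..r. \<Prod>s<k i. \<theta> (x i / (x j * Q ^ n j) * Q ^ s) / \<theta> (x i / (x j * Q ^ k j) * Q ^ s))"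
      by (intro prod.cong refl prod.swap)
    finally show ?thesis
      by (simp only: ellfact_def prod_dividef)
  qed
  have ed: "ellfact z q p (2 * m) = (\<Prod>s<m. \<theta> (z * Q ^ s) * \<theta> (z * q * Q ^ s))" for z m
    unfolding ellfact_double by (simp add: ellfact_def prod.distrib)
  have 2: "(\<Prod>u\<in>lower r k. \<theta> (string x u * b) * \<theta> (string x u * b') / (\<theta> (a * string x u * q ^ K) * \<theta> (a * string x u * q ^ (K + 1))))
    = (\<Prod>i=1..r. ellfact (x i * b) Q p (k i) * ellfact (x i * b') Q p (k i) / ellfact (a * x i * q ^ K) q p (2 * k i))"
    unfolding lower_def ed unfolding ellfact_def
    by (simp add: prod_Sigma_pair string_def prod_dividef prod.distrib mult_ac)
  have 3: "(\<Prod>u\<in>lower r n - lower r k. \<theta> (a * string x u * q\<^sup>2 / c) * \<theta> (a * string x u * q * c)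
         / (\<theta> (a * string x u * q ^ (K + 1)) * \<theta> (a * string x u * q ^ (K + 2))))
    = (\<Prod>i=1..r. ellfact (a * x i * q\<^sup>2 / c) Q p (n i) * ellfact (a * x i * q * c) Q p (n i)
          / (ellfact (a * x i * q\<^sup>2 / c) Q p (k i) * ellfact (a * x i * q * c) Q p (k i)
             * ellfact (a * x i * q ^ (K + 2 * k i + 1)) q p (2 * (n i - k i))))"
  proof -
    have "(\<Prod>s=k i..<n i. \<theta> (a * string x (i, s) * q\<^sup>2 / c) * \<theta> (a * string x (i, s) * q * c)
         / (\<theta> (a * string x (i, s) * q ^ (K + 1)) * \<theta> (a * string x (i, s) * q ^ (K + 2))))
      = ellfact (a * x i * q\<^sup>2 / c) Q p (n i) * ellfact (a * x i * q * c) Q p (n i)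
          / (ellfact (a * x i * q\<^sup>2 / c) Q p (k i) * ellfact (a * x i * q * c) Q p (k i)
             * ellfact (a * x i * q ^ (K + 2 * k i + 1)) q p (2 * (n i - k i)))" if i: "i \<in> {1..r}" for i
    proof -
      have nz1: "ellfact (a * x i * q\<^sup>2 / c) Q p (k i) \<noteq> 0"
        using gen_ellfact_square[OF gen_power[OF gx(2)[OF i], of 2]] by (simp add: mult_ac)
      have nz2: "ellfact (a * x i * q * c) Q p (k i) \<noteq> 0"
        using gen_ellfact_square[OF gen_mult_q[OF gx(3)[OF i]]] by (simp add: mult_ac)
      have "(\<Prod>s=k i..<n i. \<theta> (a * x i * q\<^sup>2 / c * Q ^ s)) = ellfact (a * x i * q\<^sup>2 / c) Q p (n i) / ellfact (a * x i * q\<^sup>2 / c) Q p (k i)"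
        using ellfact_shift_prod[OF kn[OF i], of "a * x i * q\<^sup>2 / c" Q] nz1 by (simp add: nonzero_eq_divide_eq mult.commute)
      moreover have "(\<Prod>s=k i..<n i. \<theta> (a * x i * q * c * Q ^ s)) = ellfact (a * x i * q * c) Q p (n i) / ellfact (a * x i * q * c) Q p (k i)"
        using ellfact_shift_prod[OF kn[OF i], of "a * x i * q * c" Q] nz2 by (simp add: nonzero_eq_divide_eq mult.commute)
      moreover have "(\<Prod>s=k i..<n i. \<theta> (a * x i * q ^ (K + 1) * Q ^ s) * \<theta> (a * x i * q ^ (K + 2) * Q ^ s))
        = ellfact (a * x i * q ^ (K + 2 * k i + 1)) q p (2 * (n i - k i))"
      proof -
        have "(\<Prod>s=k i..<n i. \<theta> (a * x i * q ^ (K + 1) * Q ^ s) * \<theta> (a * x i * q ^ (K + 2) * Q ^ s))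
          = (\<Prod>s=0..<n i - k i. \<theta> (a * x i * q ^ (K + 1) * Q ^ (s + k i)) * \<theta> (a * x i * q ^ (K + 2) * Q ^ (s + k i)))"
          using prod.shift_bounds_nat_ivl[of _ 0 "k i" "n i - k i"] kn[OF i] by simp
        also have "\<dots> = ellfact (a * x i * q ^ (K + 2 * k i + 1)) q p (2 * (n i - k i))"
          unfolding ed atLeast0LessThan by (intro prod.cong refl) (simp add: power_add mult_ac power_mult power2_eq_square power_mult_distrib)
        finally show ?thesis .
      qed
      moreover have "(\<Prod>s=k i..<n i. \<theta> (a * string x (i, s) * q\<^sup>2 / c) * \<theta> (a * string x (i, s) * q * c)
         / (\<theta> (a * string x (i, s) * q ^ (K + 1)) * \<theta> (a * string x (i, s) * q ^ (K + 2))))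
         = (\<Prod>s=k i..<n i. \<theta> (a * x i * q\<^sup>2 / c * Q ^ s)) * (\<Prod>s=k i..<n i. \<theta> (a * x i * q * c * Q ^ s))
           / (\<Prod>s=k i..<n i. \<theta> (a * x i * q ^ (K + 1) * Q ^ s) * \<theta> (a * x i * q ^ (K + 2) * Q ^ s))"
        unfolding prod.distrib[symmetric] prod_dividef[symmetric] by (simp add: string_def mult_ac)
      ultimately show ?thesis by simp
    qed
    then show ?thesis
      unfolding lower_diff by (subst prod_Sigma_pair, simp, simp, intro prod.cong refl)
  qed
  show ?thesis
    unfolding core_term_def card_lower K_def[symmetric] Let_def 1 2 3 prod.distrib by (simp only: mult.assoc)
qed

lemma gen_power_Q: "gen z \<Longrightarrow> gen (z * Q ^ n)"
  using gen_power[of z "2 * n"] unfolding power_mult .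

lemma prod_split_last2: "(\<Prod>i=1..r+2. f i) = (\<Prod>i=1..r. f i) * f (r + 1) * f (r + 2 :: nat)"
  for f :: "nat \<Rightarrow> 'a::comm_monoid_mult"
  by (simp add: mult_ac)

text \<open>The quotient of the two terms does not involve k. The factors depending on k match
  through \<open>Delta_shift\<close> and through a regrouping of the theta functions in a
  x_i.\<close>

lemma summand_core:
  fixes k n :: "nat \<Rightarrow> nat"
  assumes x: "\<And>i. i \<in> {1..r} \<Longrightarrow> x i \<noteq> 0" and nz: "a \<noteq> 0" "c \<noteq> 0" and D: "Delta r x p \<noteq> 0"
    and kn: "\<And>i. i \<in> {1..r} \<Longrightarrow> k i \<le> n i"
    and nN: "\<And>i. i \<in> {1..r} \<Longrightarrow> n i \<le> N"
    and dist: "\<And>i j s t. i \<in> {1..r} \<Longrightarrow> j \<in> {1..r} \<Longrightarrow> s \<le> N \<Longrightarrow> t \<le> N \<Longrightarrow> (i, s) \<noteq> (j, t) \<Longrightarrow>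
        \<theta> (x i * Q ^ s / (x j * Q ^ t)) \<noteq> 0"
    and gx: "\<And>i. i \<in> {1..r} \<Longrightarrow> gen (a * x i)" "\<And>i. i \<in> {1..r} \<Longrightarrow> gen (a * x i / c)"
       "\<And>i. i \<in> {1..r} \<Longrightarrow> gen (a * x i * c)"
    and b: "\<And>i. i \<in> {1..r} \<Longrightarrow> b i = 1 / (x i * Q ^ n i)"
  shows "summand r a b x c k
    = (\<Prod>i=1..r. ellfact (a * x i * q) q p (2 * n i)
         / (ellfact (a * x i * q\<^sup>2 / c) Q p (n i) * ellfact (a * x i * q * c) Q p (n i)))
      * core_term a (b (r + 1)) (b (r + 2)) c (string x) (lower r n) (lower r k)"
proof -
  define K where "K = (\<Sum>i=1..r. k i)"
  define P where "P = (\<Prod>i=1..r. \<Prod>j=1..r. ellfact (x i / (x j * Q ^ k j)) Q p (k i))"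
  define P2 where "P2 = (\<Prod>i=1..r. \<Prod>j=1..r. ellfact (Q * x i / x j) Q p (k i))"
  define D' where "D' = Delta r (\<lambda>i. x i * q ^ (2 * k i)) p"
  define PA where "PA = (\<Prod>i=1..r. \<theta> (a * x i * q ^ (K + 2 * k i)) * ellfact (a * x i) q p K / (\<theta> (a * x i) * ellfact (a * q / b i) q p K))"
  define PB where "PB = (\<Prod>i=1..r. \<Prod>j=1..r. ellfact (x i / (x j * Q ^ n j)) Q p (k i))"
  define PC where "PC = (\<Prod>i=1..r. ellfact (x i * b (r + 1)) Q p (k i) * ellfact (x i * b (r + 2)) Q p (k i))"
  define PD where "PD = (\<Prod>i=1..r. 1 / (ellfact (a * x i * q\<^sup>2 / c) Q p (k i) * ellfact (a * x i * q * c) Q p (k i)))"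
  define PN where "PN = (\<Prod>i=1..r. ellfact (a * x i * q\<^sup>2 / c) Q p (n i) * ellfact (a * x i * q * c) Q p (n i))"
  define PE where "PE = (\<Prod>i=1..r. ellfact (a * x i * q) q p (2 * n i))"
  define PF where "PF = (\<Prod>i=1..r. ellfact (a * x i * q ^ K) q p (2 * k i) * ellfact (a * x i * q ^ (K + 2 * k i + 1)) q p (2 * (n i - k i)))"
  have dist': "\<theta> (x i * Q ^ s / (x j * Q ^ t)) \<noteq> 0"
    if "i \<in> {1..r}" "j \<in> {1..r}" "s < n i" "t \<le> n j" "(i, s) \<noteq> (j, t)" for i j s t
    using that nN[of i] nN[of j] by (intro dist) auto
  have kN: "k i \<le> N" if "i \<in> {1..r}" for i
    using kn[OF that] nN[OF that] by simp
  have P0: "P \<noteq> 0"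
  proof -
    have "\<theta> (x i / (x j * Q ^ k j) * Q ^ s) \<noteq> 0" if "i \<in> {1..r}" "j \<in> {1..r}" "s < k i" for i j s
    proof -
      have "x i / (x j * Q ^ k j) * Q ^ s = x i * Q ^ s / (x j * Q ^ k j)" by simp
      then show ?thesis
        using dist[of i j s "k j"] that kN[of i] kN[of j] by auto
    qed
    then show ?thesis
      unfolding P_def by (auto simp: ellfact_eq_0_iff)
  qed
  have P20: "P2 \<noteq> 0"
  proof -
    have "\<theta> (Q * x i / x j * Q ^ s) \<noteq> 0" if "i \<in> {1..r}" "j \<in> {1..r}" "s < k i" for i j s
    proof -
      have "Q * x i / x j * Q ^ s = x i * Q ^ Suc s / (x j * Q ^ 0)" by simp
      moreover have "\<theta> (x i * Q ^ Suc s / (x j * Q ^ 0)) \<noteq> 0"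
        using that kN[of i] by (intro dist) auto
      ultimately show ?thesis by (simp only: not_False_eq_True)
    qed
    then show ?thesis
      unfolding P2_def by (auto simp: ellfact_eq_0_iff)
  qed
  have "D' * q ^ K * q ^ K\<^sup>2 * P = Delta r x p * (-1) ^ K * P2"
    unfolding D'_def P_def P2_def K_def by (rule Delta_shift[OF x])
  then have e1: "D' / Delta r x p * q ^ K / P2 = (-1) ^ K / q ^ K\<^sup>2 / P"
    using D P0 P20 q_nonzero by (simp add: field_simps)
  have e2: "PA = PE / PF"
    unfolding PA_def PE_def PF_def prod_dividef[symmetric]
  proof (intro prod.cong refl)
    fix i assume i: "i \<in> {1..r}"
    define z where "z = a * x i"
    define m where "m = n i - k i"
    have nk: "n i = k i + m" using kn[OF i] by (simp add: m_def)
    have gz: "gen z" using gx(1)[OF i] by (simp add: z_def)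
    have bz: "a * q / b i = z * q * q ^ (2 * n i)"
      using b[OF i] x[OF i] power_mult[of q 2 "n i"] by (simp add: z_def mult_ac)
    \<comment> \<open>The run z, zq, ..., zq^{K + 2n_i} is cut in two ways: into K, 2k_i, 1 and
      2(n_i - k_i) factors, or into 1, 2n_i and K factors.\<close>
    have "ellfact z q p K * ellfact (z * q ^ K) q p (2 * k i) * \<theta> (z * q ^ (K + 2 * k i))
         * ellfact (z * q ^ (K + 2 * k i + 1)) q p (2 * m) = ellfact z q p (Suc (K + 2 * k i) + 2 * m)"
      unfolding ellfact_add[of z q p "Suc (K + 2 * k i)"] ellfact_Suc ellfact_add[of z q p K] by (simp add: mult_ac)
    also have "\<dots> = ellfact z q p (Suc (2 * n i + K))"
      using nk by (simp add: algebra_simps)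
    also have "\<dots> = \<theta> z * ellfact (z * q) q p (2 * n i) * ellfact (z * q * q ^ (2 * n i)) q p K"
      by (simp only: ellfact_Suc' ellfact_add mult.assoc)
    finally have *: "\<theta> (z * q ^ (K + 2 * k i)) * ellfact z q p K * (ellfact (z * q ^ K) q p (2 * k i) * ellfact (z * q ^ (K + 2 * k i + 1)) q p (2 * m))
      = ellfact (z * q) q p (2 * n i) * (\<theta> z * ellfact (z * q * q ^ (2 * n i)) q p K)"
      by (simp only: mult_ac)
    have 1: "\<theta> z * ellfact (z * q * q ^ (2 * n i)) q p K \<noteq> 0"
      and 2: "ellfact (z * q ^ K) q p (2 * k i) * ellfact (z * q ^ (K + 2 * k i + 1)) q p (2 * m) \<noteq> 0"
      using gz gen_theta gen_ellfact gen_power gen_mult_q by (metis mult_eq_0_iff)+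
    show "\<theta> (a * x i * q ^ (K + 2 * k i)) * ellfact (a * x i) q p K / (\<theta> (a * x i) * ellfact (a * q / b i) q p K)
      = ellfact (a * x i * q) q p (2 * n i) / (ellfact (a * x i * q ^ K) q p (2 * k i) * ellfact (a * x i * q ^ (K + 2 * k i + 1)) q p (2 * (n i - k i)))"
      unfolding bz z_def[symmetric] m_def[symmetric] by (rule iffD2[OF frac_eq_eq[OF 1 2] *])
  qed
  have eB: "(\<Prod>i=1..r. \<Prod>j=1..r. ellfact (x i * b j) Q p (k i)) = PB"
    unfolding PB_def by (intro prod.cong refl) (simp add: b)
  have "summand r a b x c k = (D' / Delta r x p * q ^ K / P2)
     * (ellfact c q p K * ellfact (q / c) q p K / (ellfact (a * q / b (r + 1)) q p K * ellfact (a * q / b (r + 2)) q p K))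
     * PA * PB * PC * PD"
    unfolding summand_def Let_def K_def[symmetric] D'_def[symmetric] prod_split_last2 eB[symmetric]
      P2_def PA_def PC_def PD_def prod.distrib prod_dividef
    by (simp add: mult_ac)
  also have "\<dots> = PE / PN * ((-1) ^ K / q ^ K\<^sup>2
     * (ellfact c q p K * ellfact (q / c) q p K / (ellfact (a * q / b (r + 1)) q p K * ellfact (a * q / b (r + 2)) q p K))
     * (PB / P) * (PC * PD * PN / PF))"
  proof -
    have "PN \<noteq> 0"
      unfolding PN_def
      using gen_ellfact_square[OF gen_power[OF gx(2), of _ 2]] gen_ellfact_square[OF gen_mult_q[OF gx(3)]]
      by (simp add: mult_ac)
    then show ?thesis
      unfolding e1 e2 by (simp add: mult_ac)
  qed
  also have "\<dots> = (\<Prod>i=1..r. ellfact (a * x i * q) q p (2 * n i)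
         / (ellfact (a * x i * q\<^sup>2 / c) Q p (n i) * ellfact (a * x i * q * c) Q p (n i)))
      * core_term a (b (r + 1)) (b (r + 2)) c (string x) (lower r n) (lower r k)"
  proof -
    have "core_term a (b (r + 1)) (b (r + 2)) c (string x) (lower r n) (lower r k) = ((-1) ^ K / q ^ K\<^sup>2
     * (ellfact c q p K * ellfact (q / c) q p K / (ellfact (a * q / b (r + 1)) q p K * ellfact (a * q / b (r + 2)) q p K))
     * (PB / P) * (PC * PD * PN / PF))"
      by (rule trans[OF core_term_lower[of r x a c k n "b (r + 1)" "b (r + 2)"]], (fact x nz kn dist' gx)+,
          unfold K_def[symmetric] PB_def P_def PC_def PD_def PN_def PF_def prod.distrib prod_dividef, simp add: mult_ac)
    then show ?thesis
      unfolding PE_def PN_def prod_dividef by simp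
  qed
  finally show ?thesis .
qed

text \<open>Since b_i x_i = Q^{-n_i}, the balancing condition becomes the stated value of b_{r+1}
  b_{r+2}, and this is the condition of \<open>subset_sum\<close> for M cells. The prefactor is
  constant in k, so it passes in front of the sum.\<close>

theorem rectangular_sum:
  fixes n :: "nat \<Rightarrow> nat"
  assumes x: "\<And>i. i \<in> {1..r} \<Longrightarrow> x i \<noteq> 0" and nz: "a \<noteq> 0" "c \<noteq> 0" "b (r + 1) \<noteq> 0" and D: "Delta r x p \<noteq> 0"
    and nN: "\<And>i. i \<in> {1..r} \<Longrightarrow> n i \<le> N"
    and dist: "\<And>i j s t. i \<in> {1..r} \<Longrightarrow> j \<in> {1..r} \<Longrightarrow> s \<le> N \<Longrightarrow> t \<le> N \<Longrightarrow> (i, s) \<noteq> (j, t) \<Longrightarrow>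
        \<theta> (x i * Q ^ s / (x j * Q ^ t)) \<noteq> 0"
    and gx: "\<And>i. i \<in> {1..r} \<Longrightarrow> gen (a * x i)" "\<And>i. i \<in> {1..r} \<Longrightarrow> gen (a * x i / c)"
       "\<And>i. i \<in> {1..r} \<Longrightarrow> gen (a * x i * c)"
    and gxx: "\<And>i j. i \<in> {1..r} \<Longrightarrow> j \<in> {1..r} \<Longrightarrow> gen (a\<^sup>2 * x i * x j)"
    and gb: "gen (a / b (r + 1))"
    and b: "\<And>i. i \<in> {1..r} \<Longrightarrow> b i = 1 / (x i * Q ^ n i)"
  defines "M \<equiv> (\<Sum>i=1..r. n i)"
  assumes bal: "b (r + 1) * b (r + 2) = a\<^sup>2 * q * Q ^ M"
  shows "(\<Sum>k\<in>({1..r} \<rightarrow>\<^sub>E UNIV) \<inter> {k. \<forall>i\<in>{1..r}. k i \<le> n i}. summand r a b x c k)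
    = (\<Prod>i=1..r. ellfact (a * x i * q) q p (2 * n i)
         / (ellfact (a * x i * q\<^sup>2 / c) Q p (n i) * ellfact (a * x i * q * c) Q p (n i)))
      * (ellfact (a * q\<^sup>2 / (b (r + 1) * c)) Q p M * ellfact (a * q * c / b (r + 1)) Q p M
        / ellfact (a * q / b (r + 1)) q p (2 * M))"
proof -
  define KK where "KK = ({1..r} \<rightarrow>\<^sub>E UNIV) \<inter> {k :: nat \<Rightarrow> nat. \<forall>i\<in>{1..r}. k i \<le> n i}"
  define C where "C = (\<Prod>i=1..r. ellfact (a * x i * q) q p (2 * n i)
         / (ellfact (a * x i * q\<^sup>2 / c) Q p (n i) * ellfact (a * x i * q * c) Q p (n i)))"
  let ?T = "core_term a (b (r + 1)) (b (r + 2)) c (string x) (lower r n)"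
  have "(\<Sum>k\<in>KK. summand r a b x c k) = (\<Sum>k\<in>KK. C * ?T (lower r k))"
    unfolding C_def by (intro sum.cong refl summand_core[where N = N] x nz D nN dist gx b) (auto simp: KK_def)
  also have "\<dots> = C * (\<Sum>k\<in>KK. ?T (lower r k))"
    by (simp add: sum_distrib_left)
  also have "(\<Sum>k\<in>KK. ?T (lower r k)) = (\<Sum>I\<in>lower r ` KK. ?T I)"
  proof (rule sum.reindex_cong[symmetric, of "lower r", OF _ refl refl])
    show "inj_on (lower r) KK"
    proof (rule inj_onI)
      fix k l assume kl: "k \<in> KK" "l \<in> KK" "lower r k = lower r l"
      show "k = l"
      proof (rule PiE_ext[of k "{1..r}" "\<lambda>_. UNIV" l])
        fix i assume i: "i \<in> {1..r}"
        have "s < k i \<longleftrightarrow> s < l i" for s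
          using arg_cong[OF kl(3), of "\<lambda>A. (i, s) \<in> A"] i by (simp add: lower_def)
        then show "k i = l i"
          by (metis nat_neq_iff)
      qed (use kl in \<open>auto simp: KK_def\<close>)
    qed
  qed
  also have "\<dots> = (\<Sum>I\<in>Pow (lower r n). ?T I)"
  proof (intro sum.mono_neutral_left ballI)
    show "lower r ` KK \<subseteq> Pow (lower r n)"
      by (force simp: KK_def lower_def)
    fix I assume I: "I \<in> Pow (lower r n) - lower r ` KK"
    have "I \<notin> lower r ` ({1..r} \<rightarrow>\<^sub>E UNIV)"
    proof
      assume "I \<in> lower r ` ({1..r} \<rightarrow>\<^sub>E UNIV)"
      then obtain k where k: "k \<in> {1..r} \<rightarrow>\<^sub>E UNIV" "I = lower r k" by blast
      have "k i \<le> n i" if i: "i \<in> {1..r}" for i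
      proof (rule ccontr)
        assume "\<not> k i \<le> n i"
        then have "(i, n i) \<in> I" using i k by (simp add: lower_def)
        then show False using I by (auto simp: lower_def)
      qed
      then show False using I k by (auto simp: KK_def)
    qed
    then show "?T I = 0"
      using I by (intro core_term_not_lower x) auto
  qed simp
  also have "\<dots> = ellfact (a * q\<^sup>2 / (b (r + 1) * c)) Q p M * ellfact (a * q * c / b (r + 1)) Q p M
        / ellfact (a * q / b (r + 1)) q p (2 * M)"
    unfolding M_def card_lower[symmetric]
  proof (rule subset_sum)
    show "b (r + 1) * b (r + 2) = a\<^sup>2 * q ^ (2 * card (lower r n) + 1)"
      using bal by (simp add: card_lower M_def power_mult mult_ac)
  next
    fix u assume u: "u \<in> lower r n"
    then obtain i s where i: "u = (i, s)" "i \<in> {1..r}" "s < n i" by (auto simp: lower_def)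
    show "string x u \<noteq> 0" using i x q_nonzero by (simp add: string_def)
    show "gen (a * string x u)"
      using gen_power_Q[OF gx(1)[OF i(2)], of s] by (simp add: i(1) string_def mult_ac)
    fix v assume v: "v \<in> lower r n"
    then obtain j t where j: "v = (j, t)" "j \<in> {1..r}" "t < n j" by (auto simp: lower_def)
    show "gen (a\<^sup>2 * string x u * string x v)"
      using gen_power_Q[OF gxx[OF i(2) j(2)], of "s + t"]
      by (simp add: i(1) j(1) string_def power_add mult_ac)
    assume "u \<noteq> v"
    then show "\<theta> (string x u / string x v) \<noteq> 0"
      using dist[of i j s t] i j nN[OF i(2)] nN[OF j(2)] by (auto simp: string_def)
  qed (use nz gb in auto)
  finally show ?thesis
    unfolding C_def KK_def by simp
qed

section \<open>Reflection and exchange rules for shifted factorials\<close>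

lemma ellfact_reflect:
  assumes "y \<noteq> 0"
  shows "ellfact (Q / (y * Q ^ n)) Q p n = (\<Prod>s<n. - 1 / (y * Q ^ s)) * ellfact y Q p n"
proof -
  have "ellfact (Q / (y * Q ^ n)) Q p n = (\<Prod>s<n. \<theta> (Q / (y * Q ^ n) * Q ^ (n - Suc s)))"
    unfolding ellfact_def by (rule prod.nat_diff_reindex[symmetric])
  also have "\<dots> = (\<Prod>s<n. - 1 / (y * Q ^ s) * \<theta> (y * Q ^ s))"
  proof (intro prod.cong refl)
    fix s assume "s \<in> {..<n}"
    then have "Q ^ n = Q * Q ^ (n - Suc s) * Q ^ s"
      by (simp flip: power_Suc power_add)
    then have "Q / (y * Q ^ n) * Q ^ (n - Suc s) = 1 / (y * Q ^ s)"
      using q_nonzero assms by simp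
    then show "\<theta> (Q / (y * Q ^ n) * Q ^ (n - Suc s)) = - 1 / (y * Q ^ s) * \<theta> (y * Q ^ s)"
      using theta_inverse[of "y * Q ^ s"] q_nonzero assms by simp
  qed
  finally show ?thesis
    by (simp only: ellfact_def prod.distrib)
qed

text \<open>Exchanging m and n gives a quotient of two runs of length n; each is then read
  backwards. The monomials from the inversions cancel except for Q^{mn}.\<close>

lemma ellfact_reflect_ratio:
  assumes "gen y"
  shows "ellfact (Q / (y * Q ^ n)) Q p m / ellfact (Q / y) Q p m
    = ellfact y Q p n / ellfact (y / Q ^ m) Q p n / Q ^ (m * n)"
proof -
  define z where "z = Q / (y * Q ^ n)"
  have y: "y \<noteq> 0" using assms gen_nonzero by blast
  have gz: "gen z"
    using gen_power_Q[OF gen_inverse[OF gen_power_Q[OF assms, of n]], of 1] by (simp add: z_def)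
  have zn: "z * Q ^ n = Q / y" using q_nonzero by (simp add: z_def)
  have nz: "ellfact (z * Q ^ m) Q p n \<noteq> 0" "ellfact (z * Q ^ n) Q p m \<noteq> 0"
    using gen_ellfact_square gen_power_Q gz by blast+
  have "ellfact z Q p m / ellfact (z * Q ^ n) Q p m = ellfact z Q p n / ellfact (z * Q ^ m) Q p n"
    using ellfact_swap[of z Q p m n] nz by (simp add: frac_eq_eq)
  also have "ellfact z Q p n = (\<Prod>s<n. - 1 / (y * Q ^ s)) * ellfact y Q p n"
    unfolding z_def using y by (rule ellfact_reflect)
  also have "ellfact (z * Q ^ m) Q p n = (\<Prod>s<n. Q ^ m * (- 1 / (y * Q ^ s))) * ellfact (y / Q ^ m) Q p n"
  proof -
    have "z * Q ^ m = Q / (y / Q ^ m * Q ^ n)" by (simp add: z_def mult_ac)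
    then show ?thesis
      using ellfact_reflect[of "y / Q ^ m" n] y q_nonzero by simp
  qed
  also have "(\<Prod>s<n. Q ^ m * (- 1 / (y * Q ^ s))) = Q ^ (m * n) * (\<Prod>s<n. - 1 / (y * Q ^ s))"
    by (simp only: prod.distrib prod_constant card_lessThan power_mult)
  finally show ?thesis
    using y q_nonzero unfolding zn z_def by simp
qed

lemma ellfact_swap_ratio:
  assumes "gen z"
  shows "ellfact z Q p m / ellfact (z * Q ^ n) Q p m = ellfact z Q p n / ellfact (z * Q ^ m) Q p n"
proof -
  have "ellfact (z * Q ^ m) Q p n \<noteq> 0" "ellfact (z * Q ^ n) Q p m \<noteq> 0"
    using gen_ellfact_square gen_power_Q assms by blast+
  then show ?thesis
    using ellfact_swap[of z Q p m n] by (simp add: frac_eq_eq)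
qed

section \<open>Interpolation in the parameters $b_i$\<close>

text \<open>With this choice of $w$ and $v$, the right-hand sides for even and odd $N$ have the same form.\<close>

definition parity :: "nat \<Rightarrow> complex \<Rightarrow> complex \<Rightarrow> nat \<Rightarrow> nat \<Rightarrow> bool" where
  "parity N w v m m' \<longleftrightarrow> (N = 2 * m \<and> w = q\<^sup>2 \<and> v = q \<and> m' = m) \<or> (N + 1 = 2 * m \<and> w = q \<and> v = q\<^sup>2 \<and> m = Suc m')"

text \<open>The run zq, ..., zq^N is split into alternate factors: w starts the half that contains
  zq^N, and v starts the other. They have m and m' members.\<close>

lemma parity_facts:
  assumes "parity N w v m m'"
  shows "N = m + m'" "w \<noteq> 0" "v \<noteq> 0" "w * v = q * Q" "q\<^sup>2 * q ^ N = w * Q ^ m" "q / q ^ N = v / Q ^ m"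
    "\<And>z. ellfact (z * q) q p N = ellfact (z * w) Q p m * ellfact (z * v) Q p m'"
    "\<And>z n. ellfact (z * q) q p (2 * n) = ellfact (z * w) Q p n * ellfact (z * v) Q p n"
    "\<And>z. gen z \<Longrightarrow> gen (z * w)" "\<And>z. gen z \<Longrightarrow> gen (z * v)"
proof -
  have double: "ellfact (z * q) q p (2 * n) = ellfact (z * q) Q p n * ellfact (z * Q) Q p n" for z n
    unfolding ellfact_double by (simp add: power2_eq_square mult.assoc)
  have pw: "q ^ (2 * m) = Q ^ m" for m
    by (simp add: power_mult)
  consider "N = 2 * m" "w = q\<^sup>2" "v = q" "m' = m" | "N = Suc (2 * m')" "w = q" "v = q\<^sup>2" "m = Suc m'"
    using assms unfolding parity_def by auto
  then have "N = m + m' \<and> w \<noteq> 0 \<and> v \<noteq> 0 \<and> w * v = q * Q \<and> q\<^sup>2 * q ^ N = w * Q ^ m \<and> q / q ^ N = v / Q ^ m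
      \<and> (\<forall>z. ellfact (z * q) q p N = ellfact (z * w) Q p m * ellfact (z * v) Q p m')
      \<and> (\<forall>z n. ellfact (z * q) q p (2 * n) = ellfact (z * w) Q p n * ellfact (z * v) Q p n)
      \<and> (\<forall>z. gen z \<longrightarrow> gen (z * w)) \<and> (\<forall>z. gen z \<longrightarrow> gen (z * v))"
  proof cases
    case 1
    then show ?thesis
      using q_nonzero gen_mult_q gen_power[of _ 2] mult.commute[of Q q] by (simp add: double pw)
  next
    case 2
    have odd: "ellfact (z * q) q p (Suc (2 * m')) = ellfact (z * q) Q p (Suc m') * ellfact (z * Q) Q p m'" for z
      unfolding ellfact_Suc[of _ _ _ "2 * m'"] double ellfact_Suc[of _ _ _ m'] pw by (simp add: mult_ac)
    have "Q * q ^ Suc (2 * m') = q * Q ^ Suc m'"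
      by (simp add: pw mult.left_commute[of Q q])
    moreover have "q / q ^ Suc (2 * m') = Q / Q ^ Suc m'"
      using q_nonzero by (simp add: pw)
    ultimately show ?thesis
      using 2 q_nonzero gen_mult_q gen_power[of _ 2] mult.commute[of Q q]
      by (simp add: odd double del: power_Suc)
  qed
  then show "N = m + m'" "w \<noteq> 0" "v \<noteq> 0" "w * v = q * Q" "q\<^sup>2 * q ^ N = w * Q ^ m" "q / q ^ N = v / Q ^ m"
    "\<And>z. ellfact (z * q) q p N = ellfact (z * w) Q p m * ellfact (z * v) Q p m'"
    "\<And>z n. ellfact (z * q) q p (2 * n) = ellfact (z * w) Q p n * ellfact (z * v) Q p n"
    "\<And>z. gen z \<Longrightarrow> gen (z * w)" "\<And>z. gen z \<Longrightarrow> gen (z * v)"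
    by blast+
qed

definition rhs :: "nat \<Rightarrow> complex \<Rightarrow> (nat \<Rightarrow> complex) \<Rightarrow> (nat \<Rightarrow> complex) \<Rightarrow> complex \<Rightarrow> complex \<Rightarrow> nat \<Rightarrow> complex" where
  "rhs r a b x w v m = (\<Prod>i=1..r. ellfact (a * x i * w) Q p m / ellfact (Q / (v * a * x i)) Q p m)
     * (\<Prod>i=1..r+2. ellfact (b i * Q / (v * a)) Q p m / ellfact (a * w / b i) Q p m)"

lemma tendsto_rhs:
  assumes A: "(A \<longlongrightarrow> a) F" and B: "\<And>i. i \<in> {1..r+2} \<Longrightarrow> ((\<lambda>u. B u i) \<longlongrightarrow> b i) F"
    and nz: "a \<noteq> 0" "v \<noteq> 0" "w \<noteq> 0" "\<And>i. i \<in> {1..r} \<Longrightarrow> x i \<noteq> 0" "\<And>i. i \<in> {1..r+2} \<Longrightarrow> b i \<noteq> 0"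
    and den: "\<And>i. i \<in> {1..r+2} \<Longrightarrow> ellfact (a * w / b i) Q p m \<noteq> 0"
      "\<And>i. i \<in> {1..r} \<Longrightarrow> ellfact (Q / (v * a * x i)) Q p m \<noteq> 0"
  shows "((\<lambda>u. rhs r (A u) (B u) x w v m) \<longlongrightarrow> rhs r a b x w v m) F"
  unfolding rhs_def
  by (intro tendsto_mult tendsto_divide tendsto_prod tendsto_const tendsto_ellfact tendsto_theta A B;
      use nz q_nonzero den in auto)

text \<open>One side has runs of lengths n_i and M, the other of length m; the exchange rules
  convert between them. Every i \<le> r costs a factor Q^{-m n_i}, and the last two parameters
  together return Q^{mM}.\<close>

lemma rhs_rectangular:
  fixes n :: "nat \<Rightarrow> nat"
  assumes par: "parity N w v m m'"
    and x: "\<And>i. i \<in> {1..r} \<Longrightarrow> x i \<noteq> 0" and nz: "a \<noteq> 0" "b (r + 1) \<noteq> 0"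
    and gx: "\<And>i. i \<in> {1..r} \<Longrightarrow> gen (a * x i)"
    and gb: "gen (a / b (r + 1))"
    and b: "\<And>i. i \<in> {1..r} \<Longrightarrow> b i = 1 / (x i * Q ^ n i)"
  defines "M \<equiv> (\<Sum>i=1..r. n i)"
  assumes bal: "b (r + 1) * b (r + 2) = a\<^sup>2 * q * Q ^ M"
  shows "(\<Prod>i=1..r. ellfact (a * x i * q) q p (2 * n i)
         / (ellfact (a * x i * q\<^sup>2 / (1 / q ^ N)) Q p (n i) * ellfact (a * x i * q * (1 / q ^ N)) Q p (n i)))
      * (ellfact (a * q\<^sup>2 / (b (r + 1) * (1 / q ^ N))) Q p M * ellfact (a * q * (1 / q ^ N) / b (r + 1)) Q p M
        / ellfact (a * q / b (r + 1)) q p (2 * M)) = rhs r a b x w v m"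
proof -
  note pf = parity_facts[OF par]
  define \<beta> where "\<beta> = b (r + 1)"
  have \<beta>: "\<beta> \<noteq> 0" using nz by (simp add: \<beta>_def)
  have \<beta>': "b (r + 2) = a\<^sup>2 * q * Q ^ M / \<beta>"
    using bal nz by (simp add: \<beta>_def field_simps)
  have 1: "ellfact (a * x i * w) Q p m / ellfact (Q / (v * a * x i)) Q p m
      * (ellfact (b i * Q / (v * a)) Q p m / ellfact (a * w / b i) Q p m)
    = ellfact (a * x i * q) q p (2 * n i)
         / (ellfact (a * x i * q\<^sup>2 / (1 / q ^ N)) Q p (n i) * ellfact (a * x i * q * (1 / q ^ N)) Q p (n i))
      / Q ^ (m * n i)" if i: "i \<in> {1..r}" for i
  proof -
    define z where "z = a * x i"
    have gz: "gen z" using gx[OF i] by (simp add: z_def)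
    have "a * x i * q * (1 / q ^ N) = z * (q / q ^ N)" by (simp add: z_def)
    then have e: "a * x i * q\<^sup>2 / (1 / q ^ N) = z * w * Q ^ m" "a * x i * q * (1 / q ^ N) = z * v / Q ^ m"
      "b i * Q / (v * a) = Q / (z * v * Q ^ n i)" "a * w / b i = z * w * Q ^ n i" "Q / (v * a * x i) = Q / (z * v)"
      unfolding pf(6) using pf(5) b[OF i] x[OF i] by (simp_all add: z_def mult_ac)
    have "ellfact (a * x i * w) Q p m / ellfact (Q / (v * a * x i)) Q p m
        * (ellfact (b i * Q / (v * a)) Q p m / ellfact (a * w / b i) Q p m)
      = (ellfact (Q / (z * v * Q ^ n i)) Q p m / ellfact (Q / (z * v)) Q p m)
        * (ellfact (z * w) Q p m / ellfact (z * w * Q ^ n i) Q p m)"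
      unfolding e z_def[symmetric] by simp
    then show ?thesis
      unfolding ellfact_reflect_ratio[OF pf(10)[OF gz]] ellfact_swap_ratio[OF pf(9)[OF gz], of m "n i"]
      unfolding e unfolding z_def[symmetric] pf(8) by (simp add: mult_ac)
  qed
  have 2: "ellfact (b (r + 1) * Q / (v * a)) Q p m / ellfact (a * w / b (r + 1)) Q p m
       * (ellfact (b (r + 2) * Q / (v * a)) Q p m / ellfact (a * w / b (r + 2)) Q p m)
    = (ellfact (a * q\<^sup>2 / (b (r + 1) * (1 / q ^ N))) Q p M * ellfact (a * q * (1 / q ^ N) / b (r + 1)) Q p M
        / ellfact (a * q / b (r + 1)) q p (2 * M)) * Q ^ (m * M)"
  proof -
    define z where "z = a / \<beta>"
    have gz: "gen z" using gb by (simp add: z_def \<beta>_def)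
    have wv: "a\<^sup>2 * q * Q = a\<^sup>2 * (w * v)" using pf(4) by simp
    have "a * q * (1 / q ^ N) / \<beta> = z * (q / q ^ N)" by (simp add: z_def)
    then have e: "a * q\<^sup>2 / (\<beta> * (1 / q ^ N)) = z * w * Q ^ m" "a * q * (1 / q ^ N) / \<beta> = z * v / Q ^ m"
      "a * w / \<beta> = z * w" "\<beta> * Q / (v * a) = Q / (z * v)" "a * q / \<beta> = z * q"
      unfolding pf(6) using pf(5) \<beta> nz by (simp_all add: z_def mult_ac)
    have e': "b (r + 2) * Q / (v * a) = z * w * Q ^ M" "a * w / b (r + 2) = Q / (z * v * Q ^ M)"
    proof -
      have "b (r + 2) * Q / (v * a) = a\<^sup>2 * q * Q * Q ^ M / (\<beta> * v * a)"
        unfolding \<beta>' by (simp add: mult_ac)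
      then show "b (r + 2) * Q / (v * a) = z * w * Q ^ M"
        unfolding wv using nz pf(3) by (simp add: z_def power2_eq_square)
      have "Q / (z * v * Q ^ M) = Q * \<beta> * w / (a * (w * v) * Q ^ M)"
        using pf(2) by (simp add: z_def)
      then show "a * w / b (r + 2) = Q / (z * v * Q ^ M)"
        unfolding pf(4) \<beta>' using nz q_nonzero by (simp add: power2_eq_square)
    qed
    have ne: "ellfact (Q / (z * v * Q ^ M)) Q p m \<noteq> 0" "ellfact (Q / (z * v)) Q p m \<noteq> 0" "ellfact (z * w) Q p m \<noteq> 0"
      "ellfact (z * w * Q ^ M) Q p m \<noteq> 0"
      "ellfact (z * v) Q p M \<noteq> 0" "ellfact (z * v / Q ^ m) Q p M \<noteq> 0" "ellfact (z * w) Q p M \<noteq> 0" "ellfact (z * w * Q ^ m) Q p M \<noteq> 0"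
    proof -
      have gQ: "gen (Q / y)" if "gen y" for y
        using gen_power_Q[OF gen_inverse[OF that], of 1] by simp
      have gD: "gen (y / Q ^ j)" if "gen y" for y j
        using gen_divide_power[OF that, of "2 * j"] by (simp add: power_mult)
      show "ellfact (Q / (z * v * Q ^ M)) Q p m \<noteq> 0" "ellfact (Q / (z * v)) Q p m \<noteq> 0" "ellfact (z * w) Q p m \<noteq> 0"
      "ellfact (z * w * Q ^ M) Q p m \<noteq> 0"
      "ellfact (z * v) Q p M \<noteq> 0" "ellfact (z * v / Q ^ m) Q p M \<noteq> 0" "ellfact (z * w) Q p M \<noteq> 0" "ellfact (z * w * Q ^ m) Q p M \<noteq> 0"
        by (intro gen_ellfact_square gQ gD gen_power_Q pf(9,10)[OF gz])+
    qed
    have A: "ellfact (Q / (z * v)) Q p m / ellfact (Q / (z * v * Q ^ M)) Q p m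
      = ellfact (z * v / Q ^ m) Q p M / ellfact (z * v) Q p M * Q ^ (m * M)"
      using ellfact_reflect_ratio[OF pf(10)[OF gz], of M m] ne q_nonzero by (simp add: divide_simps) (simp add: mult_ac)
    have B: "ellfact (z * w * Q ^ M) Q p m / ellfact (z * w) Q p m = ellfact (z * w * Q ^ m) Q p M / ellfact (z * w) Q p M"
      using ellfact_swap_ratio[OF pf(9)[OF gz], of m M] ne by (simp add: divide_simps) (simp add: mult_ac)
    have "ellfact (b (r + 1) * Q / (v * a)) Q p m / ellfact (a * w / b (r + 1)) Q p m
       * (ellfact (b (r + 2) * Q / (v * a)) Q p m / ellfact (a * w / b (r + 2)) Q p m)
      = (ellfact (Q / (z * v)) Q p m / ellfact (Q / (z * v * Q ^ M)) Q p m)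
        * (ellfact (z * w * Q ^ M) Q p m / ellfact (z * w) Q p m)"
      unfolding \<beta>_def[symmetric] e e' by simp
    then show ?thesis
      unfolding A B \<beta>_def[symmetric] e pf(8) by (simp add: mult_ac)
  qed
  have "rhs r a b x w v m = (\<Prod>i=1..r. ellfact (a * x i * w) Q p m / ellfact (Q / (v * a * x i)) Q p m
      * (ellfact (b i * Q / (v * a)) Q p m / ellfact (a * w / b i) Q p m))
    * (ellfact (b (r + 1) * Q / (v * a)) Q p m / ellfact (a * w / b (r + 1)) Q p m
       * (ellfact (b (r + 2) * Q / (v * a)) Q p m / ellfact (a * w / b (r + 2)) Q p m))"
    unfolding rhs_def prod_split_last2 prod.distrib by (simp only: mult.assoc)
  also have "\<dots> = (\<Prod>i=1..r. ellfact (a * x i * q) q p (2 * n i)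
         / (ellfact (a * x i * q\<^sup>2 / (1 / q ^ N)) Q p (n i) * ellfact (a * x i * q * (1 / q ^ N)) Q p (n i)))
      / (\<Prod>i=1..r. Q ^ (m * n i))
      * ((ellfact (a * q\<^sup>2 / (b (r + 1) * (1 / q ^ N))) Q p M * ellfact (a * q * (1 / q ^ N) / b (r + 1)) Q p M
        / ellfact (a * q / b (r + 1)) q p (2 * M)) * Q ^ (m * M))"
    unfolding 2 prod_dividef[symmetric] by (intro arg_cong2[where f = "(*)"] refl prod.cong 1)
  also have "(\<Prod>i=1..r. Q ^ (m * n i)) = Q ^ (m * M)"
    by (simp add: M_def power_sum[symmetric] sum_distrib_left)
  finally show ?thesis
    using q_nonzero by simp
qed

text \<open>Two truncations meet here: c = q^{-N} kills the terms with |k| > N, and the choice of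
  b_i kills those with k_i > n_i. Summing over either index set therefore gives the same
  value.\<close>

lemma base_sum:
  fixes n :: "nat \<Rightarrow> nat"
  assumes par: "parity N w v m m'"
    and x: "\<And>i. i \<in> {1..r} \<Longrightarrow> x i \<noteq> 0" and nz: "a \<noteq> 0" "b (r + 1) \<noteq> 0" and D: "Delta r x p \<noteq> 0"
    and nN: "\<And>i. i \<in> {1..r} \<Longrightarrow> n i \<le> N"
    and dist: "\<And>i j s t. i \<in> {1..r} \<Longrightarrow> j \<in> {1..r} \<Longrightarrow> s \<le> N \<Longrightarrow> t \<le> N \<Longrightarrow> (i, s) \<noteq> (j, t) \<Longrightarrow>
        \<theta> (x i * Q ^ s / (x j * Q ^ t)) \<noteq> 0"
    and gx: "\<And>i. i \<in> {1..r} \<Longrightarrow> gen (a * x i)"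
    and gxx: "\<And>i j. i \<in> {1..r} \<Longrightarrow> j \<in> {1..r} \<Longrightarrow> gen (a\<^sup>2 * x i * x j)"
    and gb: "gen (a / b (r + 1))"
    and b: "\<And>i. i \<in> {1..r} \<Longrightarrow> b i = 1 / (x i * Q ^ n i)"
    and bal: "b (r + 1) * b (r + 2) = a\<^sup>2 * q * Q ^ (\<Sum>i=1..r. n i)"
  shows "(\<Sum>k\<in>multi_indices r N. summand r a b x (1 / q ^ N) k) = rhs r a b x w v m"
proof -
  define c where "c = 1 / q ^ N"
  define KK where "KK = ({1..r} \<rightarrow>\<^sub>E UNIV) \<inter> {k :: nat \<Rightarrow> nat. \<forall>i\<in>{1..r}. k i \<le> n i}"
  have "(\<Sum>k\<in>multi_indices r N. summand r a b x c k) = (\<Sum>k\<in>KK. summand r a b x c k)"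
  proof (rule sum.mono_neutral_cong)
    have "KK \<subseteq> {1..r} \<rightarrow>\<^sub>E {..N}"
    proof
      fix k assume k: "k \<in> KK"
      have "k i \<le> N" if "i \<in> {1..r}" for i
        using k nN[OF that] that unfolding KK_def by fastforce
      then show "k \<in> {1..r} \<rightarrow>\<^sub>E {..N}"
        using k by (auto simp: KK_def PiE_iff)
    qed
    then show "finite KK"
      by (rule finite_subset) (simp add: finite_PiE)
    show "finite (multi_indices r N)" by (rule finite_multi_indices)
    show "summand r a b x c k = 0" if "k \<in> KK - multi_indices r N" for k
    proof -
      have "N < (\<Sum>i=1..r. k i)"
        using that by (auto simp: KK_def multi_indices_def)
      moreover have "\<theta> (c * q ^ N) = 0"
        using q_nonzero by (simp add: c_def)
      ultimately have "ellfact c q p (\<Sum>i=1..r. k i) = 0"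
        unfolding ellfact_eq_0_iff by blast
      then show ?thesis
        unfolding summand_def Let_def by simp
    qed
    show "summand r a b x c k = 0" if kM: "k \<in> multi_indices r N - KK" for k
    proof -
      obtain i where i: "i \<in> {1..r}" "n i < k i"
        using kM by (force simp: KK_def multi_indices_def)
      have "\<theta> (x i * b i * Q ^ n i) = 0"
        using b[OF i(1)] x[OF i(1)] q_nonzero by simp
      then have "ellfact (x i * b i) Q p (k i) = 0"
        unfolding ellfact_eq_0_iff using i(2) by blast
      moreover have "i \<in> {1..r+2}" using i by auto
      ultimately have "(\<Prod>j=1..r+2. ellfact (x i * b j) Q p (k i)) = 0"
        by (intro prod_zero) auto
      then have "(\<Prod>i=1..r.
          \<theta> (a * x i * q ^ ((\<Sum>i=1..r. k i) + 2 * k i)) / \<theta> (a * x i)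
          * (ellfact (a * x i) q p (\<Sum>i=1..r. k i) * (\<Prod>j=1..r+2. ellfact (x i * b j) Q p (k i))
             / (ellfact (a * x i * q\<^sup>2 / c) Q p (k i)
                * ellfact (a * x i * q * c) Q p (k i)
                * (\<Prod>j=1..r. ellfact (Q * x i / x j) Q p (k i))))) = 0"
        by (intro prod_zero bexI[OF _ i(1)]) simp_all
      then show ?thesis
        unfolding summand_def Let_def by (simp only: mult_zero_right)
    qed
  qed simp
  also have "\<dots> = (\<Prod>i=1..r. ellfact (a * x i * q) q p (2 * n i)
         / (ellfact (a * x i * q\<^sup>2 / c) Q p (n i) * ellfact (a * x i * q * c) Q p (n i)))
      * (ellfact (a * q\<^sup>2 / (b (r + 1) * c)) Q p (\<Sum>i=1..r. n i) * ellfact (a * q * c / b (r + 1)) Q p (\<Sum>i=1..r. n i)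
        / ellfact (a * q / b (r + 1)) q p (2 * (\<Sum>i=1..r. n i)))"
    unfolding KK_def
  proof (rule rectangular_sum[where N = N])
    show "gen (a * x i / c)" "gen (a * x i * c)" if "i \<in> {1..r}" for i
      using gen_power[OF gx[OF that], of N] gen_divide_power[OF gx[OF that], of N] by (simp_all add: c_def)
    show "c \<noteq> 0" using q_nonzero by (simp add: c_def)
  qed (fact x nz D nN dist gx gxx gb b bal)+
  also have "\<dots> = rhs r a b x w v m"
    unfolding c_def by (rule rhs_rectangular[OF par x nz gx gb b bal])
  finally show ?thesis by (simp only: c_def)
qed

lemma prod_update_pair:
  fixes h :: "nat \<Rightarrow> complex \<Rightarrow> 'b::comm_monoid_mult"
  assumes "i0 \<in> {1..r}"
  shows "(\<Prod>i=1..r+2. h i ((b(i0 := u, r+2 := u')) i)) = h i0 u * h (r+2) u' * (\<Prod>i\<in>{1..r+2} - {i0, r+2}. h i (b i))"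
proof -
  have "{1..r+2} = insert i0 (insert (r+2) ({1..r+2} - {i0, r+2}))" "i0 \<noteq> r + 2"
    using assms by auto
  then have "(\<Prod>i=1..r+2. h i ((b(i0 := u, r+2 := u')) i))
     = (\<Prod>i\<in>insert i0 (insert (r+2) ({1..r+2} - {i0, r+2})). h i ((b(i0 := u, r+2 := u')) i))"
    by argo
  also have "\<dots> = h i0 u * h (r+2) u' * (\<Prod>i\<in>{1..r+2} - {i0, r+2}. h i ((b(i0 := u, r+2 := u')) i))"
    using \<open>i0 \<noteq> r + 2\<close> by (simp add: mult.assoc)
  also have "(\<Prod>i\<in>{1..r+2} - {i0, r+2}. h i ((b(i0 := u, r+2 := u')) i)) = (\<Prod>i\<in>{1..r+2} - {i0, r+2}. h i (b i))"
    by (intro prod.cong) auto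
  finally show ?thesis .
qed

text \<open>With u in place of b_i and P/u in place of b_{r+2}, multiply by E(u) = (aq/u, aqu/P; q,
  p)_N. A term with |k| = K keeps N - K pairs of E and gains k_i pairs for each i, so its degree is
  N for t = P; on the right the degree is m + m' = N. Of the genericity conditions, the one on P
  x_i^2 separates nodes from reflections, and the others keep E nonzero at the nodes and at
  b_i.\<close>

lemma interpolation_step:
  assumes par: "parity N w v m m'" and i0: "i0 \<in> {1..r}"
    and nz: "a \<noteq> 0" "\<And>i. i \<in> {1..r} \<Longrightarrow> x i \<noteq> 0" "b i0 \<noteq> 0" "b (r + 2) \<noteq> 0"
    and dist: "\<And>s t. s \<le> N \<Longrightarrow> t \<le> N \<Longrightarrow> s \<noteq> t \<Longrightarrow> \<theta> (Q ^ s / Q ^ t) \<noteq> 0"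
  defines "P \<equiv> b i0 * b (r + 2)"
  assumes gen: "gen (a * x i0)" "gen (P * (x i0)\<^sup>2)" "gen (a / (P * x i0))" "gen (a / b i0)" "gen (a / b (r + 2))"
    and node: "\<And>n u. n \<le> N \<Longrightarrow> u = 1 / (x i0 * Q ^ n) \<Longrightarrow>
      (\<Sum>k\<in>multi_indices r N. summand r a (b(i0 := u, r+2 := P / u)) x c k) = rhs r a (b(i0 := u, r+2 := P / u)) x w v m"
  shows "(\<Sum>k\<in>multi_indices r N. summand r a b x c k) = rhs r a b x w v m"
proof -
  note pf = parity_facts[OF par]
  have P: "P \<noteq> 0" using nz by (simp add: P_def)
  have x0: "x i0 \<noteq> 0" using nz i0 by simp
  define b' where "b' = (\<lambda>u. b(i0 := u, r+2 := P / u))"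
  define J where "J = {1..r+2} - {i0, r+2}"
  have split: "(\<Prod>i=1..r+2. h (b' u i)) = h u * h (P / u) * (\<Prod>i\<in>J. h (b i))" for u and h :: "complex \<Rightarrow> complex"
    unfolding b'_def J_def using prod_update_pair[OF i0, of "\<lambda>_. h"] .
  define E where "E = (\<lambda>u. ellfact (a * q / u) q p N * ellfact (a * q / (P / u)) q p N)"
  define cst where "cst = (\<lambda>k. let K = (\<Sum>i=1..r. k i) in
      Delta r (\<lambda>i. x i * q ^ (2 * k i)) p / Delta r x p
      * (ellfact c q p K * ellfact (q / c) q p K / (\<Prod>i\<in>J. ellfact (a * q / b i) q p K))
      * q ^ K
      * (\<Prod>i=1..r.
          \<theta> (a * x i * q ^ (K + 2 * k i)) / \<theta> (a * x i)
          * (ellfact (a * x i) q p K * (\<Prod>j\<in>J. ellfact (x i * b j) Q p (k i))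
             / (ellfact (a * x i * q\<^sup>2 / c) Q p (k i)
                * ellfact (a * x i * q * c) Q p (k i)
                * (\<Prod>j=1..r. ellfact (Q * x i / x j) Q p (k i))))))"
  define F where "F = (\<lambda>u. \<Sum>k\<in>multi_indices r N. cst k *
      ((ellfact (a * q * q ^ (\<Sum>i=1..r. k i) / P * u) q p (N - (\<Sum>i=1..r. k i))
        * ellfact (a * q * q ^ (\<Sum>i=1..r. k i) / P * P / u) q p (N - (\<Sum>i=1..r. k i)))
      * (\<Prod>i=1..r. ellfact (x i * u) Q p (k i) * ellfact (x i * P / u) Q p (k i))))"
  define G where "G = (\<lambda>u. (\<Prod>i=1..r. ellfact (a * x i * w) Q p m / ellfact (Q / (v * a * x i)) Q p m)
     * (\<Prod>i\<in>J. ellfact (b i * Q / (v * a)) Q p m / ellfact (a * w / b i) Q p m)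
     * ((ellfact (Q / (v * a) * u) Q p m * ellfact (Q / (v * a) * P / u) Q p m)
       * (ellfact (a * v / P * u) Q p m' * ellfact (a * v / P * P / u) Q p m')))"
  have S_eq: "(\<Sum>k\<in>multi_indices r N. summand r a (b' u) x c k) * E u = F u" if u: "u \<noteq> 0" and E: "E u \<noteq> 0" for u
    unfolding sum_distrib_right F_def
  proof (intro sum.cong refl)
    fix k assume "k \<in> multi_indices r N"
    define K where "K = (\<Sum>i=1..r. k i)"
    have KN: "K \<le> N" using \<open>k \<in> _\<close> by (simp add: K_def multi_indices_def)
    have e: "ellfact z q p N = ellfact z q p K * ellfact (z * q ^ K) q p (N - K)" for z
      using ellfact_add[of z q p K "N - K"] KN by simp
    have E': "E u = (ellfact (a * q / u) q p K * ellfact (a * q / (P / u)) q p K)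
      * (ellfact (a * q * q ^ K / P * u) q p (N - K) * ellfact (a * q * q ^ K / P * P / u) q p (N - K))"
      unfolding E_def e using P u by (simp add: mult_ac)
    have ne: "ellfact (a * q / u) q p K * ellfact (a * q / (P / u)) q p K \<noteq> 0"
      using E unfolding E' by simp
    have "(\<Prod>i=1..r.
          \<theta> (a * x i * q ^ (K + 2 * k i)) / \<theta> (a * x i)
          * (ellfact (a * x i) q p K * (\<Prod>j=1..r+2. ellfact (x i * b' u j) Q p (k i))
             / (ellfact (a * x i * q\<^sup>2 / c) Q p (k i)
                * ellfact (a * x i * q * c) Q p (k i)
                * (\<Prod>j=1..r. ellfact (Q * x i / x j) Q p (k i)))))
       = (\<Prod>i=1..r.
          \<theta> (a * x i * q ^ (K + 2 * k i)) / \<theta> (a * x i)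
          * (ellfact (a * x i) q p K * (\<Prod>j\<in>J. ellfact (x i * b j) Q p (k i))
             / (ellfact (a * x i * q\<^sup>2 / c) Q p (k i)
                * ellfact (a * x i * q * c) Q p (k i)
                * (\<Prod>j=1..r. ellfact (Q * x i / x j) Q p (k i)))))
        * (\<Prod>i=1..r. ellfact (x i * u) Q p (k i) * ellfact (x i * P / u) Q p (k i))"
      unfolding prod.distrib[symmetric] by (intro prod.cong refl, subst split) (simp add: mult_ac)
    then have "summand r a (b' u) x c k = cst k * (\<Prod>i=1..r. ellfact (x i * u) Q p (k i) * ellfact (x i * P / u) Q p (k i))
       / (ellfact (a * q / u) q p K * ellfact (a * q / (P / u)) q p K)"
      unfolding summand_def cst_def Let_def K_def[symmetric]
      using split[of "\<lambda>z. ellfact (a * q / z) q p K" u] by (simp only: mult_ac times_divide_eq_right times_divide_eq_left divide_divide_eq_left)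
    then show "summand r a (b' u) x c k * E u = cst k *
      ((ellfact (a * q * q ^ (\<Sum>i=1..r. k i) / P * u) q p (N - (\<Sum>i=1..r. k i))
        * ellfact (a * q * q ^ (\<Sum>i=1..r. k i) / P * P / u) q p (N - (\<Sum>i=1..r. k i)))
      * (\<Prod>i=1..r. ellfact (x i * u) Q p (k i) * ellfact (x i * P / u) Q p (k i)))"
      unfolding E' K_def[symmetric] using ne by simp
  qed
  have R_eq: "rhs r a (b' u) x w v m * E u = G u" if u: "u \<noteq> 0" and E: "E u \<noteq> 0" for u
  proof -
    have q: "ellfact (z * q) q p N = ellfact (z * w) Q p m * ellfact (z * v) Q p m'" for z
      by (rule pf(7))
    have E': "E u = (ellfact (a * w / u) Q p m * ellfact (a * w / (P / u)) Q p m)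
       * (ellfact (a * v / P * u) Q p m' * ellfact (a * v / P * P / u) Q p m')"
      using q[of "a / u"] q[of "a / (P / u)"] P unfolding E_def by (simp add: mult_ac)
    have ne: "ellfact (a * w / u) Q p m * ellfact (a * w / (P / u)) Q p m \<noteq> 0"
      using E unfolding E' by simp
    have "rhs r a (b' u) x w v m = (\<Prod>i=1..r. ellfact (a * x i * w) Q p m / ellfact (Q / (v * a * x i)) Q p m)
     * (\<Prod>i\<in>J. ellfact (b i * Q / (v * a)) Q p m / ellfact (a * w / b i) Q p m)
     * (ellfact (Q / (v * a) * u) Q p m * ellfact (Q / (v * a) * P / u) Q p m)
      / (ellfact (a * w / u) Q p m * ellfact (a * w / (P / u)) Q p m)"
      unfolding rhs_def using split[of "\<lambda>z. ellfact (z * Q / (v * a)) Q p m / ellfact (a * w / z) Q p m" u]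
      by (simp add: mult_ac)
    then show ?thesis
      unfolding E' G_def using ne by simp
  qed
  have F_space: "tspace P N F"
    unfolding F_def
  proof (intro tspace_sum tspace_scale)
    fix k assume "k \<in> multi_indices r N"
    then have "N = (N - (\<Sum>i=1..r. k i)) + (\<Sum>i=1..r. k i)"
      by (simp add: multi_indices_def)
    then show "tspace P N (\<lambda>u. (ellfact (a * q * q ^ (\<Sum>i=1..r. k i) / P * u) q p (N - (\<Sum>i=1..r. k i))
        * ellfact (a * q * q ^ (\<Sum>i=1..r. k i) / P * P / u) q p (N - (\<Sum>i=1..r. k i)))
      * (\<Prod>i=1..r. ellfact (x i * u) Q p (k i) * ellfact (x i * P / u) Q p (k i)))"
      by (rule ssubst[where P = "\<lambda>n. tspace P n _"]) (use P nz q_nonzero in \<open>intro tspace_mult tspace_prod tspace_ellfact_pair; simp\<close>)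
  qed
  have G_space: "tspace P N G"
    unfolding G_def pf(1) using P nz pf(2,3) q_nonzero
    by (intro tspace_scale tspace_mult tspace_ellfact_pair) auto
  \<comment> \<open>These are the values of b_i at which the sum is already known, one for each n
    \<le> N; their number N + 1 matches the degree.\<close>
  define nd where "nd = (\<lambda>n. 1 / (x i0 * Q ^ n))"
  define U where "U = nd ` {..N}"
  have ratio: "\<theta> (nd s / nd t) \<noteq> 0" if "s \<le> N" "t \<le> N" "s \<noteq> t" for s t
    using dist[of t s] that x0 by (simp add: nd_def)
  have inj: "inj_on nd {..N}"
  proof (rule inj_onI, rule ccontr)
    fix s t assume st: "s \<in> {..N}" "t \<in> {..N}" "nd s = nd t" "s \<noteq> t"
    have "nd t \<noteq> 0" using x0 q_nonzero by (simp add: nd_def)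
    then show False using ratio[of s t] st by simp
  qed
  have nodes: "nodes P U"
    unfolding nodes_def
  proof (intro conjI ballI)
    show "finite U" "0 \<notin> U" using x0 q_nonzero by (auto simp: U_def nd_def)
    fix u u' assume "u \<in> U" "u' \<in> U"
    then obtain s t where st: "s \<le> N" "t \<le> N" "u = nd s" "u' = nd t" by (auto simp: U_def)
    have "u * u' / P = 1 / (P * (x i0)\<^sup>2 * Q ^ (s + t))"
      by (simp add: st nd_def power2_eq_square power_add mult_ac)
    then show "\<theta> (u * u' / P) \<noteq> 0"
      using gen_theta[OF gen_inverse[OF gen_power_Q[OF gen(2)]]] by simp
    show "u \<noteq> u' \<longrightarrow> \<theta> (u / u') \<noteq> 0"
      using ratio st by auto
  qed
  have card_U: "card U = Suc N" using inj by (simp add: U_def card_image)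
  have FG: "F u = G u" if uU: "u \<in> U" for u
  proof -
    obtain n where n: "n \<le> N" "u = 1 / (x i0 * Q ^ n)" using uU by (auto simp: U_def nd_def)
    have u0: "u \<noteq> 0" using n x0 q_nonzero by simp
    have "a * q / u = a * x i0 * Q ^ n * q" using n by (simp add: mult_ac)
    then have "ellfact (a * q / u) q p N \<noteq> 0"
      using gen_ellfact[OF gen_mult_q[OF gen_power_Q[OF gen(1), of n]]] by simp
    moreover have "a * q / (P / u) = a / (P * x i0) / q ^ (2 * n) * q"
      using n power_mult[of q 2 n] by (simp add: mult_ac)
    then have "ellfact (a * q / (P / u)) q p N \<noteq> 0"
      using gen_ellfact[OF gen_mult_q[OF gen_divide_power[OF gen(3), of "2 * n"]]] by simp
    ultimately have "E u \<noteq> 0"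
      unfolding E_def by simp
    then show ?thesis
      using S_eq[OF u0] R_eq[OF u0] node[OF n] unfolding b'_def by simp
  qed
  have "F (b i0) = G (b i0)"
    by (rule tspace_eqI[OF F_space G_space P nodes card_U nz(3) FG])
  moreover have "E (b i0) \<noteq> 0"
    unfolding E_def using gen_ellfact[OF gen_mult_q[OF gen(4)]] gen_ellfact[OF gen_mult_q[OF gen(5)]] nz
    by (simp add: P_def)
  moreover have "b' (b i0) = b"
    using nz by (simp add: b'_def P_def)
  ultimately show ?thesis
    using S_eq[OF nz(3)] R_eq[OF nz(3)] by (metis mult_right_cancel)
qed

text \<open>Induction on the number j of parameters that already have their final value, while the
  others are still of the form Q^{-n}/x_i. The product \<open>B j\<close> collects what the final
  parameters contribute to the balancing condition, so the genericity conditions can be phrased in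
  the final data alone.\<close>

lemma generic_sum:
  assumes par: "parity N w v m m'"
    and a: "a \<noteq> 0" and x: "\<And>i. i \<in> {1..r} \<Longrightarrow> x i \<noteq> 0" and D: "Delta r x p \<noteq> 0"
    and dist: "\<And>i j s t. i \<in> {1..r} \<Longrightarrow> j \<in> {1..r} \<Longrightarrow> s \<le> N \<Longrightarrow> t \<le> N \<Longrightarrow> (i, s) \<noteq> (j, t) \<Longrightarrow>
        \<theta> (x i * Q ^ s / (x j * Q ^ t)) \<noteq> 0"
    and b0: "\<And>i. i \<in> {1..r+2} \<Longrightarrow> b0 i \<noteq> 0"
    and bal: "a\<^sup>2 * q = (\<Prod>i=1..r+2. b0 i) * (\<Prod>i=1..r. x i)"
    and gx: "\<And>i. i \<in> {1..r} \<Longrightarrow> gen (a * x i)"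
    and gxx: "\<And>i j. i \<in> {1..r} \<Longrightarrow> j \<in> {1..r} \<Longrightarrow> gen (a\<^sup>2 * x i * x j)"
    and gb: "\<And>i. i \<in> {1..r} \<Longrightarrow> gen (a / b0 i)"
  defines "B \<equiv> (\<lambda>j. b0 (r + 1) * (\<Prod>i=1..j. b0 i * x i))"
  assumes gB: "\<And>j. j \<le> r \<Longrightarrow> gen (a / B j)"
    and gxB: "\<And>j. j < r \<Longrightarrow> gen (a\<^sup>2 * x (Suc j) / B j)"
  shows "(\<Sum>k\<in>multi_indices r N. summand r a b0 x (1 / q ^ N) k) = rhs r a b0 x w v m"
proof -
  have B0: "B j \<noteq> 0" if "j \<le> r" for j
    using b0 x that by (auto simp: B_def)
  \<comment> \<open>Both \<open>b\<close> and \<open>n\<close> vary: the nodes of the next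
    interpolation alter one exponent, and b_{r+2} is always determined by the balancing
    condition.\<close>
  have claim: "(\<Sum>k\<in>multi_indices r N. summand r a b x (1 / q ^ N) k) = rhs r a b x w v m"
    if "j \<le> r" "\<And>i. i \<in> {1..j} \<Longrightarrow> b i = b0 i"
      "\<And>i. i \<in> {Suc j..r} \<Longrightarrow> n i \<le> N \<and> b i = 1 / (x i * Q ^ n i)"
      "b (r + 1) = b0 (r + 1)" "b (r + 2) * B j = a\<^sup>2 * q * Q ^ (\<Sum>i=Suc j..r. n i)"
    for j b and n :: "nat \<Rightarrow> nat"
    using that
  proof (induction j arbitrary: b n)
    case 0
    show ?case
    proof (rule base_sum[OF par])
      show "b (r + 1) \<noteq> 0" using 0 b0[of "r + 1"] by simp
      show "gen (a / b (r + 1))" using gB[of 0] 0 by (simp add: B_def)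
      show "b (r + 1) * b (r + 2) = a\<^sup>2 * q * Q ^ sum n {1..r}"
        using 0 by (simp add: B_def mult.commute)
      show "n i \<le> N" "b i = 1 / (x i * Q ^ n i)" if "i \<in> {1..r}" for i
        using 0 that by auto
    qed (fact a x D dist gx gxx)+
  next
    case (Suc j)
    define i0 where "i0 = Suc j"
    define E where "E = (\<Sum>i=Suc (Suc j)..r. n i)"
    define P where "P = b i0 * b (r + 2)"
    have i0: "i0 \<in> {1..r}" using Suc.prems(1) by (simp add: i0_def)
    have bi0: "b i0 = b0 i0" using Suc.prems(2)[of i0] by (simp add: i0_def)
    have nz: "b0 i0 \<noteq> 0" "x i0 \<noteq> 0" "B j \<noteq> 0" using b0[of i0] x[of i0] i0 B0[of j] Suc.prems(1) by auto
    have BS: "B (Suc j) = B j * (b0 i0 * x i0)"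
      by (simp add: B_def i0_def mult.assoc)
    have bE: "b (r + 2) * B (Suc j) = a\<^sup>2 * q * Q ^ E"
      using Suc.prems(5) by (simp add: E_def)
    have b2: "b (r + 2) \<noteq> 0"
      using bE a q_nonzero by auto
    have PB: "P * x i0 * B j = a\<^sup>2 * q * Q ^ E"
      using bE unfolding BS P_def bi0 by (simp add: mult_ac)
    have P: "P = a\<^sup>2 * q * Q ^ E / (x i0 * B j)"
      using PB nz by (simp add: field_simps)
    have gj: "gen (a / B j)" "gen (a / B (Suc j))" "gen (a\<^sup>2 * x i0 / B j)"
      using gB gxB Suc.prems(1) by (auto simp: i0_def)
    show ?case
    proof (rule interpolation_step[OF par i0 a x])
      show "b i0 \<noteq> 0" using bi0 nz by simp
      show "b (r + 2) \<noteq> 0" by (rule b2)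
      show "\<theta> (Q ^ s / Q ^ t) \<noteq> 0" if "s \<le> N" "t \<le> N" "s \<noteq> t" for s t
        using dist[OF i0 i0 that(1,2)] that nz by simp
      show "gen (a * x i0)" using gx i0 by blast
      \<comment> \<open>The auxiliary exponents enter only as a power of Q, which does not affect
        \<open>gen\<close>. The same holds for the two conditions that follow on quotients with
        b_{r+2}.\<close>
      have "b i0 * b (r + 2) * (x i0)\<^sup>2 = a\<^sup>2 * x i0 / B j * q * Q ^ E"
        using nz unfolding P_def[symmetric] P by (simp add: power2_eq_square)
      then show "gen (b i0 * b (r + 2) * (x i0)\<^sup>2)"
        using gen_power_Q[OF gen_mult_q[OF gj(3)]] by simp
      have "a / (b i0 * b (r + 2) * x i0) = 1 / (a / B j * q * Q ^ E)"
        using nz a unfolding P_def[symmetric] P by (simp add: power2_eq_square)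
      then show "gen (a / (b i0 * b (r + 2) * x i0))"
        using gen_inverse[OF gen_power_Q[OF gen_mult_q[OF gj(1)]]] by simp
      show "gen (a / b i0)" using gb[OF i0] bi0 by simp
      have "b (r + 2) = a\<^sup>2 * q * Q ^ E / B (Suc j)"
        using bE B0[of "Suc j"] Suc.prems(1) by (simp add: field_simps)
      then have "a / b (r + 2) = 1 / (a / B (Suc j) * q * Q ^ E)"
        using a by (simp add: power2_eq_square)
      then show "gen (a / b (r + 2))"
        using gen_inverse[OF gen_power_Q[OF gen_mult_q[OF gj(2)]]] by simp
      fix l u assume lu: "l \<le> N" "u = 1 / (x i0 * Q ^ l)"
      let ?b = "b(i0 := u, r + 2 := b i0 * b (r + 2) / u)"
      show "(\<Sum>k\<in>multi_indices r N. summand r a ?b x (1 / q ^ N) k) = rhs r a ?b x w v m"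
      proof (rule Suc.IH[of ?b "n(i0 := l)"])
        show "j \<le> r" using Suc.prems(1) by simp
        show "?b i = b0 i" if "i \<in> {1..j}" for i
          using Suc.prems(1,2) that by (auto simp: i0_def)
        show "(n(i0 := l)) i \<le> N \<and> ?b i = 1 / (x i * Q ^ (n(i0 := l)) i)" if "i \<in> {Suc j..r}" for i
          using Suc.prems(3)[of i] that lu i0 by (cases "i = i0") (auto simp: i0_def)
        show "?b (r + 1) = b0 (r + 1)"
          using Suc.prems(4) i0 by auto
        have sum: "(\<Sum>i=Suc j..r. (n(i0 := l)) i) = l + E"
        proof -
          have "(\<Sum>i=Suc j..r. (n(i0 := l)) i) = (n(i0 := l)) (Suc j) + (\<Sum>i=Suc (Suc j)..r. (n(i0 := l)) i)"
            using Suc.prems(1) by (intro sum.atLeast_Suc_atMost) simp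
          also have "(\<Sum>i=Suc (Suc j)..r. (n(i0 := l)) i) = E"
            unfolding E_def by (intro sum.cong) (auto simp: i0_def)
          finally show ?thesis by (simp add: i0_def)
        qed
        show "?b (r + 2) * B j = a\<^sup>2 * q * Q ^ (\<Sum>i=Suc j..r. (n(i0 := l)) i)"
        proof -
          have "?b (r + 2) * B j = (P * x i0 * B j) * Q ^ l"
            using lu by (simp add: P_def)
          then show ?thesis
            unfolding sum PB by (simp add: power_add)
        qed
      qed
    qed
  qed
  show ?thesis
  proof (rule claim[of r b0 "\<lambda>_. 0"])
    show "b0 (r + 2) * B r = a\<^sup>2 * q * Q ^ (\<Sum>i=Suc r..r. 0)"
      unfolding bal prod_split_last2 by (simp add: B_def prod.distrib mult_ac)
  qed auto
qed

section \<open>Removal of the genericity conditions by a limit\<close>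

lemma countable_not_gen:
  assumes "C \<noteq> 0" "e \<noteq> 0"
  shows "countable {u::real. u > 0 \<and> \<not> gen (C * of_real u powi e)}"
proof -
  define A where "A = (\<lambda>(k, n). {u::real. u > 0 \<and> C * of_real u powi e * q powi k = p powi n})"
  have "{u. u > 0 \<and> \<not> gen (C * of_real u powi e)} \<subseteq> (\<Union>kn. A kn)"
  proof
    fix u :: real assume "u \<in> {u. u > 0 \<and> \<not> gen (C * of_real u powi e)}"
    then have u: "u > 0" "\<not> gen (C * of_real u powi e)" by auto
    then obtain k where "\<theta> (C * of_real u powi e * q powi k) = 0"
      using assms by (auto simp: gen_def)
    moreover have "C * of_real u powi e * q powi k \<noteq> 0"
      using assms u q_nonzero by simp
    ultimately obtain n where "C * of_real u powi e * q powi k = p powi n"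
      using theta_eq_0_iff by blast
    then have "u \<in> A (k, n)" using u by (simp add: A_def)
    then show "u \<in> (\<Union>kn. A kn)" by blast
  qed
  moreover have "countable (\<Union>kn. A kn)"
  proof (intro countable_UN ballI)
    fix kn :: "int \<times> int"
    obtain k n where kn: "kn = (k, n)" by fastforce
    \<comment> \<open>For each (k, n) the equation has at most one positive solution, because u ->
      u^e is injective on positive reals for e \<noteq> 0.\<close>
    have "u = u'" if "u \<in> A kn" "u' \<in> A kn" for u u'
    proof -
      have pos: "u > 0" "u' > 0" using that by (auto simp: A_def kn)
      have "C * of_real u powi e * q powi k = C * of_real u' powi e * q powi k"
        using that by (simp add: A_def kn)
      then have "complex_of_real u powi e = of_real u' powi e"
        using assms q_nonzero by simp
      then have "u powi e = u' powi e"
        by (metis of_real_eq_iff of_real_power_int)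
      then have "u powr (real_of_int e) = u' powr (real_of_int e)"
        using pos by (simp add: powr_real_of_int')
      then show "u = u'"
        using pos assms by (metis ln_inj_iff ln_powr mult_left_cancel of_int_eq_0_iff less_irrefl)
    qed
    then have "A kn \<subseteq> {SOME u. u \<in> A kn}"
      by (metis singleton_iff someI_ex subsetI)
    then show "countable (A kn)"
      by (meson countable_empty countable_insert countable_subset)
  qed auto
  ultimately show ?thesis
    by (rule countable_subset)
qed

text \<open>The perturbation is $a \mapsto a u$, $b_{r+1} \mapsto b_{r+1} u^3$, $b_{r+2} \mapsto b_{r+2}/u$. Each
  genericity condition then contains a nonzero power of $u$, so it fails for countably many $u$ only.\<close>

lemma full_sum:
  assumes par: "parity N w v m m'"
    and a: "a \<noteq> 0" and x: "\<And>i. i \<in> {1..r} \<Longrightarrow> x i \<noteq> 0" and D: "Delta r x p \<noteq> 0"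
    and dist: "\<And>i j s t. i \<in> {1..r} \<Longrightarrow> j \<in> {1..r} \<Longrightarrow> s \<le> N \<Longrightarrow> t \<le> N \<Longrightarrow> (i, s) \<noteq> (j, t) \<Longrightarrow>
        \<theta> (x i * Q ^ s / (x j * Q ^ t)) \<noteq> 0"
    and b: "\<And>i. i \<in> {1..r+2} \<Longrightarrow> b i \<noteq> 0"
    and bal: "a\<^sup>2 * q = (\<Prod>i=1..r+2. b i) * (\<Prod>i=1..r. x i)"
    and den: "\<And>i k. i \<in> {1..r+2} \<Longrightarrow> k \<le> N \<Longrightarrow> ellfact (a * q / b i) q p k \<noteq> 0"
      "\<And>i. i \<in> {1..r} \<Longrightarrow> \<theta> (a * x i) \<noteq> 0"
      "\<And>i k. i \<in> {1..r} \<Longrightarrow> k \<le> N \<Longrightarrow> ellfact (a * x i * q\<^sup>2 / (1 / q ^ N)) Q p k \<noteq> 0"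
      "\<And>i k. i \<in> {1..r} \<Longrightarrow> k \<le> N \<Longrightarrow> ellfact (a * x i * q * (1 / q ^ N)) Q p k \<noteq> 0"
      "\<And>i j k. i \<in> {1..r} \<Longrightarrow> j \<in> {1..r} \<Longrightarrow> k \<le> N \<Longrightarrow> ellfact (Q * x i / x j) Q p k \<noteq> 0"
      "\<And>i. i \<in> {1..r+2} \<Longrightarrow> ellfact (a * w / b i) Q p m \<noteq> 0"
      "\<And>i. i \<in> {1..r} \<Longrightarrow> ellfact (Q / (v * a * x i)) Q p m \<noteq> 0"
  shows "(\<Sum>k\<in>multi_indices r N. summand r a b x (1 / q ^ N) k) = rhs r a b x w v m"
proof -
  define A where "A = (\<lambda>u::real. a * of_real u)"
  \<comment> \<open>The exponent of u in b_{r+1} must differ from 1 and 2, or else a/B_j or a^2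
    x_{j+1}/B_j would not move. With 3 they acquire u^{-2} and u^{-1}, and u^{-1} in b_{r+2}
    restores the balance.\<close>
  define Bb where "Bb = (\<lambda>u::real. b(r + 1 := b (r + 1) * of_real u ^ 3, r + 2 := b (r + 2) / of_real u))"
  define B where "B = (\<lambda>j. b (r + 1) * (\<Prod>i=1..j. b i * x i))"
  define bad where "bad = (\<Union>i\<in>{1..r}. {u. u > 0 \<and> \<not> gen (a * x i * of_real u powi 1)})
    \<union> (\<Union>i\<in>{1..r}. \<Union>j\<in>{1..r}. {u. u > 0 \<and> \<not> gen (a\<^sup>2 * x i * x j * of_real u powi 2)})
    \<union> (\<Union>i\<in>{1..r}. {u. u > 0 \<and> \<not> gen (a / b i * of_real u powi 1)})
    \<union> (\<Union>j\<in>{..r}. {u. u > 0 \<and> \<not> gen (a / B j * of_real u powi (-2))})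
    \<union> (\<Union>j\<in>{..<r}. {u. u > 0 \<and> \<not> gen (a\<^sup>2 * x (Suc j) / B j * of_real u powi (-1))})"
  have B0: "B j \<noteq> 0" if "j \<le> r" for j
    using b x that by (auto simp: B_def)
  have "countable bad"
    unfolding bad_def
    by (intro countable_Un countable_UN countable_not_gen; use a x b B0 in auto)
  have good: "(\<Sum>k\<in>multi_indices r N. summand r (A u) (Bb u) x (1 / q ^ N) k) = rhs r (A u) (Bb u) x w v m"
    if u: "u > 0" "u \<notin> bad" for u
  proof (rule generic_sum[OF par _ x D dist])
    have u0: "complex_of_real u \<noteq> 0" using u by simp
    show "A u \<noteq> 0" using a u by (simp add: A_def)
    show "Bb u i \<noteq> 0" if "i \<in> {1..r+2}" for i
      using b[of i] b[of "r + 1"] b[of "r + 2"] that u by (auto simp: Bb_def)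
    have Bi: "Bb u i = b i" if "i \<in> {1..r}" for i using that by (auto simp: Bb_def)
    have "(\<Prod>i=1..r. Bb u i) = (\<Prod>i=1..r. b i)" by (intro prod.cong refl Bi)
    then have "(\<Prod>i=1..r+2. Bb u i) = (\<Prod>i=1..r+2. b i) * (of_real u)\<^sup>2"
      unfolding prod_split_last2 using u0 by (simp add: Bb_def power2_eq_square power3_eq_cube)
    then show "(A u)\<^sup>2 * q = (\<Prod>i=1..r+2. Bb u i) * (\<Prod>i=1..r. x i)"
      using bal by (simp add: A_def power_mult_distrib mult_ac)
    have g: "\<And>i. i \<in> {1..r} \<Longrightarrow> gen (a * x i * of_real u powi 1)"
      "\<And>i j. i \<in> {1..r} \<Longrightarrow> j \<in> {1..r} \<Longrightarrow> gen (a\<^sup>2 * x i * x j * of_real u powi 2)"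
      "\<And>i. i \<in> {1..r} \<Longrightarrow> gen (a / b i * of_real u powi 1)"
      "\<And>j. j \<le> r \<Longrightarrow> gen (a / B j * of_real u powi (-2))"
      "\<And>j. j < r \<Longrightarrow> gen (a\<^sup>2 * x (Suc j) / B j * of_real u powi (-1))"
      using u unfolding bad_def Un_iff UN_iff mem_Collect_eq by (auto simp del: power_int_1_right)
    show "gen (A u * x i)" if "i \<in> {1..r}" for i
      using g(1)[OF that] by (simp add: A_def mult_ac)
    show "gen ((A u)\<^sup>2 * x i * x j)" if "i \<in> {1..r}" "j \<in> {1..r}" for i j
      using g(2)[OF that] by (simp add: A_def power_mult_distrib mult_ac)
    show "gen (A u / Bb u i)" if "i \<in> {1..r}" for i
      using g(3)[OF that] Bi[OF that] by (simp add: A_def mult_ac)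
    have BB: "Bb u (r + 1) * (\<Prod>i=1..j. Bb u i * x i) = B j * of_real u ^ 3" if "j \<le> r" for j
    proof -
      have "(\<Prod>i=1..j. Bb u i * x i) = (\<Prod>i=1..j. b i * x i)"
        using that by (intro prod.cong refl) (simp add: Bi)
      then show ?thesis by (simp add: Bb_def B_def mult_ac)
    qed
    show "gen (A u / (Bb u (r + 1) * (\<Prod>i=1..j. Bb u i * x i)))" if "j \<le> r" for j
    proof -
      have "A u / (B j * of_real u ^ 3) = a / B j * of_real u powi (-2)"
        using u0 by (simp add: A_def power_int_minus divide_inverse power2_eq_square power3_eq_cube)
      then show ?thesis using g(4)[OF that] BB[OF that] by simp
    qed
    show "gen ((A u)\<^sup>2 * x (Suc j) / (Bb u (r + 1) * (\<Prod>i=1..j. Bb u i * x i)))" if "j < r" for j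
    proof -
      have "(A u)\<^sup>2 * x (Suc j) / (B j * of_real u ^ 3) = a\<^sup>2 * x (Suc j) / B j * of_real u powi (-1)"
        using u0 by (simp add: A_def power_int_minus power2_eq_square power3_eq_cube field_simps)
      then show ?thesis using g(5)[OF that] BB[of j] that by simp
    qed
  qed
  \<comment> \<open>An interval is uncountable, so good parameters exist arbitrarily close to
    1.\<close>
  have ex: "\<exists>u. 1 < u \<and> u < 1 + 1 / real (Suc n) \<and> u \<notin> bad" for n
  proof (rule ccontr)
    assume "\<not> ?thesis"
    then have "{1<..<1 + 1 / real (Suc n)} \<subseteq> bad" by auto
    then show False
      using \<open>countable bad\<close> countable_subset uncountable_open_interval[of 1 "1 + 1 / real (Suc n)"] by fastforce
  qed
  define U where "U = (\<lambda>n. SOME u. 1 < u \<and> u < 1 + 1 / real (Suc n) \<and> u \<notin> bad)"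
  have U: "1 < U n" "U n < 1 + 1 / real (Suc n)" "U n \<notin> bad" for n
    using someI_ex[OF ex[of n]] unfolding U_def by blast+
  have "U \<longlonglongrightarrow> 1"
  proof (rule tendsto_sandwich[of "\<lambda>_. 1" U sequentially "\<lambda>n. 1 + 1 / real (Suc n)" 1])
    show "(\<lambda>n. 1 + 1 / real (Suc n)) \<longlonglongrightarrow> 1"
      using LIMSEQ_inverse_real_of_nat_add[of 1] by (simp add: inverse_eq_divide)
  qed (use U in \<open>auto intro!: always_eventually less_imp_le simp del: of_nat_Suc\<close>)
  then have U': "(\<lambda>n. complex_of_real (U n)) \<longlonglongrightarrow> 1"
    using tendsto_of_real by fastforce
  have A_lim: "(\<lambda>n. A (U n)) \<longlonglongrightarrow> a"
    unfolding A_def using tendsto_mult[OF tendsto_const[of a] U'] by simp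
  have B_lim: "(\<lambda>n. Bb (U n) i) \<longlonglongrightarrow> b i" for i
  proof -
    have "(\<lambda>n. b (r + 1) * of_real (U n) ^ 3) \<longlonglongrightarrow> b (r + 1) * 1 ^ 3"
      by (intro tendsto_intros U')
    moreover have "(\<lambda>n. b (r + 2) / of_real (U n)) \<longlonglongrightarrow> b (r + 2) / 1"
      by (intro tendsto_intros U') simp
    ultimately show ?thesis
      unfolding Bb_def by (cases "i = r + 1"; cases "i = r + 2") auto
  qed
  have "(\<lambda>n. \<Sum>k\<in>multi_indices r N. summand r (A (U n)) (Bb (U n)) x (1 / q ^ N) k)
    \<longlonglongrightarrow> (\<Sum>k\<in>multi_indices r N. summand r a b x (1 / q ^ N) k)"
  proof (rule tendsto_sum)
    fix k assume k: "k \<in> multi_indices r N"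
    \<comment> \<open>All lengths occurring in the summand are at most N, the range in which the
      denominators are assumed nonzero; so the limit may be taken factor by factor.\<close>
    then have KN: "(\<Sum>i=1..r. k i) \<le> N" by (simp add: multi_indices_def)
    have kN: "k i \<le> N" if "i \<in> {1..r}" for i
      using member_le_sum[of i "{1..r}" k] that KN by simp
    show "(\<lambda>n. summand r (A (U n)) (Bb (U n)) x (1 / q ^ N) k) \<longlonglongrightarrow> summand r a b x (1 / q ^ N) k"
    proof -
      define K where "K = (\<Sum>i=1..r. k i)"
      let ?c = "1 / q ^ N"
      have c0: "?c \<noteq> 0" using q_nonzero by simp
      have Ax: "((\<lambda>u. A (U u) * x i) \<longlongrightarrow> a * x i) sequentially" "a * x i \<noteq> 0" if "i \<in> {1..r}" for i
        using a x[OF that] by (simp_all add: A_lim tendsto_mult_right)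
      have 1: "((\<lambda>u. \<Prod>i=1..r+2. ellfact (A (U u) * q / Bb (U u) i) q p K) \<longlongrightarrow> (\<Prod>i=1..r+2. ellfact (a * q / b i) q p K)) sequentially"
      proof (rule tendsto_prod)
        fix i assume i: "i \<in> {1..r+2}"
        have "((\<lambda>u. A (U u) * q / Bb (U u) i) \<longlongrightarrow> a * q / b i) sequentially"
          by (rule tendsto_divide[OF tendsto_mult_right[OF A_lim] B_lim[of i] b[OF i]])
        then show "((\<lambda>u. ellfact (A (U u) * q / Bb (U u) i) q p K) \<longlongrightarrow> ellfact (a * q / b i) q p K) sequentially"
          by (rule tendsto_ellfact) (simp_all add: a b[OF i] q_nonzero)
      qed
      have 2: "(\<Prod>i=1..r+2. ellfact (a * q / b i) q p K) \<noteq> 0"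
        unfolding K_def using den(1)[OF _ KN] by (simp only: prod_zero_iff finite_atLeastAtMost) blast
      have 3: "((\<lambda>u. \<theta> (A (U u) * x i * q ^ (K + 2 * k i)) / \<theta> (A (U u) * x i)
              * (ellfact (A (U u) * x i) q p K * (\<Prod>j=1..r+2. ellfact (x i * Bb (U u) j) Q p (k i))
                 / (ellfact (A (U u) * x i * q\<^sup>2 / ?c) Q p (k i)
                    * ellfact (A (U u) * x i * q * ?c) Q p (k i)
                    * (\<Prod>j=1..r. ellfact (Q * x i / x j) Q p (k i)))))
          \<longlongrightarrow> \<theta> (a * x i * q ^ (K + 2 * k i)) / \<theta> (a * x i)
              * (ellfact (a * x i) q p K * (\<Prod>j=1..r+2. ellfact (x i * b j) Q p (k i))
                 / (ellfact (a * x i * q\<^sup>2 / ?c) Q p (k i)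
                    * ellfact (a * x i * q * ?c) Q p (k i)
                    * (\<Prod>j=1..r. ellfact (Q * x i / x j) Q p (k i))))) sequentially" if i: "i \<in> {1..r}" for i
      proof -
        note Ai = Ax[OF i]
        have "((\<lambda>u. \<theta> (A (U u) * x i * q ^ (K + 2 * k i))) \<longlongrightarrow> \<theta> (a * x i * q ^ (K + 2 * k i))) sequentially"
          by (rule tendsto_theta[OF tendsto_mult_right[OF Ai(1)]]) (simp add: Ai(2)[simplified] q_nonzero)
        note t1 = tendsto_divide[OF this tendsto_theta[OF Ai] den(2)[OF i]]
        note t2 = tendsto_ellfact[OF Ai q_nonzero, of K]
        have t3: "((\<lambda>u. \<Prod>j=1..r+2. ellfact (x i * Bb (U u) j) Q p (k i)) \<longlongrightarrow> (\<Prod>j=1..r+2. ellfact (x i * b j) Q p (k i))) sequentially"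
        proof (rule tendsto_prod)
          fix j assume j: "j \<in> {1..r+2}"
          show "((\<lambda>u. ellfact (x i * Bb (U u) j) Q p (k i)) \<longlongrightarrow> ellfact (x i * b j) Q p (k i)) sequentially"
            by (rule tendsto_ellfact[OF tendsto_mult_left[OF B_lim[of j]]]) (simp_all add: x[OF i] b[OF j] q_nonzero)
        qed
        have t4: "((\<lambda>u. ellfact (A (U u) * x i * q\<^sup>2 / ?c) Q p (k i)) \<longlongrightarrow> ellfact (a * x i * q\<^sup>2 / ?c) Q p (k i)) sequentially"
          by (rule tendsto_ellfact[OF tendsto_divide[OF tendsto_mult_right[OF Ai(1)] tendsto_const c0]])
            (simp_all add: Ai(2)[simplified] c0 q_nonzero)
        have t5: "((\<lambda>u. ellfact (A (U u) * x i * q * ?c) Q p (k i)) \<longlongrightarrow> ellfact (a * x i * q * ?c) Q p (k i)) sequentially"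
          by (rule tendsto_ellfact[OF tendsto_mult_right[OF tendsto_mult_right[OF Ai(1)]]])
            (simp_all add: Ai(2)[simplified] c0 q_nonzero)
        have "(\<Prod>j=1..r. ellfact (Q * x i / x j) Q p (k i)) \<noteq> 0"
          using den(5)[OF i _ kN[OF i]] by (simp only: prod_zero_iff finite_atLeastAtMost) blast
        then have nz6: "ellfact (a * x i * q\<^sup>2 / ?c) Q p (k i) * ellfact (a * x i * q * ?c) Q p (k i)
            * (\<Prod>j=1..r. ellfact (Q * x i / x j) Q p (k i)) \<noteq> 0"
          using den(3,4)[OF i kN[OF i]] by (simp only: mult_eq_0_iff) blast
        show ?thesis
          by (rule tendsto_mult[OF t1 tendsto_divide[OF tendsto_mult[OF t2 t3] tendsto_mult[OF tendsto_mult[OF t4 t5] tendsto_const] nz6]])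
      qed
      show ?thesis
        unfolding summand_def Let_def K_def[symmetric]
        by (rule tendsto_mult[OF tendsto_mult[OF tendsto_mult[OF tendsto_const tendsto_divide[OF tendsto_const 1 2]] tendsto_const]
            tendsto_prod[OF 3]])
    qed
  qed
  moreover have "(\<lambda>n. rhs r (A (U n)) (Bb (U n)) x w v m) \<longlonglongrightarrow> rhs r a b x w v m"
    by (intro tendsto_rhs A_lim B_lim a x b den parity_facts[OF par])
  moreover have "(\<Sum>k\<in>multi_indices r N. summand r (A (U n)) (Bb (U n)) x (1 / q ^ N) k)
      = rhs r (A (U n)) (Bb (U n)) x w v m" for n
    using good[of "U n"] U(1)[of n] U(3)[of n] by simp
  ultimately show ?thesis
    using LIMSEQ_unique by simp
qed

end

section \<open>The summation formula in its original parameters\<close>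

theorem corollary4p6:
  fixes p q a :: complex and b x :: "nat \<Rightarrow> complex" and r N :: nat
  assumes "norm p < 1" and "q \<noteq> 0"
    and "\<And>k n. k > 0 \<Longrightarrow> q ^ k \<noteq> p powi n"
    and "r \<ge> 1"
    and "a \<noteq> 0"
    and "\<And>i. i \<in> {1..r+2} \<Longrightarrow> b i \<noteq> 0"
    and "\<And>i. i \<in> {1..r} \<Longrightarrow> x i \<noteq> 0"
    and "a\<^sup>2 * q = (\<Prod>i=1..r+2. b i) * (\<Prod>i=1..r. x i)"
    \<comment> \<open>no denominator on the left-hand side vanishes\<close>
    and "Delta r x p \<noteq> 0"
    and "\<And>i k. i \<in> {1..r+2} \<Longrightarrow> k \<le> N \<Longrightarrow> ellfact (a * q / b i) q p k \<noteq> 0"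
    and "\<And>i. i \<in> {1..r} \<Longrightarrow> theta (a * x i) p \<noteq> 0"
    and "\<And>i k. i \<in> {1..r} \<Longrightarrow> k \<le> N \<Longrightarrow> ellfact (a * x i * q ^ (N + 2)) (q\<^sup>2) p k \<noteq> 0"
    and "\<And>i k. i \<in> {1..r} \<Longrightarrow> k \<le> N \<Longrightarrow> ellfact (a * x i * q powi (1 - int N)) (q\<^sup>2) p k \<noteq> 0"
    and "\<And>i j k. i \<in> {1..r} \<Longrightarrow> j \<in> {1..r} \<Longrightarrow> k \<le> N \<Longrightarrow> ellfact (q\<^sup>2 * x i / x j) (q\<^sup>2) p k \<noteq> 0"
    \<comment> \<open>no denominator on the right-hand side vanishes\<close>
    and "\<And>i m. N = 2 * m \<Longrightarrow> i \<in> {1..r} \<Longrightarrow> ellfact (q / (a * x i)) (q\<^sup>2) p m \<noteq> 0"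
    and "\<And>i m. N = 2 * m \<Longrightarrow> i \<in> {1..r+2} \<Longrightarrow> ellfact (a * q\<^sup>2 / b i) (q\<^sup>2) p m \<noteq> 0"
    and "\<And>i m. N + 1 = 2 * m \<Longrightarrow> i \<in> {1..r} \<Longrightarrow> ellfact (1 / (a * x i)) (q\<^sup>2) p m \<noteq> 0"
    and "\<And>i m. N + 1 = 2 * m \<Longrightarrow> i \<in> {1..r+2} \<Longrightarrow> ellfact (a * q / b i) (q\<^sup>2) p m \<noteq> 0"
  defines "S \<equiv> (\<Sum>k\<in>multi_indices r N. let K = (\<Sum>i=1..r. k i) in
      Delta r (\<lambda>i. x i * q ^ (2 * k i)) p / Delta r x p
      * (ellfact (q powi (- int N)) q p K * ellfact (q ^ (N + 1)) q p K
         / (\<Prod>i=1..r+2. ellfact (a * q / b i) q p K))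
      * q ^ K
      * (\<Prod>i=1..r.
          theta (a * x i * q ^ (K + 2 * k i)) p / theta (a * x i) p
          * (ellfact (a * x i) q p K * (\<Prod>j=1..r+2. ellfact (x i * b j) (q\<^sup>2) p (k i))
             / (ellfact (a * x i * q ^ (N + 2)) (q\<^sup>2) p (k i)
                * ellfact (a * x i * q powi (1 - int N)) (q\<^sup>2) p (k i)
                * (\<Prod>j=1..r. ellfact (q\<^sup>2 * x i / x j) (q\<^sup>2) p (k i))))))"
  shows "(\<forall>m. N = 2 * m \<longrightarrow>
            S = (\<Prod>i=1..r. ellfact (a * x i * q\<^sup>2) (q\<^sup>2) p m / ellfact (q / (a * x i)) (q\<^sup>2) p m)
                * (\<Prod>i=1..r+2. ellfact (b i * q / a) (q\<^sup>2) p m / ellfact (a * q\<^sup>2 / b i) (q\<^sup>2) p m))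
       \<and> (\<forall>m. N + 1 = 2 * m \<longrightarrow>
            S = (\<Prod>i=1..r. ellfact (a * x i * q) (q\<^sup>2) p m / ellfact (1 / (a * x i)) (q\<^sup>2) p m)
                * (\<Prod>i=1..r+2. ellfact (b i / a) (q\<^sup>2) p m / ellfact (a * q / b i) (q\<^sup>2) p m))"
proof -
  have x0: "\<And>i. i \<in> {1..r} \<Longrightarrow> x i \<noteq> 0" by (fact assms(7))
  have base: "theta_base p"
    by (rule theta_base.intro) (fact assms(1))
  have ell: "elliptic p q"
  proof (rule elliptic.intro[OF base elliptic_axioms.intro])
    show "q \<noteq> 0" by (fact assms(2))
    show "theta q p \<noteq> 0"
      using assms(3)[of 1] theta_base.theta_eq_0_iff[OF base assms(2)] by auto
  qed
  let ?Q = "q\<^sup>2" and ?\<theta> = "\<lambda>z. theta z p"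
  have c: "q powi (- int N) = 1 / q ^ N" "q / (1 / q ^ N) = q ^ (N + 1)"
    "\<And>z. z * q\<^sup>2 / (1 / q ^ N) = z * q ^ (N + 2)" "\<And>z. z * q * (1 / q ^ N) = z * q powi (1 - int N)"
    using assms(2) by (simp_all add: power_int_minus power_int_diff divide_inverse power_add mult_ac power2_eq_square)
  have S: "S = (\<Sum>k\<in>multi_indices r N. elliptic.summand p q r a b x (1 / q ^ N) k)"
    unfolding S_def elliptic.summand_def[OF ell] c ..
  \<comment> \<open>This is the last factor of (Q x_i/x_j; Q, p)_d, so it is covered by the
    left-hand denominators.\<close>
  have d: "?\<theta> (x i / x j * ?Q ^ d) \<noteq> 0" if "i \<in> {1..r}" "j \<in> {1..r}" "0 < d" "d \<le> N" for i j d
  proof -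
    have "ellfact (q\<^sup>2 * x i / x j) (q\<^sup>2) p d \<noteq> 0"
      using assms(14) that by blast
    then have "?\<theta> (q\<^sup>2 * x i / x j * ?Q ^ (d - 1)) \<noteq> 0"
      using that(3) unfolding ellfact_eq_0_iff by (metis diff_less zero_less_one)
    moreover have "?Q ^ d = ?Q * ?Q ^ (d - 1)"
      using that(3) by (simp flip: power_Suc)
    ultimately show ?thesis by (simp add: mult_ac)
  qed
  \<comment> \<open>Equal exponents are not reached by those denominators; here the nonvanishing of
    \<open>Delta\<close> takes over, for i < j, and theta inversion gives i > j.\<close>
  have d0: "?\<theta> (x i / x j) \<noteq> 0" if "i \<in> {1..r}" "j \<in> {1..r}" "i < j" for i j
  proof
    assume "?\<theta> (x i / x j) = 0"
    then have "Delta r x p = 0"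
      unfolding Delta_def using that by (intro prod_zero bexI[of _ j] bexI[of _ i]) auto
    then show False using assms(9) by simp
  qed
  have inv: "?\<theta> (z / y) \<noteq> 0" if "?\<theta> (y / z) \<noteq> 0" "y \<noteq> 0" "z \<noteq> 0" for y z
    using theta_base.theta_minus_swap[OF base that(3,2)] that by simp
  have dist: "?\<theta> (x i * ?Q ^ s / (x j * ?Q ^ t)) \<noteq> 0"
    if ij: "i \<in> {1..r}" "j \<in> {1..r}" and st: "s \<le> N" "t \<le> N" "(i, s) \<noteq> (j, t)" for i j s t
  proof -
    note nz = assms(2) x0[OF ij(1)] x0[OF ij(2)]
    consider "s < t" | "t < s" | "s = t" "i < j" | "s = t" "j < i"
      using st by force
    then show ?thesis
    proof cases
      case 1
      then have "?Q ^ t = ?Q ^ (t - s) * ?Q ^ s" by (simp flip: power_add)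
      then have "x j * ?Q ^ t / (x i * ?Q ^ s) = x j / x i * ?Q ^ (t - s)" using nz by simp
      then have "?\<theta> (x j * ?Q ^ t / (x i * ?Q ^ s)) \<noteq> 0" using d[OF ij(2,1), of "t - s"] 1 st by simp
      then show ?thesis by (rule inv) (use nz in simp_all)
    next
      case 2
      then have "?Q ^ s = ?Q ^ (s - t) * ?Q ^ t" by (simp flip: power_add)
      then have "x i * ?Q ^ s / (x j * ?Q ^ t) = x i / x j * ?Q ^ (s - t)" using nz by simp
      then show ?thesis using d[OF ij, of "s - t"] 2 st by simp
    next
      case 3
      then show ?thesis using d0[OF ij] nz by simp
    next
      case 4
      then show ?thesis using inv[OF d0[OF ij(2,1)]] nz by simp
    qed
  qed
  have main: "S = elliptic.rhs p q r a b x w v m" if par: "elliptic.parity q N w v m m'"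
    and den: "\<And>i. i \<in> {1..r+2} \<Longrightarrow> ellfact (a * w / b i) ?Q p m \<noteq> 0"
      "\<And>i. i \<in> {1..r} \<Longrightarrow> ellfact (?Q / (v * a * x i)) ?Q p m \<noteq> 0" for w v m m'
    unfolding S
  proof (rule elliptic.full_sum[OF ell par assms(5) x0 assms(9) dist assms(6) assms(8) assms(10) assms(11) _ _ assms(14) den])
    show "ellfact (a * x i * q\<^sup>2 / (1 / q ^ N)) ?Q p k \<noteq> 0" if "i \<in> {1..r}" "k \<le> N" for i k
      unfolding c using assms(12)[OF that] .
    show "ellfact (a * x i * q * (1 / q ^ N)) ?Q p k \<noteq> 0" if "i \<in> {1..r}" "k \<le> N" for i k
      unfolding c using assms(13)[OF that] .
  qed
  show ?thesis
  proof (intro conjI allI impI)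
    fix m assume m: "N = 2 * m"
    have e: "?Q / (q * a * x i) = q / (a * x i)" "b i * ?Q / (q * a) = b i * q / a" for i
      using assms(2) by (simp_all add: power2_eq_square)
    have "S = elliptic.rhs p q r a b x ?Q q m"
      by (rule main[of _ _ m m]) (use m assms(15)[OF m] assms(16)[OF m] in \<open>simp_all add: elliptic.parity_def[OF ell] e\<close>)
    then show "S = (\<Prod>i=1..r. ellfact (a * x i * q\<^sup>2) (q\<^sup>2) p m / ellfact (q / (a * x i)) (q\<^sup>2) p m)
                * (\<Prod>i=1..r+2. ellfact (b i * q / a) (q\<^sup>2) p m / ellfact (a * q\<^sup>2 / b i) (q\<^sup>2) p m)"
      unfolding elliptic.rhs_def[OF ell] e .
  next
    fix m assume m: "N + 1 = 2 * m"
    \<comment> \<open>In the odd case w and v change places and the second run is one shorter, so m'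
      = m - 1; N + 1 = 2m guarantees m > 0.\<close>
    then have m': "m = Suc (m - 1)" by simp
    have e: "?Q / (?Q * a * x i) = 1 / (a * x i)" "b i * ?Q / (?Q * a) = b i / a" for i
      using assms(2) by simp_all
    have "S = elliptic.rhs p q r a b x q ?Q m"
      by (rule main[of _ _ m "m - 1"]) (use m m' assms(17)[OF m] assms(18)[OF m] in \<open>simp_all add: elliptic.parity_def[OF ell] e\<close>)
    then show "S = (\<Prod>i=1..r. ellfact (a * x i * q) (q\<^sup>2) p m / ellfact (1 / (a * x i)) (q\<^sup>2) p m)
                * (\<Prod>i=1..r+2. ellfact (b i / a) (q\<^sup>2) p m / ellfact (a * q / b i) (q\<^sup>2) p m)"
      unfolding elliptic.rhs_def[OF ell] e .
  qed
qed

end
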